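(* Suppose $(\mathcal{C},\mathcal{D})$ is a unital pseudo-Cartan inclusion and $\mathcal{A}\subseteq\mathcal{C}$ is a closed (not necessarily self-adjoint) subalgebra with $\mathcal{D}\subseteq\mathcal{A}\subseteq\mathcal{C}$. Let $C^*(\mathcal{A})$ be the C*-subalgebra of $\mathcal{C}$ generated by $\mathcal{A}$ and $C^*_e(\mathcal{A})$ the C*-envelope of $\mathcal{A}$. Then $C^*(\mathcal{A})=C^*_e(\mathcal{A})$, i.e. $C^*(\mathcal{A})$ together with the inclusion $\mathcal{A}\subseteq C^*(\mathcal{A})$ is a C*-envelope of $\mathcal{A}$.
   Context: A unital inclusion $(\mathcal{C},\mathcal{D})$: C*-algebra $\mathcal{C}$ with C*-subalgebra $\mathcal{D}$ containing the unit of $\mathcal{C}$. $\mathcal{N}(\mathcal{C},\mathcal{D})=\{v: v\mathcal{D}v^*\cup v^*\mathcal{D}v\subseteq\mathcal{D}\}$; regular: span dense. $\mathcal{D}^c$: relative commutant. Ideal intersection property: every nonzero closed ideal of the larger algebra meets the subalgebra nontrivially. Pseudo-Cartan inclusion: regular inclusion with $\mathcal{D}$ and $\mathcal{D}^c$ abelian and both $(\mathcal{C},\mathcal{D}^c)$, $(\mathcal{D}^c,\mathcal{D})$ having the ideal intersection property. *)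

theory Defs
  imports "HOL-Analysis.Analysis"
begin

class scaleC =
  fixes scaleC :: "complex \<Rightarrow> 'a \<Rightarrow> 'a"

class adjoint =
  fixes adj :: "'a \<Rightarrow> 'a"

class cstar_algebra = real_normed_algebra_1 + banach + scaleC + adjoint +
  assumes scaleR_scaleC: "scaleR r x = scaleC (complex_of_real r) x"
  and scaleC_add_right: "scaleC c (x + y) = scaleC c x + scaleC c y"
  and scaleC_add_left: "scaleC (c + d) x = scaleC c x + scaleC d x"
  and scaleC_scaleC: "scaleC c (scaleC d x) = scaleC (c * d) x"
  and scaleC_one: "scaleC 1 x = x"
  and norm_scaleC: "norm (scaleC c x) = cmod c * norm x"
  and mult_scaleC_left: "scaleC c x * y = scaleC c (x * y)"
  and mult_scaleC_right: "x * scaleC c y = scaleC c (x * y)"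
  and adj_adj: "adj (adj x) = x"
  and adj_add: "adj (x + y) = adj x + adj y"
  and adj_mult: "adj (x * y) = adj y * adj x"
  and adj_scaleC: "adj (scaleC c x) = scaleC (cnj c) (adj x)"
  and cstar_identity: "norm (adj x * x) = norm x ^ 2"

definition csubspace :: "'a::cstar_algebra set \<Rightarrow> bool" where
  "csubspace S \<longleftrightarrow> 0 \<in> S \<and> (\<forall>x\<in>S. \<forall>y\<in>S. x + y \<in> S) \<and> (\<forall>c. \<forall>x\<in>S. scaleC c x \<in> S)"

definition csubalgebra :: "'a::cstar_algebra set \<Rightarrow> bool" where
  "csubalgebra S \<longleftrightarrow> csubspace S \<and> (\<forall>x\<in>S. \<forall>y\<in>S. x * y \<in> S)"

definition closed_subalgebra :: "'a::cstar_algebra set \<Rightarrow> bool" where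
  "closed_subalgebra S \<longleftrightarrow> csubalgebra S \<and> closed S"

definition cstar_subalgebra :: "'a::cstar_algebra set \<Rightarrow> bool" where
  "cstar_subalgebra S \<longleftrightarrow> csubalgebra S \<and> closed S \<and> (\<forall>x\<in>S. adj x \<in> S)"

definition cstar_gen :: "'a::cstar_algebra set \<Rightarrow> 'a set" where
  "cstar_gen S = \<Inter>{B. cstar_subalgebra B \<and> S \<subseteq> B}"

definition cspan :: "'a::cstar_algebra set \<Rightarrow> 'a set" where
  "cspan S = \<Inter>{V. csubspace V \<and> S \<subseteq> V}"

definition closed_ideal :: "'a::cstar_algebra set \<Rightarrow> 'a set \<Rightarrow> bool" where
  "closed_ideal B J \<longleftrightarrow> J \<subseteq> B \<and> csubspace J \<and> closed J \<and>
     (\<forall>b\<in>B. \<forall>x\<in>J. b * x \<in> J \<and> x * b \<in> J)"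

definition ideal_intersection_property :: "'a::cstar_algebra set \<Rightarrow> 'a set \<Rightarrow> bool" where
  "ideal_intersection_property B D \<longleftrightarrow>
     (\<forall>J. closed_ideal B J \<and> J \<noteq> {0} \<longrightarrow> J \<inter> D \<noteq> {0})"

definition normalizers :: "'a::cstar_algebra set \<Rightarrow> 'a set" where
  "normalizers D = {v. (\<forall>d\<in>D. v * d * adj v \<in> D \<and> adj v * d * v \<in> D)}"

definition regular_inclusion :: "'a::cstar_algebra set \<Rightarrow> bool" where
  "regular_inclusion D \<longleftrightarrow> closure (cspan (normalizers D)) = UNIV"

definition relative_commutant :: "'a::cstar_algebra set \<Rightarrow> 'a set" where
  "relative_commutant D = {x. \<forall>d\<in>D. x * d = d * x}"

definition abelian :: "'a::cstar_algebra set \<Rightarrow> bool" where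
  "abelian S \<longleftrightarrow> (\<forall>x\<in>S. \<forall>y\<in>S. x * y = y * x)"

text \<open>Unital pseudo-Cartan inclusion (C, D), where C is the whole C*-algebra (the type).\<close>
definition pseudo_cartan :: "'a::cstar_algebra set \<Rightarrow> bool" where
  "pseudo_cartan D \<longleftrightarrow> cstar_subalgebra D \<and> 1 \<in> D \<and> regular_inclusion D \<and>
     abelian D \<and> abelian (relative_commutant D) \<and>
     ideal_intersection_property UNIV (relative_commutant D) \<and>
     ideal_intersection_property (relative_commutant D) D"

text \<open>n x n matrices over a C*-algebra are represented as functions nat => nat => 'a,
 only entries with indices < n being relevant. The norm on M_n(C) is the unique C*-norm,
 given by the square root of the spectral radius of X* X in the algebra M_n(C).\<close>

definition mmul :: "nat \<Rightarrow> (nat \<Rightarrow> nat \<Rightarrow> 'a::cstar_algebra) \<Rightarrow> (nat \<Rightarrow> nat \<Rightarrow> 'a) \<Rightarrow> nat \<Rightarrow> nat \<Rightarrow> 'a" where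
  "mmul n X Y = (\<lambda>i j. \<Sum>k<n. X i k * Y k j)"

definition madj :: "(nat \<Rightarrow> nat \<Rightarrow> 'a::cstar_algebra) \<Rightarrow> nat \<Rightarrow> nat \<Rightarrow> 'a" where
  "madj X = (\<lambda>i j. adj (X j i))"

definition mscalar :: "complex \<Rightarrow> nat \<Rightarrow> nat \<Rightarrow> 'a::cstar_algebra" where
  "mscalar c = (\<lambda>i j. if i = j then scaleC c 1 else 0)"

definition minvertible :: "nat \<Rightarrow> (nat \<Rightarrow> nat \<Rightarrow> 'a::cstar_algebra) \<Rightarrow> bool" where
  "minvertible n X \<longleftrightarrow> (\<exists>Y. \<forall>i<n. \<forall>j<n.
      mmul n X Y i j = mscalar 1 i j \<and> mmul n Y X i j = mscalar 1 i j)"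

definition mspectrum :: "nat \<Rightarrow> (nat \<Rightarrow> nat \<Rightarrow> 'a::cstar_algebra) \<Rightarrow> complex set" where
  "mspectrum n X = {c. \<not> minvertible n (\<lambda>i j. X i j - mscalar c i j)}"

definition mspectral_radius :: "nat \<Rightarrow> (nat \<Rightarrow> nat \<Rightarrow> 'a::cstar_algebra) \<Rightarrow> real" where
  "mspectral_radius n X = Sup (cmod ` mspectrum n X)"

definition mnorm :: "nat \<Rightarrow> (nat \<Rightarrow> nat \<Rightarrow> 'a::cstar_algebra) \<Rightarrow> real" where
  "mnorm n X = sqrt (mspectral_radius n (mmul n (madj X) X))"

definition chom_on :: "'a::cstar_algebra set \<Rightarrow> ('a \<Rightarrow> 'b::cstar_algebra) \<Rightarrow> bool" where
  "chom_on A f \<longleftrightarrow> (\<forall>x\<in>A. \<forall>y\<in>A. f (x + y) = f x + f y \<and> f (x * y) = f x * f y) \<and>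
     (\<forall>c. \<forall>x\<in>A. f (scaleC c x) = scaleC c (f x))"

definition star_hom_on :: "'a::cstar_algebra set \<Rightarrow> ('a \<Rightarrow> 'b::cstar_algebra) \<Rightarrow> bool" where
  "star_hom_on B f \<longleftrightarrow> chom_on B f \<and> (\<forall>x\<in>B. f (adj x) = adj (f x))"

definition completely_isometric_on :: "'a::cstar_algebra set \<Rightarrow> ('a \<Rightarrow> 'b::cstar_algebra) \<Rightarrow> bool" where
  "completely_isometric_on A f \<longleftrightarrow>
     (\<forall>n\<ge>1. \<forall>X. (\<forall>i<n. \<forall>j<n. X i j \<in> A) \<longrightarrow> mnorm n (\<lambda>i j. f (X i j)) = mnorm n X)"

text \<open>A C*-cover of the operator algebra A is a completely isometric homomorphism
 j : A -> B; the cover is the pair (C*(j(A)), j).\<close>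
definition cstar_cover :: "'a::cstar_algebra set \<Rightarrow> ('a \<Rightarrow> 'b::cstar_algebra) \<Rightarrow> bool" where
  "cstar_cover A j \<longleftrightarrow> chom_on A j \<and> completely_isometric_on A j"

text \<open>(C*(iota(A)), iota) is a C*-envelope of A, with the universal property tested against
 all C*-covers taking values in C*-algebras of type 'b (the type 'b is left free, hence
 universally quantified, in theorems).\<close>
definition cstar_envelope :: "'a::cstar_algebra set \<Rightarrow> ('a \<Rightarrow> 'e::cstar_algebra) \<Rightarrow> 'b::cstar_algebra itself \<Rightarrow> bool" where
  "cstar_envelope A \<iota> _ \<longleftrightarrow> cstar_cover A \<iota> \<and>
     (\<forall>j :: 'a \<Rightarrow> 'b. cstar_cover A j \<longrightarrow>
        (\<exists>\<pi> :: 'b \<Rightarrow> 'e. star_hom_on (cstar_gen (j ` A)) \<pi> \<and>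
            \<pi> ` cstar_gen (j ` A) \<subseteq> cstar_gen (\<iota> ` A) \<and>
            (\<forall>a\<in>A. \<pi> (j a) = \<iota> a)))"

end

theory Submission
  imports Defs
begin

text \<open>
  Points of the spectrum of \<open>D\<close> are replaced by decreasing sequences \<open>b\<close> of positive contractions
  in \<open>D\<close>. For a normalizer \<open>v\<close>, one can shrink any such contraction to \<open>d\<close> with \<open>d v d \<approx> \<lambda> d\<^sup>2\<close>: either
  \<open>v\<close> moves the support of \<open>d\<close> off itself, or \<open>v\<close> is locally in \<open>D\<^sup>c\<close> and the ideal intersection property
  of \<open>(D\<^sup>c, D)\<close> makes it locally almost scalar. So for every countable family of normalizers there are
  states \<open>\<omega>\<close> of \<open>C\<close> with \<open>norm (b n * x * b n - \<omega> x * b n ^ 2)\<close> tending to 0. The elements that are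
  locally small near a dense set of points form an ideal meeting \<open>D\<close> trivially, hence vanish; so
  for every nonzero \<open>x\<close> some such state is nonzero at \<open>adj x * x\<close>.

  In the GNS space of such a state, the vectors given by normalizers are pairwise orthogonal or parallel,
  \<open>D\<close> acts diagonally, and for a vector \<open>u\<close> with no vanishing coordinate the values
  \<open>\<langle>a u, u\<rangle>\<close> with \<open>a\<close> in \<open>A\<close> determine all matrix entries of \<open>A\<close>, because \<open>D\<close> is contained in \<open>A\<close>.
  An isometric homomorphism \<open>j\<close> of \<open>A\<close> carries the functional \<open>a \<mapsto> \<langle>a u, u\<rangle>\<close> to one on \<open>j(A)\<close> that extends to a state
  (Hahn-Banach). Its GNS space contains vectors on which \<open>j(a)\<close> has the matrix entries of \<open>a\<close>, and
  isometry on the elements \<open>a d\<close> with \<open>d\<close> in \<open>D\<close> shows that \<open>j(a)\<close> and its adjoint do not leave their closed span. So the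
  representation of \<open>C*(A)\<close> is contained in one of \<open>C*(j(A))\<close>, which gives the *-homomorphism
  \<open>j(a) \<mapsto> a\<close>.
\<close>

text \<open>The obstacle is that \<open>j\<close> is multiplicative only on \<open>A\<close>, while
  a *-homomorphism also has to control the elements \<open>adj (j a)\<close>, about which the
  hypothesis says nothing directly. Equal matrix entries only say that \<open>a\<close> is a
  compression of \<open>j a\<close>, and compressions do not respect products, so the matched
  vectors must span a subspace invariant under all \<open>j a\<close> and \<open>adj (j a)\<close>.
  The missing information is an upper bound for the length of \<open>j a\<close> on a matched
  vector: if it does not exceed the length of \<open>a\<close> on its partner, the entries already
  account for the whole vector. Such a bound concerns norms after cutting by elements of
  \<open>D\<close> that shrink to the point of a normalizer vector, and
  \<open>norm (j a * j d) = norm (a * d)\<close> supplies it; for the adjoint,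
  \<open>norm (d * a)\<close> is used. No Hilbert space is built: elements of the algebra with the
  seminorm of a state stand for vectors, and sequences for limits. What remains is
  \<open>norm x \<le> norm y\<close> for every *-polynomial \<open>x\<close> in elements of
  \<open>A\<close> and the same polynomial \<open>y\<close> in their images; the homomorphism is
  read off from the closure of all such pairs.\<close>

subsection \<open>Elementary facts on C*-algebras\<close>

lemma scaleC_zero_right [simp]: "scaleC c 0 = (0::'a::cstar_algebra)"
  using scaleC_add_right[of c 0 "0::'a"] by simp

lemma scaleC_zero_left [simp]: "scaleC 0 x = 0" for x :: "'a::cstar_algebra"
  using scaleC_add_left[of 0 0 x] by simp

lemma scaleC_minus_right: "scaleC c (- x) = - scaleC c x" for x :: "'a::cstar_algebra"
  using scaleC_add_right[of c x "- x"] minus_unique[of "scaleC c x" "scaleC c (- x)"] by simp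

lemma scaleC_minus_left: "scaleC (- c) x = - scaleC c x" for x :: "'a::cstar_algebra"
  using scaleC_add_left[of c "- c" x] minus_unique[of "scaleC c x" "scaleC (- c) x"] by simp

lemma scaleC_minus1: "scaleC (- 1) x = - x" for x :: "'a::cstar_algebra"
  by (simp add: scaleC_minus_left scaleC_one)

lemma scaleC_diff_right: "scaleC c (x - y) = scaleC c x - scaleC c y" for x y :: "'a::cstar_algebra"
  using scaleC_add_right[of c x "- y"] by (simp add: scaleC_minus_right)

lemma scaleC_diff_left: "scaleC (c - d) x = scaleC c x - scaleC d x" for x :: "'a::cstar_algebra"
  using scaleC_add_left[of c "- d" x] by (simp add: scaleC_minus_left)

lemma adj_0 [simp]: "adj 0 = (0::'a::cstar_algebra)"
  using adj_add[of 0 "0::'a"] by simp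

lemma adj_minus: "adj (- x) = - adj x" for x :: "'a::cstar_algebra"
  using adj_add[of x "- x"] minus_unique[of "adj x" "adj (- x)"] by simp

lemma adj_diff: "adj (x - y) = adj x - adj y" for x y :: "'a::cstar_algebra"
  using adj_add[of x "- y"] by (simp add: adj_minus)

lemma adj_1 [simp]: "adj 1 = (1::'a::cstar_algebra)"
  using adj_mult[of 1 "adj (1::'a)"] by (simp add: adj_adj)

lemma adj_scaleR: "adj (scaleR r x) = scaleR r (adj x)" for x :: "'a::cstar_algebra"
  by (simp add: scaleR_scaleC adj_scaleC)

lemma adj_power: "adj (x ^ n) = adj x ^ n" for x :: "'a::cstar_algebra"
  by (induction n) (simp_all add: adj_mult power_commutes)

lemma norm_adj [simp]: "norm (adj x) = norm x" for x :: "'a::cstar_algebra"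
proof -
  have *: "norm y \<le> norm (adj y)" for y :: 'a
  proof (cases "y = 0")
    case False
    have "norm y * norm y \<le> norm (adj y) * norm y"
      using cstar_identity[of y] norm_mult_ineq[of "adj y" y] by (simp add: power2_eq_square)
    then show ?thesis using False by simp
  qed simp
  show ?thesis using *[of x] *[of "adj x"] by (simp add: adj_adj)
qed

lemma cstar_identity': "norm (x * adj x) = norm x ^ 2" for x :: "'a::cstar_algebra"
  using cstar_identity[of "adj x"] by (simp add: adj_adj)

lemma norm_square_selfadj: "adj x = x \<Longrightarrow> norm (x * x) = norm x ^ 2" for x :: "'a::cstar_algebra"
  using cstar_identity[of x] by simp

lemma adj_eq_0_iff [simp]: "adj x = 0 \<longleftrightarrow> x = 0" for x :: "'a::cstar_algebra"
  by (metis adj_adj adj_0)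

lemma adj_mult_self_eq_0: "adj x * x = 0 \<longleftrightarrow> x = 0" for x :: "'a::cstar_algebra"
  using cstar_identity[of x] by (metis mult_zero_right norm_eq_zero power_eq_0_iff zero_neq_numeral)

lemma norm_mult_le: "norm a \<le> A \<Longrightarrow> norm b \<le> B \<Longrightarrow> norm (a * b) \<le> A * B"
  for a b :: "'a::real_normed_algebra"
  by (rule order_trans[OF norm_mult_ineq mult_mono]) (auto intro: order_trans[OF norm_ge_zero])

text \<open>The explicit formulas are exported because callers need \<open>h\<close> and
  \<open>k\<close> to lie in adjoint-closed subspaces that contain \<open>x\<close>.\<close>

lemma real_imag_decomp:
  fixes x :: "'a::cstar_algebra"
  obtains h k where "adj h = h" "adj k = k" "x = h + scaleC \<i> k"
    "h = scaleR (1/2) (x + adj x)" "k = scaleC (- \<i> / 2) (x - adj x)"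
proof -
  let ?h = "scaleR (1/2) (x + adj x)" and ?k = "scaleC (- \<i> / 2) (x - adj x)"
  have 1: "adj ?h = ?h" by (simp add: adj_scaleR adj_add adj_adj add.commute)
  have 2: "adj ?k = ?k"
    by (simp add: adj_scaleC adj_diff adj_adj scaleC_diff_right scaleC_minus_left)
  have "scaleC \<i> ?k = scaleR (1/2) (x - adj x)"
    by (simp add: scaleC_scaleC scaleR_scaleC)
  then have "?h + scaleC \<i> ?k = scaleR (1/2) (x + adj x + (x - adj x))"
    by (simp only: scaleR_add_right)
  also have "\<dots> = x" using scaleR_half_double[of x] by simp
  finally have 3: "x = ?h + scaleC \<i> ?k" by simp
  show thesis by (rule that[OF 1 2 3 refl refl])
qed

lemma bounded_linear_adj: "bounded_linear (adj :: 'a::cstar_algebra \<Rightarrow> 'a)"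
  by (rule bounded_linear_intro[where K = 1]) (simp_all add: adj_add adj_scaleR)

lemma bounded_linear_scaleC: "bounded_linear (scaleC c :: 'a::cstar_algebra \<Rightarrow> 'a)"
  by (rule bounded_linear_intro[where K = "cmod c"])
    (simp_all add: scaleC_add_right norm_scaleC scaleR_scaleC scaleC_scaleC mult.commute)

lemmas tendsto_adj [tendsto_intros] = bounded_linear.tendsto[OF bounded_linear_adj]
lemmas tendsto_scaleC_right [tendsto_intros] = bounded_linear.tendsto[OF bounded_linear_scaleC]
lemmas continuous_on_adj [continuous_intros] = bounded_linear.continuous_on[OF bounded_linear_adj]

subsection \<open>Closed subalgebras\<close>

text \<open>Functional calculus is tracked by membership in all such sets: \<open>D\<close> or
  \<open>E\<close> for \<open>S\<close> gives membership there, a commutant gives commutation.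
  Closure under \<open>adj\<close> is not asked because the commutant of a single element need not
  have it.\<close>

definition unital_closed :: "'a::cstar_algebra set \<Rightarrow> bool" where
  "unital_closed S \<longleftrightarrow> closed_subalgebra S \<and> 1 \<in> S"

lemma csubspaceD:
  assumes "csubspace S"
  shows "0 \<in> S" "x \<in> S \<Longrightarrow> y \<in> S \<Longrightarrow> x + y \<in> S" "x \<in> S \<Longrightarrow> scaleC c x \<in> S"
    "x \<in> S \<Longrightarrow> scaleR r x \<in> S" "x \<in> S \<Longrightarrow> - x \<in> S" "x \<in> S \<Longrightarrow> y \<in> S \<Longrightarrow> x - y \<in> S"
    "(\<And>i. i \<in> I \<Longrightarrow> f i \<in> S) \<Longrightarrow> sum f I \<in> S"
proof -
  show 0: "0 \<in> S" and add: "\<And>x y. x \<in> S \<Longrightarrow> y \<in> S \<Longrightarrow> x + y \<in> S"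
    and sc: "\<And>c x. x \<in> S \<Longrightarrow> scaleC c x \<in> S"
    using assms by (auto simp: csubspace_def)
  show "x \<in> S \<Longrightarrow> scaleR r x \<in> S" by (simp add: scaleR_scaleC sc)
  show neg: "\<And>x. x \<in> S \<Longrightarrow> - x \<in> S" using sc[of _ "- 1"] by (simp add: scaleC_minus1)
  show "x \<in> S \<Longrightarrow> y \<in> S \<Longrightarrow> x - y \<in> S" using add[of x "- y"] neg by simp
  show "(\<And>i. i \<in> I \<Longrightarrow> f i \<in> S) \<Longrightarrow> sum f I \<in> S"
    by (induction I rule: infinite_finite_induct) (auto simp: 0 add)
qed

lemma unital_closedD:
  assumes "unital_closed S"
  shows "csubspace S" "closed S" "1 \<in> S" "x \<in> S \<Longrightarrow> y \<in> S \<Longrightarrow> x * y \<in> S" "x \<in> S \<Longrightarrow> x ^ n \<in> S"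
proof -
  show "csubspace S" "closed S" "1 \<in> S" and m: "\<And>x y. x \<in> S \<Longrightarrow> y \<in> S \<Longrightarrow> x * y \<in> S"
    using assms by (auto simp: unital_closed_def closed_subalgebra_def csubalgebra_def)
  then show "x \<in> S \<Longrightarrow> x ^ n \<in> S" by (induction n) auto
qed

lemma unital_closed_commutant: "unital_closed {y :: 'a::cstar_algebra. \<forall>x\<in>X. x * y = y * x}"
proof -
  have "{y. \<forall>x\<in>X. x * y = y * x} = (\<Inter>x\<in>X. {y :: 'a. x * y = y * x})" by auto
  moreover have "closed {y :: 'a. x * y = y * x}" for x
    by (intro closed_Collect_eq continuous_intros)
  ultimately have "closed {y :: 'a. \<forall>x\<in>X. x * y = y * x}" by auto
  then show ?thesis
    unfolding unital_closed_def closed_subalgebra_def csubalgebra_def csubspace_def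
    by (auto simp: algebra_simps mult_scaleC_left mult_scaleC_right) (metis mult.assoc)
qed

subsection \<open>Square roots by the binomial series\<close>

text \<open>Taylor coefficients of sqrt (1 - x) at 0.\<close>

definition sqrt_coeff :: "nat \<Rightarrow> real" where
  "sqrt_coeff n = ((1/2) gchoose n) * (- 1) ^ n"

lemma sqrt_coeff_0 [simp]: "sqrt_coeff 0 = 1"
  by (simp add: sqrt_coeff_def)

lemma sqrt_coeff_Suc: "sqrt_coeff (Suc (Suc n)) = sqrt_coeff (Suc n) * ((real n + 1 - 1/2) / (real n + 2))"
proof -
  have "((1/2::real) gchoose Suc (Suc n)) = ((1/2) gchoose Suc n) * ((1/2 - real (Suc n)) / real (Suc (Suc n)))"
    using gbinomial_mult_1[of "1/2::real" "Suc n"]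
    by (simp only: nonzero_eq_divide_eq times_divide_eq_right) (simp add: algebra_simps)
  then show ?thesis unfolding sqrt_coeff_def by (simp only:) (simp add: field_simps)
qed

lemma sqrt_coeff_Suc_nonpos: "sqrt_coeff (Suc n) \<le> 0"
proof (induction n)
  case 0
  show ?case by (simp add: sqrt_coeff_def)
next
  case (Suc n)
  then show ?case unfolding sqrt_coeff_Suc by (intro mult_nonpos_nonneg) auto
qed

text \<open>All coefficients after the constant one are nonpositive, so for 0 < x < 1 the weighted
  sum of absolute values is at most 1 - sqrt (1 - x); then x tends to 1. Absolute summability at the
  radius of convergence admits every \<open>k\<close> of norm exactly 1.\<close>

lemma sqrt_coeff_partial: "(\<Sum>n<N. \<bar>sqrt_coeff (Suc n)\<bar>) \<le> 1"
proof -
  have *: "(\<Sum>n<N. \<bar>sqrt_coeff (Suc n)\<bar> * x ^ Suc n) \<le> 1" if x: "0 < x" "x < 1" for x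
  proof -
    have "(\<lambda>n. ((1/2) gchoose n) * (- x) ^ n) sums (1 + (- x)) powr (1/2)"
      using x by (intro gen_binomial_real) auto
    moreover have "((1/2) gchoose n) * (- x) ^ n = sqrt_coeff n * x ^ n" for n
      by (simp add: sqrt_coeff_def power_minus[of x])
    ultimately have "(\<lambda>n. sqrt_coeff n * x ^ n) sums (1 - x) powr (1/2)" by simp
    then have "(\<lambda>n. sqrt_coeff (Suc n) * x ^ Suc n) sums ((1 - x) powr (1/2) - 1)"
      by (subst sums_Suc_iff) simp
    then have "(\<lambda>n. - (sqrt_coeff (Suc n) * x ^ Suc n)) sums - ((1 - x) powr (1/2) - 1)"
      by (rule sums_minus)
    moreover have "- (sqrt_coeff (Suc n) * x ^ Suc n) = \<bar>sqrt_coeff (Suc n)\<bar> * x ^ Suc n" for n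
      using sqrt_coeff_Suc_nonpos[of n] by simp
    ultimately have s: "(\<lambda>n. \<bar>sqrt_coeff (Suc n)\<bar> * x ^ Suc n) sums (1 - (1 - x) powr (1/2))" by simp
    have "(\<Sum>n<N. \<bar>sqrt_coeff (Suc n)\<bar> * x ^ Suc n) \<le> 1 - (1 - x) powr (1/2)"
      using s x by (intro sum_le_suminf[of "\<lambda>n. \<bar>sqrt_coeff (Suc n)\<bar> * x ^ Suc n" "{..<N}", unfolded sums_unique[OF s, symmetric]])
        (auto simp: sums_iff)
    also have "\<dots> \<le> 1" by simp
    finally show ?thesis .
  qed
  have "((\<lambda>x. \<Sum>n<N. \<bar>sqrt_coeff (Suc n)\<bar> * x ^ Suc n) \<longlongrightarrow> (\<Sum>n<N. \<bar>sqrt_coeff (Suc n)\<bar> * 1 ^ Suc n)) (at_left 1)"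
    by (intro tendsto_intros)
  moreover have "eventually (\<lambda>x. (\<Sum>n<N. \<bar>sqrt_coeff (Suc n)\<bar> * x ^ Suc n) \<le> 1) (at_left 1)"
    using eventually_at_left_real[of 0 "1::real"] by (rule eventually_mono[OF _ *]) auto
  ultimately have "(\<Sum>n<N. \<bar>sqrt_coeff (Suc n)\<bar> * 1 ^ Suc n) \<le> 1"
    by (rule tendsto_upperbound) simp
  then show ?thesis by simp
qed

lemma summable_sqrt_coeff: "summable (\<lambda>n. \<bar>sqrt_coeff n\<bar>)" "(\<Sum>n. \<bar>sqrt_coeff (Suc n)\<bar>) \<le> 1"
proof -
  have s: "summable (\<lambda>n. \<bar>sqrt_coeff (Suc n)\<bar>)"
    using sqrt_coeff_partial by (intro summableI_nonneg_bounded[where x = 1]) auto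
  then show "summable (\<lambda>n. \<bar>sqrt_coeff n\<bar>)" using summable_Suc_iff by blast
  show "(\<Sum>n. \<bar>sqrt_coeff (Suc n)\<bar>) \<le> 1"
    using s sqrt_coeff_partial by (intro suminf_le_const) auto
qed

text \<open>Vandermonde's identity for 1/2 + 1/2 = 1: the squared series has the coefficients of 1 -
  x.\<close>

lemma sqrt_coeff_convolution:
  "(\<Sum>i\<le>n. sqrt_coeff i * sqrt_coeff (n - i)) = (if n = 0 then 1 else if n = 1 then - 1 else 0)"
proof -
  have "(\<Sum>i\<le>n. sqrt_coeff i * sqrt_coeff (n - i))
      = (\<Sum>i\<in>{0..n}. ((1/2) gchoose i) * ((1/2) gchoose (n - i)) * (- 1) ^ n)"
    unfolding sqrt_coeff_def
    by (rule sum.cong) (auto simp: power_add[symmetric])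
  also have "\<dots> = (1 gchoose n) * (- 1) ^ n"
    using gbinomial_Vandermonde[of "1/2::real" "1/2" n] by (simp add: sum_distrib_right[symmetric])
  also have "(1::real) gchoose n = of_nat (1 choose n)" by (metis binomial_gbinomial of_nat_1)
  finally show ?thesis by (cases n; cases "n - 1") auto
qed

definition sqrt_one_minus :: "'a::cstar_algebra \<Rightarrow> 'a" where
  "sqrt_one_minus k = (\<Sum>n. sqrt_coeff n *\<^sub>R k ^ n)"

context
  fixes k :: "'a::cstar_algebra"
  assumes k: "norm k \<le> 1"
begin

lemma norm_sqrt_term: "norm (sqrt_coeff n *\<^sub>R k ^ n) \<le> \<bar>sqrt_coeff n\<bar>"
proof -
  have "norm (k ^ n) \<le> 1" using k by (meson norm_power_ineq norm_ge_zero order_trans power_le_one)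
  then show ?thesis by (simp add: mult_left_le)
qed

lemma summable_norm_sqrt_series: "summable (\<lambda>n. norm (sqrt_coeff n *\<^sub>R k ^ n))"
  using norm_sqrt_term by (intro summable_comparison_test'[OF summable_sqrt_coeff(1)]) auto

lemma summable_sqrt_series: "summable (\<lambda>n. sqrt_coeff n *\<^sub>R k ^ n)"
  using summable_norm_sqrt_series by (rule summable_norm_cancel)

lemma sqrt_one_minus_square: "sqrt_one_minus k * sqrt_one_minus k = 1 - k"
proof -
  have "sqrt_one_minus k * sqrt_one_minus k
      = (\<Sum>n. \<Sum>i\<le>n. (sqrt_coeff i *\<^sub>R k ^ i) * (sqrt_coeff (n - i) *\<^sub>R k ^ (n - i)))"
    unfolding sqrt_one_minus_def by (intro Cauchy_product summable_norm_sqrt_series)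
  also have "(\<lambda>n. \<Sum>i\<le>n. (sqrt_coeff i *\<^sub>R k ^ i) * (sqrt_coeff (n - i) *\<^sub>R k ^ (n - i)))
      = (\<lambda>n. (if n = 0 then 1 else if n = 1 then - 1 else 0) *\<^sub>R k ^ n)"
  proof
    fix n
    have "(\<Sum>i\<le>n. (sqrt_coeff i *\<^sub>R k ^ i) * (sqrt_coeff (n - i) *\<^sub>R k ^ (n - i)))
        = (\<Sum>i\<le>n. (sqrt_coeff i * sqrt_coeff (n - i)) *\<^sub>R k ^ n)"
      by (rule sum.cong) (auto simp: power_add[symmetric])
    also have "\<dots> = (\<Sum>i\<le>n. sqrt_coeff i * sqrt_coeff (n - i)) *\<^sub>R k ^ n"
      by (rule scaleR_sum_left[symmetric])
    finally show "(\<Sum>i\<le>n. (sqrt_coeff i *\<^sub>R k ^ i) * (sqrt_coeff (n - i) *\<^sub>R k ^ (n - i)))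
        = (if n = 0 then 1 else if n = 1 then - 1 else 0) *\<^sub>R k ^ n"
      by (simp only: sqrt_coeff_convolution)
  qed
  also have "(\<Sum>n. (if n = 0 then 1 else if n = 1 then - 1 else 0) *\<^sub>R k ^ n)
      = (\<Sum>n\<in>{0,1}. (if n = 0 then 1 else if n = 1 then - 1 else 0) *\<^sub>R k ^ n)"
    by (rule suminf_finite) auto
  also have "\<dots> = 1 - k" by simp
  finally show ?thesis .
qed

text \<open>Without the constant term, the coefficients have total absolute value at most 1. The
  bound is positivity of the root, in the sense of \<open>cpos\<close> with T = 1.\<close>

lemma norm_one_minus_sqrt: "norm (1 - sqrt_one_minus k) \<le> 1"
proof -
  have "sqrt_one_minus k = (\<Sum>n. sqrt_coeff (Suc n) *\<^sub>R k ^ Suc n) + 1"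
    unfolding sqrt_one_minus_def using suminf_split_head[OF summable_sqrt_series] by simp
  then have "norm (1 - sqrt_one_minus k) = norm (\<Sum>n. sqrt_coeff (Suc n) *\<^sub>R k ^ Suc n)" by simp
  also have "\<dots> \<le> (\<Sum>n. norm (sqrt_coeff (Suc n) *\<^sub>R k ^ Suc n))"
    by (rule summable_norm[OF summable_ignore_initial_segment[OF summable_norm_sqrt_series, of 1, unfolded Suc_eq_plus1[symmetric]]])
  also have "\<dots> \<le> (\<Sum>n. \<bar>sqrt_coeff (Suc n)\<bar>)"
    by (rule suminf_le[OF norm_sqrt_term
          summable_ignore_initial_segment[OF summable_norm_sqrt_series, of 1, unfolded Suc_eq_plus1[symmetric]]
          summable_ignore_initial_segment[OF summable_sqrt_coeff(1), of 1, unfolded Suc_eq_plus1[symmetric]]])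
  also have "\<dots> \<le> 1" by (rule summable_sqrt_coeff)
  finally show ?thesis .
qed

lemma sqrt_one_minus_in:
  assumes "unital_closed S" "k \<in> S"
  shows "sqrt_one_minus k \<in> S"
proof -
  note S = unital_closedD[OF assms(1)]
  have "(\<lambda>N. \<Sum>n<N. sqrt_coeff n *\<^sub>R k ^ n) \<longlonglongrightarrow> sqrt_one_minus k"
    unfolding sqrt_one_minus_def by (rule summable_LIMSEQ[OF summable_sqrt_series])
  moreover have "(\<Sum>n<N. sqrt_coeff n *\<^sub>R k ^ n) \<in> S" for N
    using assms(2) S by (intro csubspaceD[OF S(1)]) auto
  ultimately show ?thesis by (rule Lim_in_closed_set[OF S(2) always_eventually[OF allI] sequentially_bot, rotated])
qed

lemma adj_sqrt_one_minus: "adj k = k \<Longrightarrow> adj (sqrt_one_minus k) = sqrt_one_minus k"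
  unfolding sqrt_one_minus_def
  by (subst bounded_linear.suminf[OF bounded_linear_adj summable_sqrt_series])
    (simp add: adj_scaleR adj_power)

end

subsection \<open>The positive cone\<close>

text \<open>For z = s + i r, commutation turns \<open>adj z * z\<close> into the sum of the squares,
  and \<open>s\<close> is the real part of z, so its norm is at most that of z.\<close>

lemma norm_le_norm_sum_squares:
  fixes s r :: "'a::cstar_algebra"
  assumes s: "adj s = s" and r: "adj r = r" and comm: "s * r = r * s"
  shows "norm s ^ 2 \<le> norm (s * s + r * r)"
proof -
  define z where "z = s + scaleC \<i> r"
  have az: "adj z = s - scaleC \<i> r"
    by (simp add: z_def adj_add adj_scaleC s r scaleC_minus_left)
  have "adj z * z = s * s + r * r"
    unfolding az by (simp add: z_def algebra_simps mult_scaleC_left mult_scaleC_right scaleC_scaleC scaleC_diff_right comm scaleC_minus1)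
  then have "norm z ^ 2 = norm (s * s + r * r)" using cstar_identity[of z] by simp
  moreover have "norm s \<le> norm z"
  proof -
    have "z + adj z = 2 *\<^sub>R s" unfolding az by (simp add: z_def scaleR_2)
    moreover have "norm (z + adj z) \<le> norm z + norm (adj z)" by (rule norm_triangle_ineq)
    ultimately have "2 * norm s \<le> norm z + norm (adj z)" by simp
    then show ?thesis by simp
  qed
  ultimately show ?thesis by (metis norm_ge_zero power_mono)
qed

text \<open>For self-adjoint \<open>h\<close> the inequality says that the spectrum lies in
  [0, 2 T]. Phrased by norms, closure under sums is just the triangle inequality, and no spectral
  theory is required.\<close>

definition cpos :: "'a::cstar_algebra \<Rightarrow> bool" where
  "cpos h \<longleftrightarrow> adj h = h \<and> (\<exists>T\<ge>0. norm (T *\<^sub>R 1 - h) \<le> T)"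

lemma cpos_adj: "cpos h \<Longrightarrow> adj h = h"
  by (simp add: cpos_def)

lemma cpos_0 [simp]: "cpos 0"
  unfolding cpos_def by (auto intro: exI[of _ 0])

lemma cpos_scaleR: "cpos h \<Longrightarrow> 0 \<le> r \<Longrightarrow> cpos (r *\<^sub>R h)"
  unfolding cpos_def
proof (elim conjE exE, intro conjI)
  fix T assume T: "0 \<le> r" "0 \<le> T" "norm (T *\<^sub>R 1 - h) \<le> T"
  have "norm ((r * T) *\<^sub>R 1 - r *\<^sub>R h) = r * norm (T *\<^sub>R 1 - h)"
    using T(1) by (metis abs_of_nonneg norm_scaleR scaleR_right_diff_distrib scaleR_scaleR)
  then show "\<exists>T\<ge>0. norm (T *\<^sub>R 1 - r *\<^sub>R h) \<le> T"
    using T by (intro exI[of _ "r * T"]) (simp add: mult_left_mono)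
qed (simp add: adj_scaleR)

lemma cpos_add: "cpos g \<Longrightarrow> cpos h \<Longrightarrow> cpos (g + h)"
  unfolding cpos_def
proof (elim conjE exE, intro conjI)
  fix S T assume T: "0 \<le> S" "norm (S *\<^sub>R 1 - g) \<le> S" "0 \<le> T" "norm (T *\<^sub>R 1 - h) \<le> T"
  have eq: "(S + T) *\<^sub>R 1 - (g + h) = (S *\<^sub>R 1 - g) + (T *\<^sub>R 1 - h)" by (simp add: scaleR_add_left)
  then have "norm ((S + T) *\<^sub>R 1 - (g + h)) \<le> S + T"
    unfolding eq using T norm_triangle_ineq[of "S *\<^sub>R 1 - g" "T *\<^sub>R 1 - h"] by linarith
  then show "\<exists>T\<ge>0. norm (T *\<^sub>R 1 - (g + h)) \<le> T"
    using T by (intro exI[of _ "S + T"]) simp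
qed (simp add: adj_add)

lemma cpos_norm_minus: "adj h = h \<Longrightarrow> norm h \<le> N \<Longrightarrow> cpos (N *\<^sub>R 1 - h)"
  unfolding cpos_def
proof
  assume h: "norm h \<le> N"
  have eq: "(2 * N) *\<^sub>R 1 - (N *\<^sub>R 1 - h) = N *\<^sub>R 1 + h" using scaleR_add_left[of N N "1::'a"] by simp
  moreover have "norm (N *\<^sub>R (1::'a) + h) \<le> 2 * N"
    using h norm_triangle_ineq[of "N *\<^sub>R (1::'a)" h] norm_ge_zero[of h] by simp
  ultimately show "\<exists>T\<ge>0. norm (T *\<^sub>R 1 - (N *\<^sub>R 1 - h)) \<le> T"
    using order_trans[OF norm_ge_zero h] by (intro exI[of _ "2 * N"]) (simp only: eq, simp)
qed (simp add: adj_diff adj_scaleR)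

lemma cpos_of_real: "0 \<le> r \<Longrightarrow> cpos (r *\<^sub>R 1)"
  using cpos_norm_minus[of 0 r] by simp

lemma cpos_1 [simp]: "cpos 1"
  using cpos_of_real[of 1] by simp

text \<open>Rescaling gives h = T (1 - k) with \<open>norm k \<le> 1\<close>, where the binomial
  series applies.\<close>

lemma cpos_sqrt:
  assumes "cpos h"
  obtains s where "cpos s" "s * s = h" "\<And>S. unital_closed S \<Longrightarrow> h \<in> S \<Longrightarrow> s \<in> S"
proof -
  from assms obtain T where T: "T \<ge> 0" "norm (T *\<^sub>R 1 - h) \<le> T" and h: "adj h = h"
    by (auto simp: cpos_def)
  show ?thesis
  proof (cases "T = 0")
    case True
    then have "h = 0" using T by simp
    then show ?thesis by (intro that[of 0]) (auto simp: unital_closed_def)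
  next
    case False
    then have T0: "T > 0" using T by simp
    define k where "k = 1 - (1 / T) *\<^sub>R h"
    have "k = (1 / T) *\<^sub>R (T *\<^sub>R 1 - h)" using T0 by (simp add: k_def scaleR_diff_right)
    then have nk: "norm k \<le> 1" using T T0 by simp
    have ak: "adj k = k" by (simp add: k_def adj_diff adj_scaleR h)
    let ?r = "sqrt_one_minus k"
    let ?s = "sqrt T *\<^sub>R ?r"
    show ?thesis
    proof (rule that)
      have "cpos ?r" unfolding cpos_def
        using norm_one_minus_sqrt[OF nk] adj_sqrt_one_minus[OF nk ak] by (auto intro: exI[of _ 1])
      then show "cpos ?s" using T0 by (intro cpos_scaleR) auto
      show "?s * ?s = h"
        using sqrt_one_minus_square[OF nk] T0 by (simp add: k_def)
      fix S assume S: "unital_closed S" "h \<in> S"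
      note S' = unital_closedD[OF S(1)]
      have "k \<in> S" unfolding k_def using S S' csubspaceD[OF S'(1)] by metis
      then show "?s \<in> S" using sqrt_one_minus_in[OF nk S(1)] csubspaceD[OF S'(1)] by metis
    qed
  qed
qed

text \<open>The root r of 1 - s^2 commutes with \<open>s\<close> and the two squares add up to 1, so
  r has norm at most 1.\<close>

lemma norm_one_minus_square:
  fixes s :: "'a::cstar_algebra"
  assumes s: "adj s = s" and n: "norm s \<le> 1"
  shows "norm (1 - s * s) \<le> 1"
proof -
  let ?k = "s * s"
  have nk: "norm ?k \<le> 1" using n by (simp add: norm_square_selfadj[OF s] power_le_one)
  have ak: "adj ?k = ?k" by (simp add: adj_mult s)
  let ?r = "sqrt_one_minus ?k"
  have "?r \<in> {y. \<forall>x\<in>{s}. x * y = y * x}"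
    by (rule sqrt_one_minus_in[OF nk unital_closed_commutant]) (simp add: mult.assoc)
  then have comm: "?r * s = s * ?r" by simp
  have ar: "adj ?r = ?r" by (rule adj_sqrt_one_minus[OF nk ak])
  have "norm ?r ^ 2 \<le> norm (?r * ?r + s * s)"
    by (rule norm_le_norm_sum_squares[OF ar s comm])
  then show ?thesis
    using sqrt_one_minus_square[OF nk] norm_square_selfadj[OF ar] by simp
qed

lemma norm_minus_square:
  fixes s :: "'a::cstar_algebra"
  assumes s: "adj s = s" and T: "norm s ^ 2 \<le> T"
  shows "norm (T *\<^sub>R 1 - s * s) \<le> T"
proof (cases "T = 0")
  case True
  then have "s = 0" using T by simp
  then show ?thesis using True by simp
next
  case False
  then have T0: "T > 0" using T using zero_le_power2[of "norm s"] by linarith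
  define t where "t = (1 / sqrt T) *\<^sub>R s"
  have "norm s \<le> sqrt T" using T by (simp add: real_le_rsqrt)
  then have "norm t \<le> 1" using T0 by (simp add: t_def)
  moreover have "adj t = t" by (simp add: t_def adj_scaleR s)
  ultimately have "norm (1 - t * t) \<le> 1" by (intro norm_one_minus_square)
  moreover have "T *\<^sub>R 1 - s * s = T *\<^sub>R (1 - t * t)" using T0 by (simp add: t_def scaleR_diff_right)
  ultimately show ?thesis using T0 by simp
qed

lemma cpos_square: "adj s = s \<Longrightarrow> cpos (s * s)"
  unfolding cpos_def using norm_minus_square[of s "norm s ^ 2"]
  by (auto simp: adj_mult intro!: exI[of _ "norm s ^ 2"])

lemma norm_minus_cpos: "cpos h \<Longrightarrow> norm h \<le> T \<Longrightarrow> norm (T *\<^sub>R 1 - h) \<le> T"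
  by (metis cpos_sqrt cpos_adj norm_minus_square norm_square_selfadj)

lemma cpos_sqrt_commute:
  assumes "cpos h"
  obtains s where "cpos s" "s * s = h" "\<And>x. x * h = h * x \<Longrightarrow> x * s = s * x"
proof -
  obtain s where s: "cpos s" "s * s = h" "\<And>S. unital_closed S \<Longrightarrow> h \<in> S \<Longrightarrow> s \<in> S"
    using cpos_sqrt[OF assms] by blast
  have "x * s = s * x" if "x * h = h * x" for x
    using s(3)[OF unital_closed_commutant[of "{x}"]] that by simp
  then show ?thesis using that s by blast
qed

lemma cpos_mult_commute:
  assumes "cpos a" "cpos b" "a * b = b * a"
  shows "cpos (a * b)"
proof -
  obtain s where s: "cpos s" "s * s = a" "\<And>x. x * a = a * x \<Longrightarrow> x * s = s * x"
    using cpos_sqrt_commute[OF assms(1)] by blast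
  obtain r where r: "cpos r" "r * r = b" "\<And>x. x * b = b * x \<Longrightarrow> x * r = r * x"
    using cpos_sqrt_commute[OF assms(2)] by blast
  have "b * s = s * b" using s(3) assms(3) by simp
  then have sr: "s * r = r * s" using r(3)[of s] by simp
  have "a * b = (s * r) * (s * r)" using s(2) r(2) sr by (metis mult.assoc)
  moreover have "adj (s * r) = s * r" by (simp add: adj_mult cpos_adj s(1) r(1) sr)
  ultimately show ?thesis by (simp add: cpos_square)
qed

text \<open>The roots of \<open>a\<close> and of T - a commute, and their squares add up to
  T.\<close>

lemma norm_le_if_cpos:
  assumes "cpos a" "cpos (T *\<^sub>R 1 - a)"
  shows "norm a \<le> T"
proof -
  obtain s where s: "cpos s" "s * s = a" "\<And>x. x * a = a * x \<Longrightarrow> x * s = s * x"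
    using cpos_sqrt_commute[OF assms(1)] by blast
  obtain r where r: "cpos r" "r * r = T *\<^sub>R 1 - a"
      "\<And>x. x * (T *\<^sub>R 1 - a) = (T *\<^sub>R 1 - a) * x \<Longrightarrow> x * r = r * x"
    using cpos_sqrt_commute[OF assms(2)] by blast
  have "s * a = a * s" using s(2) by (metis mult.assoc)
  then have "s * r = r * s" by (intro r(3)) (simp add: algebra_simps)
  then have "norm s ^ 2 \<le> norm (s * s + r * r)"
    by (intro norm_le_norm_sum_squares cpos_adj s(1) r(1))
  then have "norm a \<le> norm (T *\<^sub>R (1::'a))" using s(2) r(2) norm_square_selfadj[OF cpos_adj[OF s(1)]] by simp
  \<comment> \<open>The estimate so far only bounds \<open>norm a\<close> by the absolute value of
    T, so the sign of T has to be settled.\<close>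
  moreover have "T \<ge> 0"
  proof (rule ccontr)
    assume "\<not> T \<ge> 0"
    have "cpos (T *\<^sub>R (1::'a))" using cpos_add[OF assms] by simp
    then obtain U where U: "U \<ge> 0" "norm (U *\<^sub>R (1::'a) - T *\<^sub>R 1) \<le> U" by (auto simp: cpos_def)
    then have "\<bar>U - T\<bar> \<le> U" by (metis norm_of_real of_real_def of_real_diff real_norm_def scaleR_left_diff_distrib)
    then show False using \<open>\<not> T \<ge> 0\<close> U by simp
  qed
  ultimately show ?thesis by simp
qed

lemma norm_mono_cpos:
  assumes "cpos a" "cpos (b - a)"
  shows "norm a \<le> norm b"
proof -
  have "adj b = b" using cpos_add[OF assms] by (simp add: cpos_def)
  then have "cpos (norm b *\<^sub>R 1 - b + (b - a))" by (intro cpos_add cpos_norm_minus assms) auto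
  then show ?thesis using norm_le_if_cpos[OF assms(1)] by simp
qed

lemma cpos_antisym: "cpos a \<Longrightarrow> cpos (- a) \<Longrightarrow> a = 0"
  using norm_mono_cpos[of a 0] by simp

lemma norm_power_two_power:
  fixes x :: "'a::cstar_algebra"
  assumes "adj x = x"
  shows "norm (x ^ (2 ^ m)) = norm x ^ (2 ^ m)"
proof (induction m)
  case (Suc m)
  have "x ^ (2 ^ Suc m) = x ^ (2 ^ m) * x ^ (2 ^ m)" by (simp add: mult_2 power_add)
  moreover have "adj (x ^ (2 ^ m)) = x ^ (2 ^ m)" by (simp add: adj_power assms)
  ultimately have "norm (x ^ (2 ^ Suc m)) = (norm x ^ (2 ^ m))\<^sup>2" using norm_square_selfadj Suc by metis
  then show ?case by (simp add: power_mult[symmetric] mult.commute)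
qed simp

text \<open>The powers of \<open>1 - p\<close> grow at most linearly, because \<open>p\<close> acts like \<open>w\<close> on its own
  range; for a self-adjoint element this forces \<open>norm (1 - p) \<le> 1\<close>.\<close>

lemma cpos_if_square_eq:
  fixes p w :: "'a::cstar_algebra"
  assumes w: "cpos w" and p: "adj p = p" and pp: "p * p = p * w" "p * p = w * p"
  shows "cpos p"
proof -
  define M where "M = norm p + norm w + 1"
  have M: "M > 0" "norm p \<le> M" "norm w \<le> M"
    using norm_ge_zero[of p] norm_ge_zero[of w] by (auto simp: M_def simp del: norm_ge_zero)
  define P where "P = (1 / M) *\<^sub>R p"
  define W where "W = (1 / M) *\<^sub>R w"
  have P: "norm P \<le> 1" "adj P = P" "P * P = P * W" using M p pp by (auto simp: P_def W_def adj_scaleR)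
  have W: "cpos W" "norm W \<le> 1" using M w by (auto simp: W_def cpos_scaleR)
  have nW: "norm (1 - W) \<le> 1" using norm_minus_cpos[OF W] by simp
  have eq: "(1 - P) ^ N = 1 - P * (\<Sum>i<N. (1 - W) ^ i)" for N
  proof (induction N)
    case (Suc N)
    let ?S = "\<Sum>i<N. (1 - W) ^ i"
    have S: "(\<Sum>i<Suc N. (1 - W) ^ i) = 1 + (1 - W) * ?S"
      by (simp add: sum.lessThan_Suc_shift sum_distrib_left del: sum.lessThan_Suc)
    have "(1 - P) ^ Suc N = (1 - P) * (1 - P * ?S)" by (simp add: Suc)
    also have "\<dots> = 1 - P * (1 + ?S) + (P * P) * ?S" by (simp add: algebra_simps)
    also have "\<dots> = 1 - P * (1 + (1 - W) * ?S)" unfolding P(3) by (simp add: algebra_simps)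
    finally show ?case by (simp only: S)
  qed simp
  have bound: "norm ((1 - P) ^ N) \<le> 1 + real N" for N
  proof -
    have "norm (\<Sum>i<N. (1 - W) ^ i) \<le> (\<Sum>i<N. 1)"
      by (rule sum_norm_le) (meson nW norm_power_ineq norm_ge_zero order_trans power_le_one)
    then have "norm (P * (\<Sum>i<N. (1 - W) ^ i)) \<le> 1 * real N"
      using P(1) by (intro order_trans[OF norm_mult_ineq] mult_mono) auto
    then show ?thesis unfolding eq using norm_triangle_ineq4[of 1 "P * (\<Sum>i<N. (1 - W) ^ i)"] by simp
  qed
  have "norm (1 - P) \<le> 1"
  proof (rule ccontr)
    define \<delta> where "\<delta> = norm (1 - P) - 1"
    assume "\<not> norm (1 - P) \<le> 1"
    then have \<delta>: "\<delta> > 0" by (simp add: \<delta>_def)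
    \<comment> \<open>Norms of powers are multiplicative only along exponents that are powers of 2.
      With n = 2 ^ m, squaring Bernoulli's inequality gives growth (1 + n \<delta>)^2 against the
      linear bound 1 + 2 n, and n \<delta>^2 > 2 makes the quadratic term win.\<close>
    obtain m where m: "2 / \<delta>\<^sup>2 < 2 ^ m" using real_arch_pow[of 2 "2 / \<delta>\<^sup>2"] by auto
    let ?n = "(2::nat) ^ m"
    have "1 + real ?n * \<delta> \<le> (1 + \<delta>) ^ ?n" using \<delta> by (intro Bernoulli_inequality) auto
    then have "(1 + real ?n * \<delta>)\<^sup>2 \<le> ((1 + \<delta>) ^ ?n)\<^sup>2" using \<delta> by (intro power_mono) auto
    also have "\<dots> = norm (1 - P) ^ (2 ^ Suc m)" by (simp add: \<delta>_def power_mult[symmetric] mult.commute)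
    also have "\<dots> = norm ((1 - P) ^ (2 ^ Suc m))" by (rule norm_power_two_power[symmetric]) (simp add: adj_diff P)
    also have "\<dots> \<le> 1 + real (2 ^ Suc m)" by (rule bound)
    finally have "(1 + real ?n * \<delta>)\<^sup>2 \<le> 1 + 2 * real ?n" by simp
    moreover have "2 * real ?n \<le> (real ?n * \<delta>)\<^sup>2"
    proof -
      have "2 < real ?n * \<delta>\<^sup>2" using m \<delta> by (simp add: field_simps)
      then have "real ?n * 2 \<le> real ?n * (real ?n * \<delta>\<^sup>2)" by (intro mult_left_mono) auto
      then show ?thesis by (simp add: power2_eq_square mult_ac)
    qed
    moreover have "0 < real ?n * \<delta>" using \<delta> by simp
    ultimately show False by (simp add: power2_sum)
  qed
  then have "cpos P" using P by (auto simp: cpos_def intro: exI[of _ 1])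
  then have "cpos (M *\<^sub>R P)" using M by (intro cpos_scaleR) auto
  then show ?thesis using M by (simp add: P_def)
qed

text \<open>The positive part of \<open>z\<close>, with \<open>p - z\<close> as the negative part.
  The last clause puts it into \<open>D\<close>, \<open>E\<close> or a commutant together with
  \<open>z\<close>.\<close>

definition is_ppart :: "'a::cstar_algebra \<Rightarrow> 'a \<Rightarrow> bool" where
  "is_ppart z p \<longleftrightarrow> cpos p \<and> cpos (p - z) \<and> p * (p - z) = 0 \<and> (p - z) * p = 0 \<and>
     (\<forall>S. unital_closed S \<longrightarrow> z \<in> S \<longrightarrow> p \<in> S)"

definition ppart :: "'a::cstar_algebra \<Rightarrow> 'a" where
  "ppart z = (SOME p. is_ppart z p)"

text \<open>With w = |z|, the halves of w + z and w - z have product 0 because w^2 = z^2. Their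
  positivity is the delicate point; it comes from p^2 = p w, which is the hypothesis of
  \<open>cpos_if_square_eq\<close>.\<close>

lemma is_ppart_ppart:
  assumes z: "adj z = z"
  shows "is_ppart z (ppart z)"
  unfolding ppart_def
proof (rule someI_ex)
  obtain w where w: "cpos w" "w * w = z * z" "\<And>S. unital_closed S \<Longrightarrow> z * z \<in> S \<Longrightarrow> w \<in> S"
    using cpos_sqrt[OF cpos_square[OF z]] by blast
  have wz: "z * w = w * z" using w(3)[OF unital_closed_commutant[of "{z}"]] by (simp add: mult.assoc)
  define p where "p = (1/2) *\<^sub>R (w + z)"
  define q where "q = (1/2) *\<^sub>R (w - z)"
  have q: "q = p - z"
    unfolding p_def q_def using scaleR_half_double[of z] by (simp add: algebra_simps)
  have "cpos p"
    by (rule cpos_if_square_eq[OF w(1)])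
      (auto simp: p_def adj_scaleR adj_add z cpos_adj[OF w(1)] algebra_simps wz w(2) scaleR_add_left[symmetric])
  moreover have "cpos q"
    by (rule cpos_if_square_eq[OF w(1)])
      (auto simp: q_def adj_scaleR adj_diff z cpos_adj[OF w(1)] algebra_simps wz w(2) scaleR_add_left[symmetric])
  moreover have "p * q = 0" "q * p = 0"
    by (auto simp: p_def q_def algebra_simps wz w(2))
  moreover have "p \<in> S" if "unital_closed S" "z \<in> S" for S
    unfolding p_def using that w(3) unital_closedD[OF that(1)] csubspaceD[OF unital_closedD(1)[OF that(1)]] by metis
  ultimately have "is_ppart z p" unfolding is_ppart_def q by blast
  then show "\<exists>p. is_ppart z p" by blast
qed

lemma pparts:
  assumes "adj z = z"
  shows "cpos (ppart z)" "cpos (ppart z - z)" "ppart z * (ppart z - z) = 0" "(ppart z - z) * ppart z = 0"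
    "unital_closed S \<Longrightarrow> z \<in> S \<Longrightarrow> ppart z \<in> S"
  using is_ppart_ppart[OF assms] by (auto simp: is_ppart_def)


text \<open>Kelley and Vaught: if \<open>x\<^sup>* x \<le> 0 \<le> x x\<^sup>*\<close>, compare the two norms of \<open>y = x (1 + x\<^sup>* x / M)\<close>
  with \<open>M = norm (x\<^sup>* x)\<close>, computed from \<open>y\<^sup>* y\<close> and from \<open>y y\<^sup>*\<close>.\<close>

lemma adj_mult_self_negative:
  fixes x :: "'a::cstar_algebra"
  assumes k: "cpos (- (adj x * x))" and h: "cpos (x * adj x)"
  shows "x = 0"
proof (rule ccontr)
  assume "x \<noteq> 0"
  define M where "M = norm x ^ 2"
  have M: "M > 0" using \<open>x \<noteq> 0\<close> by (simp add: M_def)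
  define \<kappa> where "\<kappa> = (1 / M) *\<^sub>R (- (adj x * x))"
  define \<eta> where "\<eta> = (1 / M) *\<^sub>R (x * adj x)"
  have \<kappa>: "cpos \<kappa>" using k M by (simp only: \<kappa>_def, intro cpos_scaleR) auto
  have \<eta>: "cpos \<eta>" using h M by (simp only: \<eta>_def, intro cpos_scaleR) auto
  have n\<kappa>: "norm \<kappa> = 1" using M by (simp add: \<kappa>_def cstar_identity M_def)
  have n\<eta>: "norm \<eta> = 1" using M by (simp add: \<eta>_def cstar_identity' M_def)
  have xx: "adj x * x = - (M *\<^sub>R \<kappa>)" "x * adj x = M *\<^sub>R \<eta>" using M by (simp_all add: \<kappa>_def \<eta>_def)
  have "x * (M *\<^sub>R \<kappa>) = x * (- (adj x * x))" using xx(1) by simp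
  also have "\<dots> = - ((x * adj x) * x)" by (simp only: mult.assoc mult_minus_right)
  also have "\<dots> = M *\<^sub>R (- (\<eta> * x))" by (simp only: xx(2)) simp
  finally have x\<kappa>: "x * \<kappa> = - (\<eta> * x)" using M by (simp only: mult_scaleR_right scaleR_cancel_left) simp
  define y where "y = x * (1 - \<kappa>)"
  have y2: "y = (1 + \<eta>) * x" unfolding y_def using x\<kappa> by (simp add: algebra_simps)
  have ay: "adj y = (1 - \<kappa>) * adj x" by (simp add: y_def adj_mult adj_diff cpos_adj[OF \<kappa>])
  have ay2: "adj y = adj x * (1 + \<eta>)" by (simp add: y2 adj_mult adj_add cpos_adj[OF \<eta>])
  have "adj y * y = (1 - \<kappa>) * (adj x * x) * (1 - \<kappa>)" unfolding ay by (simp add: y_def mult.assoc)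
  also have "\<dots> = - (M *\<^sub>R ((1 - \<kappa>) * (\<kappa> * (1 - \<kappa>))))" unfolding xx by (simp add: mult.assoc)
  finally have 1: "norm y ^ 2 = M * norm ((1 - \<kappa>) * (\<kappa> * (1 - \<kappa>)))"
    using cstar_identity[of y] M by simp
  have "y * adj y = (1 + \<eta>) * (x * adj x) * (1 + \<eta>)" unfolding ay2 by (simp add: y2 mult.assoc)
  also have "\<dots> = M *\<^sub>R ((1 + \<eta>) * \<eta> * (1 + \<eta>))" unfolding xx by (simp add: mult.assoc)
  finally have 2: "norm y ^ 2 = M * norm ((1 + \<eta>) * \<eta> * (1 + \<eta>))"
    using cstar_identity'[of y] M by simp
  \<comment> \<open>From here the two computations of \<open>norm y ^ 2\<close> are driven apart:
    the first gives at most M / 4, since 1/4 - \<kappa> (1 - \<kappa>) is the square of 1/2 -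
    \<kappa>, and the second at least M.\<close>
  have "norm (\<kappa> * (1 - \<kappa>)) \<le> 1/4"
  proof (rule norm_le_if_cpos)
    have "cpos (1 - \<kappa>)" using cpos_norm_minus[OF cpos_adj[OF \<kappa>], of 1] n\<kappa> by simp
    then show "cpos (\<kappa> * (1 - \<kappa>))" using \<kappa> by (intro cpos_mult_commute) (auto simp: algebra_simps)
    let ?s = "(1/2) *\<^sub>R 1 - \<kappa>"
    have "(1/4) *\<^sub>R 1 - \<kappa> * (1 - \<kappa>) = ?s * ?s"
      using scaleR_half_double[of \<kappa>] by (simp add: algebra_simps)
    moreover have "adj ?s = ?s" by (simp add: adj_diff adj_scaleR cpos_adj[OF \<kappa>])
    ultimately show "cpos ((1/4) *\<^sub>R 1 - \<kappa> * (1 - \<kappa>))" using cpos_square by metis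
  qed
  moreover have "norm (1 - \<kappa>) \<le> 1" using norm_minus_cpos[OF \<kappa>, of 1] n\<kappa> by simp
  ultimately have "norm ((1 - \<kappa>) * (\<kappa> * (1 - \<kappa>))) \<le> 1 * (1/4)"
    by - (rule order_trans[OF norm_mult_ineq mult_mono], auto)
  moreover have "norm \<eta> \<le> norm ((1 + \<eta>) * \<eta> * (1 + \<eta>))"
  proof (rule norm_mono_cpos[OF \<eta>])
    have "(1 + \<eta>) * \<eta> * (1 + \<eta>) - \<eta> = 2 *\<^sub>R (\<eta> * \<eta>) + (\<eta> * \<eta>) * \<eta>"
      by (simp add: algebra_simps scaleR_2)
    moreover have "cpos (\<eta> * \<eta>)" by (rule cpos_square[OF cpos_adj[OF \<eta>]])
    ultimately show "cpos ((1 + \<eta>) * \<eta> * (1 + \<eta>) - \<eta>)"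
      using \<eta> by (metis cpos_add cpos_scaleR cpos_mult_commute mult.assoc zero_le_numeral)
  qed
  ultimately have "norm ((1 - \<kappa>) * (\<kappa> * (1 - \<kappa>))) < norm ((1 + \<eta>) * \<eta> * (1 + \<eta>))" using n\<eta> by linarith
  then show False using 1 2 M by simp
qed

text \<open>Cut \<open>a\<close> by the negative part q of \<open>adj a * a\<close>: x = a q has
  \<open>adj x * x\<close> equal to - q^3. Since \<open>adj x * x + x * adj x\<close> is twice a sum
  of squares of self-adjoint elements, \<open>x * adj x\<close> is positive, so
  \<open>adj_mult_self_negative\<close> gives x = 0 and hence q = 0.\<close>

lemma cpos_adj_mult: "cpos (adj a * a)"
proof -
  define h where "h = adj a * a"
  have ah: "adj h = h" by (simp add: h_def adj_mult adj_adj)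
  define p where "p = ppart h"
  define q where "q = p - h"
  have p: "cpos p" and q: "cpos q" and pq: "p * q = 0" "q * p = 0"
    using pparts[OF ah] by (auto simp: p_def q_def)
  have hq: "h = p - q" by (simp add: q_def)
  define x where "x = a * q"
  have "adj x * x = q * h * q" by (simp add: x_def adj_mult cpos_adj[OF q] h_def mult.assoc)
  also have "\<dots> = - (q * q * q)" unfolding hq using pq by (simp add: left_diff_distrib right_diff_distrib)
  finally have axx: "- (adj x * x) = q * q * q" by simp
  have k: "cpos (q * q * q)"
    by (intro cpos_mult_commute[OF cpos_square[OF cpos_adj[OF q]] q]) (simp add: mult.assoc)
  obtain u v where uv: "adj u = u" "adj v = v" "x = u + scaleC \<i> v" using real_imag_decomp by metis
  have ax: "adj x = u - scaleC \<i> v"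
    unfolding uv(3) by (simp add: adj_add adj_scaleC uv(1,2) scaleC_minus_left)
  have "adj x * x + x * adj x = 2 *\<^sub>R (u * u + v * v)"
    unfolding ax unfolding uv(3)
    by (simp add: algebra_simps mult_scaleC_left mult_scaleC_right scaleC_scaleC scaleC_diff_right scaleC_add_right
        scaleC_minus1 scaleR_2)
  then have "x * adj x = 2 *\<^sub>R (u * u + v * v) + q * q * q" unfolding axx[symmetric] by (simp add: eq_diff_eq add.commute)
  then have "cpos (x * adj x)" using k uv(1,2) by (auto intro!: cpos_add cpos_scaleR cpos_square)
  then have "x = 0" using k axx by (intro adj_mult_self_negative) auto
  then have "q * q * q * q = 0" using axx by simp
  then have "adj (q * q) * (q * q) = 0" by (simp add: adj_mult cpos_adj[OF q] mult.assoc)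
  then have "adj q * q = 0" by (simp add: adj_mult_self_eq_0 cpos_adj[OF q])
  then have "q = 0" by (simp add: adj_mult_self_eq_0)
  then show ?thesis using p hq by (simp add: h_def)
qed

lemma cpos_mult_adj: "cpos (a * adj a)"
  using cpos_adj_mult[of "adj a"] by (simp add: adj_adj)

lemma cpos_conj: "cpos h \<Longrightarrow> cpos (adj x * h * x)"
proof -
  assume "cpos h"
  then obtain s where s: "cpos s" "s * s = h" using cpos_sqrt by blast
  have "adj x * h * x = adj (s * x) * (s * x)"
    unfolding s(2)[symmetric] by (simp add: adj_mult cpos_adj[OF s(1)] mult.assoc)
  then show ?thesis by (simp add: cpos_adj_mult)
qed

lemma cpos_norm_square_minus: "cpos ((norm x ^ 2) *\<^sub>R 1 - adj x * x)"
  by (rule cpos_norm_minus) (simp_all add: adj_mult adj_adj cstar_identity)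

lemma norm_mult_mono_right:
  assumes "cpos (b * adj b - a * adj a)"
  shows "norm (x * a) \<le> norm (x * b)"
proof -
  have eq: "norm (x * y) ^ 2 = norm (x * (y * adj y) * adj x)" for y
    using cstar_identity'[of "x * y"] by (simp add: adj_mult mult.assoc)
  have "norm (x * (a * adj a) * adj x) \<le> norm (x * (b * adj b) * adj x)"
  proof (rule norm_mono_cpos)
    show "cpos (x * (a * adj a) * adj x)" using cpos_conj[OF cpos_mult_adj, of "adj x" a] by (simp add: adj_adj)
    show "cpos (x * (b * adj b) * adj x - x * (a * adj a) * adj x)"
      using cpos_conj[OF assms, of "adj x"] by (simp add: adj_adj algebra_simps)
  qed
  then have "norm (x * a) ^ 2 \<le> norm (x * b) ^ 2" by (simp only: eq)
  then show ?thesis by (simp add: abs_le_square_iff[symmetric])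
qed

lemma norm_mult_mono_left:
  assumes "cpos (adj b * b - adj a * a)"
  shows "norm (a * x) \<le> norm (b * x)"
proof -
  have "norm (adj x * adj a) \<le> norm (adj x * adj b)"
    by (rule norm_mult_mono_right) (simp add: assms adj_adj)
  then show ?thesis by (metis adj_mult norm_adj)
qed

subsection \<open>The norm as a spectral radius\<close>

definition invertible_elem :: "'a::cstar_algebra \<Rightarrow> bool" where
  "invertible_elem z \<longleftrightarrow> (\<exists>y. z * y = 1 \<and> y * z = 1)"

lemma minvertible_1: "minvertible 1 Z \<longleftrightarrow> invertible_elem (Z 0 0)"
proof
  assume "minvertible 1 Z"
  then show "invertible_elem (Z 0 0)"
    by (auto simp: minvertible_def invertible_elem_def mmul_def mscalar_def scaleC_one)
next
  assume "invertible_elem (Z 0 0)"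
  then obtain y where "Z 0 0 * y = 1" "y * Z 0 0 = 1" by (auto simp: invertible_elem_def)
  then show "minvertible 1 Z"
    unfolding minvertible_def by (intro exI[of _ "\<lambda>_ _. y"]) (auto simp: mmul_def mscalar_def scaleC_one)
qed

lemma neumann:
  fixes k :: "'a::cstar_algebra"
  assumes "norm k < 1"
  shows "invertible_elem (1 - k)"
proof -
  have s: "summable (\<lambda>n. k ^ n)"
    by (rule summable_comparison_test'[OF summable_geometric[of "norm k"]])
      (use assms norm_power_ineq in auto)
  let ?S = "\<Sum>n. k ^ n"
  have "(\<Sum>n. k ^ Suc n) = ?S - 1" using suminf_split_head[OF s] by simp
  moreover have "(\<Sum>n. k ^ Suc n) = k * ?S" using suminf_mult[OF s, of k] by simp
  moreover have "(\<Sum>n. k ^ Suc n) = ?S * k" using suminf_mult2[OF s, of k] by (simp add: power_commutes)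
  ultimately have "(1 - k) * ?S = 1" "?S * (1 - k) = 1" by (simp_all add: algebra_simps)
  then show ?thesis by (auto simp: invertible_elem_def)
qed

lemma invertible_minus_scaleC:
  assumes "norm h < cmod c"
  shows "invertible_elem (h - scaleC c 1)"
proof -
  have c: "c \<noteq> 0" using assms norm_ge_zero[of h] by auto
  have "norm (scaleC (1 / c) h) < 1" using assms c by (simp add: norm_scaleC norm_divide)
  then obtain y where y: "(1 - scaleC (1 / c) h) * y = 1" "y * (1 - scaleC (1 / c) h) = 1"
    using neumann by (auto simp: invertible_elem_def)
  have eq: "h - scaleC c 1 = scaleC (- c) (1 - scaleC (1 / c) h)"
    using c by (simp add: scaleC_diff_right scaleC_scaleC scaleC_minus_left scaleC_one)
  show ?thesis unfolding invertible_elem_def eq using y c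
    by (intro exI[of _ "scaleC (- 1 / c) y"]) (simp add: mult_scaleC_left mult_scaleC_right scaleC_scaleC scaleC_one)
qed

text \<open>If e = norm h - h had an inverse g, then g would be positive, and with G = norm g one
  gets e >= 1 / G. Thus h <= norm h - 1 / G, which contradicts the size of the norm.\<close>

lemma not_invertible_norm_minus:
  assumes h: "cpos h"
  shows "\<not> invertible_elem (h - norm h *\<^sub>R 1)"
proof
  let ?e = "norm h *\<^sub>R 1 - h"
  assume "invertible_elem (h - norm h *\<^sub>R 1)"
  then obtain y where "(h - norm h *\<^sub>R 1) * y = 1" "y * (h - norm h *\<^sub>R 1) = 1" by (auto simp: invertible_elem_def)
  then have g: "?e * (- y) = 1" "(- y) * ?e = 1" by (simp_all add: algebra_simps)
  define g where "g = - y"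
  have g: "?e * g = 1" "g * ?e = 1" using g by (simp_all add: g_def)
  have e: "cpos ?e" by (rule cpos_norm_minus[OF cpos_adj[OF h]]) simp
  have "adj g * ?e = 1" using arg_cong[OF g(1), of adj] by (simp add: adj_mult cpos_adj[OF e])
  then have ag: "adj g = g" using g by (metis mult.assoc mult.right_neutral mult.left_neutral)
  have gg: "cpos g" using cpos_conj[OF e, of g] by (simp add: ag mult.assoc g)
  define G where "G = norm g"
  have G: "G > 0" unfolding G_def using g by auto
  have "cpos (?e * (G *\<^sub>R 1 - g))"
    by (intro cpos_mult_commute e cpos_norm_minus ag) (use g in \<open>simp_all add: G_def algebra_simps\<close>)
  also have "?e * (G *\<^sub>R 1 - g) = G *\<^sub>R ?e - 1" using g(1) by (simp add: right_diff_distrib)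
  finally have "cpos ((1 / G) *\<^sub>R (G *\<^sub>R ?e - 1))" using G by (intro cpos_scaleR) auto
  also have "(1 / G) *\<^sub>R (G *\<^sub>R ?e - 1) = (norm h - 1 / G) *\<^sub>R 1 - h"
    using G by (simp add: scaleR_diff_right scaleR_diff_left)
  finally have "norm h \<le> norm h - 1 / G" by (rule norm_le_if_cpos[OF h])
  then show False using G by simp
qed

text \<open>The spectral radius of \<open>adj a * a\<close> is its norm. This turns the complete
  isometry of a cover into \<open>norm (j a) = norm a\<close>.\<close>

lemma mnorm_1: "mnorm 1 X = norm (X 0 0)"
proof -
  let ?h = "adj (X 0 0) * X 0 0"
  have spec: "mspectrum 1 (mmul 1 (madj X) X) = {c. \<not> invertible_elem (?h - scaleC c 1)}"
    by (simp add: mspectrum_def minvertible_1[unfolded One_nat_def] mmul_def madj_def mscalar_def)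
  have "Sup (cmod ` {c. \<not> invertible_elem (?h - scaleC c 1)}) = norm ?h"
  proof (rule cSup_eq_maximum)
    show "norm ?h \<in> cmod ` {c. \<not> invertible_elem (?h - scaleC c 1)}"
      using not_invertible_norm_minus[OF cpos_adj_mult, of "X 0 0"]
      by (intro image_eqI[of _ _ "complex_of_real (norm ?h)"]) (auto simp: scaleR_scaleC)
    show "x \<le> norm ?h" if "x \<in> cmod ` {c. \<not> invertible_elem (?h - scaleC c 1)}" for x
      using that invertible_minus_scaleC not_less by auto
  qed
  then show ?thesis unfolding mnorm_def mspectral_radius_def spec by (simp add: cstar_identity)
qed

lemma completely_isometric_norm:
  assumes "completely_isometric_on A f" "a \<in> A"
  shows "norm (f a) = norm a"
proof -
  have "mnorm 1 (\<lambda>i j. f a) = mnorm 1 (\<lambda>i j. a)"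
    using assms unfolding completely_isometric_on_def by (elim allE[of _ 1]) auto
  then show ?thesis by (simp only: mnorm_1)
qed

subsection \<open>Self-adjointness from norm estimates\<close>

lemma norm_le_if_two_sided:
  assumes "cpos (c *\<^sub>R 1 - y)" "cpos (c *\<^sub>R 1 + y)"
  shows "norm y \<le> 3 * c"
proof -
  have "cpos ((2 * c) *\<^sub>R 1 - (c *\<^sub>R 1 + y))"
    using assms(1) scaleR_add_left[of c c "1::'a"] by (simp add: algebra_simps)
  then have *: "norm (c *\<^sub>R 1 + y) \<le> 2 * c" by (rule norm_le_if_cpos[OF assms(2)])
  have "c \<ge> 0" using order_trans[OF norm_ge_zero *] by simp
  then show ?thesis using * norm_triangle_ineq4[of "c *\<^sub>R 1 + y" "c *\<^sub>R 1"] by simp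
qed

text \<open>\<open>w\<close> measures how far the kernel and the range of \<open>q\<close> are from
  being orthogonal, and w = 0 gives \<open>adj q * q = q\<close>. As \<open>q\<close> maps q + t v
  to q, contractivity yields t^2 \<open>adj v * v\<close> + 2 t \<open>adj w * w\<close> >= 0 for
  all real t; letting t tend to 0 from below forces w = 0. It is applied to \<open>j 1\<close>,
  which need not be the unit.\<close>

lemma contractive_idempotent_selfadj:
  fixes q :: "'a::cstar_algebra"
  assumes qq: "q * q = q" and n: "norm q \<le> 1"
  shows "adj q = q"
proof -
  define w where "w = adj (1 - q) * q"
  define v where "v = (1 - q) * w"
  have aw: "adj w = adj q * (1 - q)" by (simp add: w_def adj_mult adj_adj adj_diff)
  have qv: "q * v = 0" by (simp add: v_def algebra_simps qq mult.assoc[symmetric])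
  have av: "adj v * q = adj w * w" by (simp add: v_def w_def adj_mult mult.assoc)
  have av': "adj q * v = adj w * w" unfolding aw by (simp add: v_def mult.assoc)
  have key: "cpos (t\<^sup>2 *\<^sub>R (adj v * v) + (2 * t) *\<^sub>R (adj w * w))" for t :: real
  proof -
    let ?x = "q + t *\<^sub>R v"
    have qx: "q * ?x = q" by (simp add: algebra_simps qq qv)
    have "cpos (1 *\<^sub>R 1 - adj q * q)"
    proof (rule cpos_norm_minus)
      show "norm (adj q * q) \<le> 1" using n by (simp add: cstar_identity power_le_one)
    qed (simp add: adj_mult adj_adj)
    then have "cpos (adj ?x * (1 - adj q * q) * ?x)" by (simp add: cpos_conj)
    also have "adj ?x * (1 - adj q * q) * ?x = adj ?x * ?x - adj (q * ?x) * (q * ?x)"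
      by (simp only: adj_mult) (simp add: left_diff_distrib right_diff_distrib mult.assoc)
    also have "\<dots> = adj ?x * ?x - adj q * q" unfolding qx ..
    also have "\<dots> = t\<^sup>2 *\<^sub>R (adj v * v) + (2 * t) *\<^sub>R (adj w * w)"
      by (simp add: adj_add adj_scaleR algebra_simps av av' power2_eq_square scaleR_add_left[symmetric])
    finally show ?thesis .
  qed
  have *: "norm (adj w * w) \<le> \<tau> * norm v ^ 2" if \<tau>: "\<tau> > 0" for \<tau>
  proof -
    have "cpos ((1 / \<tau>) *\<^sub>R (\<tau>\<^sup>2 *\<^sub>R (adj v * v) + (2 * - \<tau>) *\<^sub>R (adj w * w)))"
      using key[of "- \<tau>"] \<tau> by (intro cpos_scaleR) auto
    then have "cpos (\<tau> *\<^sub>R (adj v * v) - 2 *\<^sub>R (adj w * w))"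
      using \<tau> by (simp add: scaleR_diff_right power2_eq_square)
    then have "norm (2 *\<^sub>R (adj w * w)) \<le> norm (\<tau> *\<^sub>R (adj v * v))"
      by (intro norm_mono_cpos cpos_scaleR cpos_adj_mult) auto
    then have "2 * norm (adj w * w) \<le> \<tau> * norm v ^ 2" using \<tau> by (simp add: cstar_identity)
    then show ?thesis using norm_ge_zero[of "adj w * w"] by linarith
  qed
  have "norm (adj w * w) \<le> 0 + e" if e: "e > 0" for e
  proof -
    have "norm (adj w * w) \<le> e / (norm v ^ 2 + 1) * norm v ^ 2" using e by (intro *) (simp add: add_nonneg_pos)
    also have "\<dots> = e * (norm v ^ 2 / (norm v ^ 2 + 1))" by simp
    also have "\<dots> \<le> e * 1" using e by (intro mult_left_mono) (auto simp: divide_le_eq_1 add_nonneg_pos)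
    finally show ?thesis by simp
  qed
  then have "norm (adj w * w) \<le> 0" by (rule field_le_epsilon)
  then have "w = 0" by (simp add: adj_mult_self_eq_0)
  then have "adj q * q = q" by (simp add: w_def adj_diff left_diff_distrib)
  then show ?thesis by (metis adj_mult adj_adj)
qed

text \<open>Adding a large imaginary multiple of the unit \<open>q\<close> makes the imaginary part of \<open>b\<close> visible in the norm.\<close>

lemma selfadj_if_norm_imaginary_shift:
  fixes b q :: "'a::cstar_algebra"
  assumes q: "q * q = q" "adj q = q" and qb: "q * b = b" "b * q = b"
    and n: "\<And>t::real. norm (b + scaleC (\<i> * t) q) ^ 2 \<le> c + t\<^sup>2"
  shows "adj b = b"
proof -
  have c: "c \<ge> 0" using order_trans[OF zero_le_power2 n[of 0]] by simp
  define k where "k = scaleC (- \<i> / 2) (b - adj b)"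
  have ak: "adj k = k" by (simp add: k_def adj_scaleC adj_diff adj_adj scaleC_diff_right scaleC_minus_left)
  have "q * adj b = adj b" "adj b * q = adj b" using arg_cong[OF qb(1), of adj] arg_cong[OF qb(2), of adj]
    by (simp_all add: adj_mult q)
  then have qk: "q * k = k" "k * q = k"
    by (simp_all add: k_def mult_scaleC_left mult_scaleC_right left_diff_distrib right_diff_distrib qb)
  have key: "cpos (c *\<^sub>R 1 - (2 * t) *\<^sub>R k)" for t :: real
  proof -
    let ?z = "b + scaleC (\<i> * t) q"
    let ?y = "k + t *\<^sub>R q"
    have "2 *\<^sub>R ?y = scaleC (- \<i>) (?z - adj ?z)"
      by (simp add: k_def adj_add adj_scaleC q scaleC_add_right scaleC_diff_right scaleC_scaleC scaleR_scaleC
          scaleC_minus_left scaleR_add_right scaleC_add_left[symmetric])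
    then have "2 * norm ?y = norm (?z - adj ?z)" by (metis norm_scaleR norm_scaleC norm_minus_cancel
          norm_ii abs_numeral mult.left_neutral)
    then have "norm ?y \<le> norm ?z" using norm_triangle_ineq4[of ?z "adj ?z"] by simp
    then have "norm ?y ^ 2 \<le> norm ?z ^ 2" by (intro power_mono) auto
    then have ny: "norm ?y ^ 2 \<le> c + t\<^sup>2" using n[of t] by linarith
    have ay: "adj ?y = ?y" by (simp add: adj_add adj_scaleR ak q)
    have "cpos ((c + t\<^sup>2) *\<^sub>R 1 - ?y * ?y)"
      by (rule cpos_norm_minus) (simp_all add: adj_mult ay norm_square_selfadj[OF ay] ny)
    then have "cpos (adj q * ((c + t\<^sup>2) *\<^sub>R 1 - ?y * ?y) * q)" by (rule cpos_conj)
    also have "adj q * ((c + t\<^sup>2) *\<^sub>R 1 - ?y * ?y) * q = (c + t\<^sup>2) *\<^sub>R q - (q * ?y) * (?y * q)"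
      by (simp add: q left_diff_distrib right_diff_distrib mult.assoc)
    also have "\<dots> = c *\<^sub>R q - k * k - (2 * t) *\<^sub>R k"
      using scaleR_add_left[of t t k]
      by (simp add: distrib_left distrib_right q qk scaleR_add_left scaleR_add_right power2_eq_square)
    \<comment> \<open>The positive terms k^2 and c (1 - q)^2 are added to replace the unit
      \<open>q\<close> of the corner by 1.\<close>
    finally have "cpos (c *\<^sub>R q - k * k - (2 * t) *\<^sub>R k + k * k + c *\<^sub>R ((1 - q) * (1 - q)))"
      by (intro cpos_add cpos_scaleR cpos_square c) (simp_all add: ak adj_diff q)
    also have "c *\<^sub>R q - k * k - (2 * t) *\<^sub>R k + k * k + c *\<^sub>R ((1 - q) * (1 - q)) = c *\<^sub>R 1 - (2 * t) *\<^sub>R k"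
      by (simp add: left_diff_distrib right_diff_distrib q scaleR_diff_right)
    finally show ?thesis .
  qed
  have "norm k \<le> 0 + e" if e: "e > 0" for e
  proof -
    \<comment> \<open>\<open>norm (2 t k)\<close> stays below 3 c for all t, so a large t makes
      \<open>norm k\<close> small; the summand 1 keeps t positive if c = 0.\<close>
    define t where "t = (3 * c + 1) / e"
    have t: "t > 0" using e c by (simp add: t_def)
    have "norm ((2 * t) *\<^sub>R k) \<le> 3 * c" using key[of t] key[of "- t"] by (intro norm_le_if_two_sided) auto
    then have "2 * (t * norm k) \<le> 3 * c" using t by simp
    then have "t * norm k \<le> 3 * c + 1" using t c mult_nonneg_nonneg[of t "norm k"] by linarith
    then have "(3 * c + 1) * norm k \<le> (3 * c + 1) * e" using e unfolding t_def by (simp add: field_simps)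
    then show ?thesis using c by simp
  qed
  then have "norm k \<le> 0" by (rule field_le_epsilon)
  then have "scaleC (2 * \<i>) k = 0" by simp
  then show ?thesis by (simp add: k_def scaleC_scaleC scaleC_one)
qed

subsection \<open>Localizing elements\<close>

lemma ppart_nonneg:
  assumes "cpos z"
  shows "ppart z = z"
proof -
  note p = pparts[OF cpos_adj[OF assms]]
  let ?q = "ppart z - z"
  have comm: "z * ?q = ?q * z"
    using p(3,4) by (simp add: algebra_simps)
  have "z * ?q = ppart z * ?q - ?q * ?q" by (simp add: algebra_simps)
  then have "z * ?q = - (?q * ?q)" using p(3) by simp
  moreover have "cpos (z * ?q)" by (rule cpos_mult_commute[OF assms p(2) comm])
  ultimately have "?q * ?q = 0" using cpos_antisym[OF cpos_square[OF cpos_adj[OF p(2)]]] by simp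
  then show ?thesis using adj_mult_self_eq_0[of ?q] by (simp add: cpos_adj[OF p(2)])
qed

lemma ppart_nonpos:
  assumes "cpos (- z)"
  shows "ppart z = 0"
proof -
  have az: "adj z = z" using cpos_adj[OF assms] by (simp add: adj_minus)
  note p = pparts[OF az]
  have comm: "ppart z * (- z) = (- z) * ppart z"
    using p(3,4) by (simp add: algebra_simps)
  have "ppart z * (- z) = - (ppart z * ppart z)" using p(3) by (simp add: algebra_simps)
  moreover have "cpos (ppart z * (- z))" by (rule cpos_mult_commute[OF p(1) assms comm])
  ultimately have "ppart z * ppart z = 0" using cpos_antisym[OF cpos_square[OF cpos_adj[OF p(1)]]] by simp
  then show ?thesis using adj_mult_self_eq_0[of "ppart z"] by (simp add: cpos_adj[OF p(1)])
qed

text \<open>The elements \<open>d\<close> with \<open>live D d\<close> replace the bump functions on the spectrum of \<open>D\<close>: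
  \<open>h\<close> witnesses that \<open>d\<close> equals 1 on some nonempty open set, and \<open>d0 * d = d\<close> says that
  \<open>d0\<close> equals 1 on the support of \<open>d\<close>.\<close>

definition live :: "'a::cstar_algebra set \<Rightarrow> 'a \<Rightarrow> bool" where
  "live D d \<longleftrightarrow> d \<in> D \<and> cpos d \<and> cpos (1 - d) \<and> (\<exists>h\<in>D. h \<noteq> 0 \<and> d * h = h)"

lemma live_norm:
  assumes "live D d"
  shows "norm d = 1"
proof -
  obtain h where d: "cpos d" "cpos (1 - d)" "h \<noteq> 0" "d * h = h" using assms by (auto simp: live_def)
  have "norm d \<le> 1" using norm_le_if_cpos[of d 1] d by simp
  moreover have "norm h \<le> norm d * norm h" using norm_mult_ineq[of d h] d by simp
  ultimately show ?thesis using d(3) by simp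
qed

section \<open>Cutting elements down by live elements of a pseudo-Cartan subalgebra\<close>

locale pseudo_cartan_inclusion =
  fixes D :: "'a::cstar_algebra set"
  assumes pseudo_cartan: "pseudo_cartan D"
begin

definition E :: "'a set" where
  "E = relative_commutant D"

lemma D_unital_closed: "unital_closed D"
  and D_adj: "d \<in> D \<Longrightarrow> adj d \<in> D"
  and D_comm: "c \<in> D \<Longrightarrow> d \<in> D \<Longrightarrow> c * d = d * c"
  using pseudo_cartan
  by (auto simp: pseudo_cartan_def cstar_subalgebra_def unital_closed_def closed_subalgebra_def abelian_def)

lemmas D_closed = unital_closedD[OF D_unital_closed] csubspaceD[OF unital_closedD(1)[OF D_unital_closed]]

lemma E_eq: "E = {y. \<forall>x\<in>D. x * y = y * x}"
  by (auto simp: E_def relative_commutant_def)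

lemma E_unital_closed: "unital_closed E"
  unfolding E_eq by (rule unital_closed_commutant)

lemmas E_closed = unital_closedD[OF E_unital_closed] csubspaceD[OF unital_closedD(1)[OF E_unital_closed]]

lemma E_adj: "x \<in> E \<Longrightarrow> adj x \<in> E"
  unfolding E_eq by (auto simp flip: adj_adj adj_mult) (metis D_adj adj_adj adj_mult)

lemma D_subset_E: "D \<subseteq> E"
  unfolding E_eq using D_comm by auto

lemma E_comm: "x \<in> E \<Longrightarrow> y \<in> E \<Longrightarrow> x * y = y * x"
  using pseudo_cartan by (auto simp: pseudo_cartan_def abelian_def E_def)

lemma E_ideal_meets_D:
  assumes "closed_ideal E J" "J \<noteq> {0}"
  obtains h where "h \<in> J" "h \<in> D" "h \<noteq> 0"
proof -
  have "J \<inter> D \<noteq> {0}"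
    using assms pseudo_cartan by (auto simp: pseudo_cartan_def ideal_intersection_property_def E_def)
  moreover have "0 \<in> J \<inter> D" using assms(1) D_closed by (auto simp: closed_ideal_def csubspace_def)
  ultimately show ?thesis using that by blast
qed

text \<open>As functions on the spectrum of \<open>D\<close>, d = min (1, 2 \<kappa>) with \<kappa>
  = |k|^2 / norm k ^ 2. Being dominated by 2 \<kappa> gives the first two estimates; being 1 only
  where \<kappa> >= 1/2 gives the last. The witness that \<open>d\<close> is live is
  \<open>q\<close>, the positive part of 2 \<kappa> - 1.\<close>

lemma live_cut:
  assumes k: "k \<in> D" "k \<noteq> 0"
  obtains d where "live D d" "\<And>x. norm (x * d) \<le> 2 * norm (x * k) / norm k"
    "\<And>x. norm (d * x) \<le> 2 * norm (k * x) / norm k"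
    "\<And>y. d * y = y \<Longrightarrow> norm k * norm y \<le> 2 * norm (k * y)"
proof -
  define \<kappa> where "\<kappa> = (1 / norm k ^ 2) *\<^sub>R (adj k * k)"
  have nk: "norm k > 0" using k by simp
  have \<kappa>D: "\<kappa> \<in> D" unfolding \<kappa>_def using k by (intro D_closed D_adj)
  have \<kappa>: "cpos \<kappa>" unfolding \<kappa>_def by (intro cpos_scaleR cpos_adj_mult) auto
  have n\<kappa>: "norm \<kappa> = 1" using nk by (simp add: \<kappa>_def cstar_identity)
  define z where "z = 1 - 2 *\<^sub>R \<kappa>"
  have az: "adj z = z" by (simp add: z_def adj_diff adj_scaleR cpos_adj[OF \<kappa>])
  have zD: "z \<in> D" unfolding z_def using \<kappa>D by (intro D_closed)
  define p where "p = ppart z"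
  define q where "q = p - z"
  have pq: "cpos p" "cpos q" "p * q = 0" "q * p = 0" using pparts[OF az] by (auto simp: p_def q_def)
  have pD: "p \<in> D" unfolding p_def by (rule pparts(5)[OF az D_unital_closed zD])
  have qD: "q \<in> D" unfolding q_def using pD zD by (intro D_closed)
  define d where "d = 1 - p"
  have dD: "d \<in> D" unfolding d_def using pD by (intro D_closed)
  have d_alt: "d = 2 *\<^sub>R \<kappa> - q" by (simp add: d_def q_def z_def)
  have np: "norm p \<le> 1"
  proof (cases "p = 0")
    case False
    have "p * p = p * z" using pq(3) by (simp add: q_def algebra_simps)
    then have "p - p * p = 2 *\<^sub>R (p * \<kappa>)" by (simp add: z_def algebra_simps)
    moreover have "cpos (2 *\<^sub>R (p * \<kappa>))"
      by (intro cpos_scaleR cpos_mult_commute pq \<kappa> D_comm pD \<kappa>D) auto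
    ultimately have "norm (p * p) \<le> norm p" by (intro norm_mono_cpos cpos_square cpos_adj pq) auto
    then have "norm p * norm p \<le> norm p" using norm_square_selfadj[OF cpos_adj[OF pq(1)]] by (simp add: power2_eq_square)
    then show ?thesis using False by simp
  qed simp
  have cd: "cpos d" unfolding d_def using cpos_norm_minus[OF cpos_adj[OF pq(1)] np] by simp
  have qn0: "q \<noteq> 0"
  proof
    assume "q = 0"
    then have "cpos (1 - 2 *\<^sub>R \<kappa>)" using pq(1) by (simp add: q_def z_def)
    then have "norm (2 *\<^sub>R \<kappa>) \<le> 1" using \<kappa> by (intro norm_le_if_cpos cpos_scaleR) auto
    then show False using n\<kappa> by simp
  qed
  have live: "live D d" unfolding live_def
    using dD cd pq(1,3) qD qn0 by (auto simp: d_def left_diff_distrib intro!: bexI[of _ q])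
  have mono: "cpos ((2 *\<^sub>R \<kappa>) * (2 *\<^sub>R \<kappa>) - d * d)"
  proof -
    have comm: "\<kappa> * d = d * \<kappa>" by (rule D_comm[OF \<kappa>D dD])
    have "(2 *\<^sub>R \<kappa>) * (2 *\<^sub>R \<kappa>) - d * d = (2 *\<^sub>R \<kappa> - d) * (2 *\<^sub>R \<kappa> + d)"
      using comm by (simp add: algebra_simps)
    also have "2 *\<^sub>R \<kappa> - d = q" by (simp add: d_alt)
    finally show ?thesis
      by (simp only:) (intro cpos_mult_commute cpos_add cpos_scaleR pq \<kappa> cd D_comm D_closed qD \<kappa>D dD; simp)
  qed
  have a2: "adj (2 *\<^sub>R \<kappa>) = 2 *\<^sub>R \<kappa>" and ad: "adj d = d"
    by (simp_all add: adj_scaleR cpos_adj[OF \<kappa>] cpos_adj[OF cd])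
  have kk: "adj k * k = k * adj k" by (intro D_comm D_adj k)
  have n2\<kappa>: "norm (x * (2 *\<^sub>R \<kappa>)) \<le> 2 * norm (x * k) / norm k"
    "norm ((2 *\<^sub>R \<kappa>) * x) \<le> 2 * norm (k * x) / norm k" for x
  proof -
    have "norm (x * (2 *\<^sub>R \<kappa>)) = 2 / norm k ^ 2 * norm ((x * k) * adj k)"
      by (simp add: \<kappa>_def kk mult.assoc)
    also have "\<dots> \<le> 2 / norm k ^ 2 * (norm (x * k) * norm (adj k))"
      by (intro mult_left_mono norm_mult_ineq) auto
    also have "\<dots> = 2 * norm (x * k) / norm k" using nk by (simp add: power2_eq_square)
    finally show "norm (x * (2 *\<^sub>R \<kappa>)) \<le> 2 * norm (x * k) / norm k" .
    have "norm ((2 *\<^sub>R \<kappa>) * x) = 2 / norm k ^ 2 * norm (adj k * (k * x))"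
      by (simp add: \<kappa>_def mult.assoc)
    also have "\<dots> \<le> 2 / norm k ^ 2 * (norm (adj k) * norm (k * x))"
      by (intro mult_left_mono norm_mult_ineq) auto
    also have "\<dots> = 2 * norm (k * x) / norm k" using nk by (simp add: power2_eq_square)
    finally show "norm ((2 *\<^sub>R \<kappa>) * x) \<le> 2 * norm (k * x) / norm k" .
  qed
  show ?thesis
  proof (rule that[OF live])
    show "norm (x * d) \<le> 2 * norm (x * k) / norm k" for x
      by (rule order_trans[OF norm_mult_mono_right n2\<kappa>(1)]) (simp only: a2 ad mono)
    show "norm (d * x) \<le> 2 * norm (k * x) / norm k" for x
      by (rule order_trans[OF norm_mult_mono_left n2\<kappa>(2)]) (simp only: a2 ad mono)
    fix y assume "d * y = y"
    then have py: "p * y = 0" by (simp add: d_def left_diff_distrib)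
    then have ky: "(2 *\<^sub>R \<kappa>) * y = y + q * y" unfolding q_def z_def by (simp add: left_diff_distrib)
    have "adj ((2 *\<^sub>R \<kappa>) * y) * ((2 *\<^sub>R \<kappa>) * y) - adj y * y = adj y * (2 *\<^sub>R q + q * q) * y"
      unfolding ky by (simp add: adj_mult adj_add cpos_adj[OF pq(2)] algebra_simps scaleR_2)
    moreover have "cpos (adj y * (2 *\<^sub>R q + q * q) * y)"
      by (intro cpos_conj cpos_add cpos_scaleR cpos_square pq cpos_adj) auto
    ultimately have "norm (adj y * y) \<le> norm (adj ((2 *\<^sub>R \<kappa>) * y) * ((2 *\<^sub>R \<kappa>) * y))"
      by (intro norm_mono_cpos cpos_adj_mult) auto
    then have "norm y ^ 2 \<le> norm ((2 *\<^sub>R \<kappa>) * y) ^ 2" by (simp only: cstar_identity)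
    then have "norm y \<le> norm ((2 *\<^sub>R \<kappa>) * y)" by (rule power2_le_imp_le) simp
    also have "\<dots> \<le> 2 * norm (k * y) / norm k" by (rule n2\<kappa>(2))
    finally show "norm k * norm y \<le> 2 * norm (k * y)" using nk by (simp add: field_simps)
  qed
qed

text \<open>Applied to x = d0 - 1, the first estimate of \<open>live_cut\<close> hands the relation
  \<open>d0 * k = k\<close> on to \<open>d\<close>.\<close>

lemma live_cut_below:
  assumes k: "k \<in> D" "k \<noteq> 0" "d0 * k = k"
  obtains d where "live D d" "d0 * d = d" "\<And>x. norm (x * d) \<le> 2 * norm (x * k) / norm k"
    "\<And>x. norm (d * x) \<le> 2 * norm (k * x) / norm k"
    "\<And>y. d * y = y \<Longrightarrow> norm k * norm y \<le> 2 * norm (k * y)"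
proof -
  obtain d where d: "live D d" "\<And>x. norm (x * d) \<le> 2 * norm (x * k) / norm k"
    "\<And>x. norm (d * x) \<le> 2 * norm (k * x) / norm k"
    "\<And>y. d * y = y \<Longrightarrow> norm k * norm y \<le> 2 * norm (k * y)" by (rule live_cut[OF k(1,2)], rule that)
  have "norm ((d0 - 1) * d) \<le> 0" using d(2)[of "d0 - 1"] k(3) by (simp add: left_diff_distrib)
  then have "d0 * d = d" by (simp add: left_diff_distrib)
  then show ?thesis using that d by blast
qed

text \<open>Slice the range of \<open>z\<close> into steps of length \<delta>. The elements of
  \<open>E\<close> that live on a suitable slice and under \<open>d0\<close> form a nonzero ideal;
  by the intersection property it contains a nonzero element of \<open>D\<close>, which can be cut
  down to \<open>d\<close>.\<close>

lemma localize_selfadj: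
  assumes z: "z \<in> E" "adj z = z" and d0: "live D d0" and \<epsilon>: "\<epsilon> > 0"
  obtains d c where "live D d" "d0 * d = d" "norm ((z - c *\<^sub>R 1) * d) \<le> \<epsilon>"
proof -
  obtain h0 where h0: "h0 \<in> D" "h0 \<noteq> 0" "d0 * h0 = h0" and d0D: "d0 \<in> D" using d0 by (auto simp: live_def)
  define \<delta> where "\<delta> = \<epsilon> / 2"
  have \<delta>: "\<delta> > 0" using \<epsilon> by (simp add: \<delta>_def)
  define N where "N = norm z"
  \<comment> \<open>\<open>lam 0\<close> lies \<delta> below - norm z. Hence P 0 = z - lam 0 cannot
    annihilate \<open>h0\<close>, so that the least index below has a predecessor
    \<open>m\<close>.\<close>
  define lam where "lam i = real i * \<delta> - N - \<delta>" for i :: nat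
  define P where "P i = ppart (z - lam i *\<^sub>R 1)" for i
  have az: "adj (z - lam i *\<^sub>R 1) = z - lam i *\<^sub>R 1" for i by (simp add: adj_diff adj_scaleR z)
  have zE: "z - lam i *\<^sub>R 1 \<in> E" for i using z by (intro E_closed)
  have PE: "P i \<in> E" for i unfolding P_def by (rule pparts(5)[OF az E_unital_closed zE])
  have ex: "\<exists>i. P i * h0 = 0"
  proof -
    obtain i where i: "2 * N + \<delta> < real i * \<delta>" using reals_Archimedean3[OF \<delta>] by blast
    then have "cpos (lam i *\<^sub>R 1 - z)" using z by (intro cpos_norm_minus) (auto simp: lam_def N_def)
    then have "P i = 0" unfolding P_def by (intro ppart_nonpos) simp
    then show ?thesis by (intro exI[of _ i]) simp
  qed
  define i where "i = (LEAST i. P i * h0 = 0)"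
  have Pi: "P i * h0 = 0" unfolding i_def using ex by (rule LeastI_ex)
  have "i \<noteq> 0"
  proof
    assume "i = 0"
    have "cpos (N *\<^sub>R 1 - - z)" using z by (intro cpos_norm_minus) (auto simp: N_def adj_minus)
    then have "cpos (N *\<^sub>R 1 - - z + \<delta> *\<^sub>R 1)" using \<delta> by (intro cpos_add cpos_of_real) auto
    moreover have "N *\<^sub>R 1 - - z + \<delta> *\<^sub>R 1 = z - lam 0 *\<^sub>R 1" by (simp add: lam_def scaleR_diff_left algebra_simps)
    ultimately have "P 0 = z - lam 0 *\<^sub>R 1" unfolding P_def by (simp only: ppart_nonneg)
    then have "z * h0 = lam 0 *\<^sub>R h0" using Pi \<open>i = 0\<close> by (simp add: left_diff_distrib)
    moreover have "\<bar>lam 0\<bar> = N + \<delta>" using \<delta> norm_ge_zero[of z] unfolding lam_def N_def by linarith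
    ultimately have "(N + \<delta>) * norm h0 = norm (z * h0)" by simp
    also have "\<dots> \<le> N * norm h0" by (simp add: N_def norm_mult_ineq)
    finally show False using h0(2) mult_pos_pos[OF \<delta>, of "norm h0"] by (simp add: distrib_right)
  qed
  then obtain m where m: "i = Suc m" by (cases i) auto
  define Q where "Q i = P i - (z - lam i *\<^sub>R 1)" for i
  have pos: "cpos (P i)" "cpos (Q i)" "Q i * P i = 0" "P i * Q i = 0" for i
    using pparts[OF az] by (auto simp: P_def Q_def)
  have QE: "Q i \<in> E" for i unfolding Q_def by (intro E_closed PE zE)
  \<comment> \<open>Functions living where lam m <= z <= lam i and under \<open>d0\<close>. The
    product \<open>P m * h0\<close> belongs to it and is nonzero because \<open>i\<close> is
    least.\<close>
  define I where "I = {y \<in> E. Q m * y = 0 \<and> P i * y = 0 \<and> d0 * y = y}"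
  have d0E: "d0 \<in> E" using d0D D_subset_E by blast
  have ideal: "closed_ideal E I"
  proof -
    have "I = E \<inter> ({y. Q m * y = 0} \<inter> {y. P i * y = 0} \<inter> {y. d0 * y = y})" by (auto simp: I_def)
    moreover have "closed \<dots>" using E_closed(2)
      by (intro closed_Int closed_Collect_eq continuous_intros)
    ultimately have "closed I" by simp
    moreover have "b * x \<in> I \<and> x * b \<in> I" if "b \<in> E" "x \<in> I" for b x
    proof -
      have "x \<in> E" using that by (simp add: I_def)
      moreover have "x * b \<in> I" using that E_closed(4)
        by (auto simp: I_def mult.assoc[symmetric])
      ultimately show ?thesis using E_comm[OF that(1)] by simp
    qed
    moreover have "csubspace I" unfolding csubspace_def using E_closed
      by (auto simp: I_def distrib_left mult_scaleC_right)
    ultimately show ?thesis by (auto simp: closed_ideal_def I_def)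
  qed
  have "P m * h0 \<noteq> 0" using m not_less_Least[of m "\<lambda>i. P i * h0 = 0"] by (auto simp: i_def)
  moreover have "P m * h0 \<in> I"
  proof -
    have h0E: "h0 \<in> E" using h0 D_subset_E by blast
    have "P i * (P m * h0) = P m * (P i * h0)" using E_comm[OF PE PE] by (metis mult.assoc)
    moreover have "d0 * (P m * h0) = P m * (d0 * h0)" using E_comm[OF d0E PE] by (metis mult.assoc)
    ultimately show ?thesis using Pi h0 h0E PE E_closed(4) pos(3)[of m]
      by (auto simp: I_def mult.assoc[symmetric])
  qed
  ultimately have "I \<noteq> {0}" by blast
  then obtain h where h: "h \<in> I" "h \<in> D" "h \<noteq> 0" using E_ideal_meets_D[OF ideal] by blast
  then have hI: "Q m * h = 0" "P i * h = 0" "d0 * h = h" by (auto simp: I_def)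
  obtain d where d: "live D d" "d0 * d = d" "\<And>x. norm (x * d) \<le> 2 * norm (x * h) / norm h"
    by (rule live_cut_below[OF h(2,3) hI(3)], rule that)
  have zm: "(z - lam m *\<^sub>R 1) * h = P m * h"
    using hI(1) by (simp add: Q_def left_diff_distrib)
  have zi: "(lam i *\<^sub>R 1 - z) * h = Q i * h"
    using hI(2) by (simp add: Q_def left_diff_distrib)
  have lam_i: "lam i = lam m + \<delta>" by (simp add: m lam_def algebra_simps)
  have sum: "P m * h + Q i * h = \<delta> *\<^sub>R h"
    unfolding zm[symmetric] zi[symmetric] lam_i by (simp add: left_diff_distrib scaleR_add_left distrib_right)
  have "norm (P m * h) \<le> norm (\<delta> *\<^sub>R h)"
  proof -
    have "\<delta> *\<^sub>R h - P m * h = Q i * h" using sum by (simp add: algebra_simps)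
    have "adj (\<delta> *\<^sub>R h) * (\<delta> *\<^sub>R h) - adj (P m * h) * (P m * h)
        = adj h * (\<delta> *\<^sub>R (P m * h + Q i * h) - P m * (P m * h))"
      unfolding sum by (simp add: adj_scaleR adj_mult cpos_adj[OF pos(1)] right_diff_distrib mult.assoc)
    also have "\<delta> *\<^sub>R (P m * h + Q i * h) - P m * (P m * h) = \<delta> *\<^sub>R (Q i * h) + P m * (\<delta> *\<^sub>R h - P m * h)"
      by (simp add: algebra_simps)
    also have "\<dots> = (\<delta> *\<^sub>R Q i + P m * Q i) * h"
      using \<open>\<delta> *\<^sub>R h - P m * h = Q i * h\<close> by (simp add: algebra_simps)
    finally have "adj (\<delta> *\<^sub>R h) * (\<delta> *\<^sub>R h) - adj (P m * h) * (P m * h) = adj h * (\<delta> *\<^sub>R Q i + P m * Q i) * h"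
      by (simp add: mult.assoc)
    moreover have "cpos (adj h * (\<delta> *\<^sub>R Q i + P m * Q i) * h)"
      using \<delta> by (intro cpos_conj cpos_add cpos_scaleR cpos_mult_commute pos E_comm PE QE) auto
    ultimately have "norm (adj (P m * h) * (P m * h)) \<le> norm (adj (\<delta> *\<^sub>R h) * (\<delta> *\<^sub>R h))"
      by (intro norm_mono_cpos cpos_adj_mult) auto
    then have "norm (P m * h) ^ 2 \<le> norm (\<delta> *\<^sub>R h) ^ 2" by (simp only: cstar_identity)
    then show ?thesis by (rule power2_le_imp_le) simp
  qed
  then have "norm ((z - lam m *\<^sub>R 1) * h) \<le> \<delta> * norm h" using \<delta> by (simp add: zm)
  then have "2 * norm ((z - lam m *\<^sub>R 1) * h) / norm h \<le> \<epsilon>" using h(3) by (simp add: \<delta>_def field_simps)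
  then have "norm ((z - lam m *\<^sub>R 1) * d) \<le> \<epsilon>" using d(3) order_trans by blast
  then show ?thesis using that d by blast
qed


lemma norm_mult_below_le:
  assumes "live D d" "d1 * d = d"
  shows "norm (x * d) \<le> norm (x * d1)"
proof -
  have "norm (x * d) = norm ((x * d1) * d)" by (simp only: mult.assoc assms)
  also have "\<dots> \<le> norm (x * d1) * norm d" by (rule norm_mult_ineq)
  finally show ?thesis using live_norm[OF assms(1)] by simp
qed

lemma below_trans:
  fixes d0 :: 'a
  shows "d0 * d1 = d1 \<Longrightarrow> d1 * d2 = d2 \<Longrightarrow> d0 * d2 = d2"
  by (metis mult.assoc)

lemma live_in_D: "live D d \<Longrightarrow> d \<in> D"
  by (simp add: live_def)

lemma live_adj: "live D d \<Longrightarrow> adj d = d"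
  by (simp add: live_def cpos_adj)

lemma localize:
  assumes z: "z \<in> E" and d0: "live D d0" and \<epsilon>: "\<epsilon> > 0"
  obtains d c where "live D d" "d0 * d = d" "norm ((z - scaleC c 1) * d) \<le> \<epsilon>"
proof -
  obtain h k where hk: "adj h = h" "adj k = k" "z = h + scaleC \<i> k"
    "h = scaleR (1/2) (z + adj z)" "k = scaleC (- \<i> / 2) (z - adj z)" by (rule real_imag_decomp)
  have "h \<in> E" "k \<in> E" unfolding hk(4,5) using z by (intro E_closed E_adj; assumption)+
  obtain d1 a where d1: "live D d1" "d0 * d1 = d1" "norm ((h - a *\<^sub>R 1) * d1) \<le> \<epsilon> / 2"
    using localize_selfadj[OF \<open>h \<in> E\<close> hk(1) d0, of "\<epsilon> / 2"] \<epsilon> by auto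
  obtain d2 b where d2: "live D d2" "d1 * d2 = d2" "norm ((k - b *\<^sub>R 1) * d2) \<le> \<epsilon> / 2"
    using localize_selfadj[OF \<open>k \<in> E\<close> hk(2) d1(1), of "\<epsilon> / 2"] \<epsilon> by auto
  have "(z - scaleC (Complex a b) 1) * d2 = (h - a *\<^sub>R 1) * d2 + scaleC \<i> ((k - b *\<^sub>R 1) * d2)"
    unfolding hk(3)
    by (simp add: Complex_eq scaleR_scaleC scaleC_add_left scaleC_scaleC scaleC_diff_right mult_scaleC_left algebra_simps)
  then have "norm ((z - scaleC (Complex a b) 1) * d2) \<le> norm ((h - a *\<^sub>R 1) * d2) + norm ((k - b *\<^sub>R 1) * d2)"
    using norm_triangle_ineq[of "(h - a *\<^sub>R 1) * d2" "scaleC \<i> ((k - b *\<^sub>R 1) * d2)"] by (simp add: norm_scaleC)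
  also have "\<dots> \<le> \<epsilon> / 2 + \<epsilon> / 2"
    using norm_mult_below_le[OF d2(1,2), of "h - a *\<^sub>R 1"] d1(3) d2(3) by linarith
  finally show ?thesis using that[OF d2(1) below_trans[OF d1(2) d2(2)]] by simp
qed

lemma normalizer_conj: "v \<in> normalizers D \<Longrightarrow> d \<in> D \<Longrightarrow> v * d * adj v \<in> D"
  "v \<in> normalizers D \<Longrightarrow> d \<in> D \<Longrightarrow> adj v * d * v \<in> D"
  by (auto simp: normalizers_def)

lemma normalizer_square: "v \<in> normalizers D \<Longrightarrow> v * adj v \<in> D" "v \<in> normalizers D \<Longrightarrow> adj v * v \<in> D"
  using normalizer_conj[of v 1] D_closed(3) by auto

lemma normalizers_adj: "v \<in> normalizers D \<Longrightarrow> adj v \<in> normalizers D"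
  by (auto simp: normalizers_def adj_adj)

lemma normalizers_mult:
  assumes "v \<in> normalizers D" "w \<in> normalizers D"
  shows "v * w \<in> normalizers D"
  unfolding normalizers_def
proof (intro CollectI ballI conjI)
  fix d assume d: "d \<in> D"
  have "v * w * d * adj (v * w) = v * (w * d * adj w) * adj v"
    "adj (v * w) * d * (v * w) = adj w * (adj v * d * v) * w"
    by (simp_all add: adj_mult mult.assoc)
  then show "v * w * d * adj (v * w) \<in> D" "adj (v * w) * d * (v * w) \<in> D"
    using normalizer_conj[OF assms(1)] normalizer_conj[OF assms(2)] d by metis+
qed

lemma normalizers_1: "1 \<in> normalizers D"
  by (simp add: normalizers_def)

text \<open>If \<open>n\<close> moves the points of the support of \<open>d0\<close>, this is witnessed by some
  \<open>n * f * adj n - f * n * adj n\<close> in \<open>D\<close>, and then a small enough \<open>d\<close> cuts \<open>n\<close> down to about 0.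
  Otherwise \<open>n\<close> is locally in the commutant of \<open>D\<close>.\<close>

lemma localize_normalizer:
  assumes n: "n \<in> normalizers D" and d0: "live D d0" and \<epsilon>: "\<epsilon> > 0"
  obtains d c where "live D d" "d0 * d = d" "norm (d * n * d - scaleC c (d * d)) \<le> \<epsilon>"
proof -
  obtain h0 where h0: "h0 \<in> D" "h0 \<noteq> 0" "d0 * h0 = h0" using d0 by (auto simp: live_def)
  define e where "e = n * adj n"
  define g where "g f = n * f * adj n" for f
  have eD: "e \<in> D" unfolding e_def by (rule normalizer_square[OF n])
  have gD: "f \<in> D \<Longrightarrow> g f \<in> D" for f unfolding g_def by (rule normalizer_conj[OF n])
  show ?thesis
  proof (cases "\<exists>f\<in>D. h0 * (g f - f * e) \<noteq> 0")
    case True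
    then obtain f where f: "f \<in> D" "h0 * (g f - f * e) \<noteq> 0" by blast
    define w where "w = g f - f * e"
    have wD: "w \<in> D" unfolding w_def using f eD gD by (intro D_closed)
    have hw: "h0 * w \<in> D" "h0 * w \<noteq> 0" "d0 * (h0 * w) = h0 * w"
      using f(2) h0(3) D_closed(4)[OF h0(1) wD] by (simp_all add: w_def mult.assoc[symmetric])
    obtain d1 where d1: "live D d1" "d0 * d1 = d1"
      "\<And>x. norm (x * d1) \<le> 2 * norm (x * (h0 * w)) / norm (h0 * w)"
      "\<And>x. norm (d1 * x) \<le> 2 * norm (h0 * w * x) / norm (h0 * w)"
      "\<And>y. d1 * y = y \<Longrightarrow> norm (h0 * w) * norm y \<le> 2 * norm (h0 * w * y)"
      by (rule live_cut_below[OF hw], rule that)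
    \<comment> \<open>The lower bound for \<open>norm (w * d)\<close>: the last clause for
      \<open>d1\<close> gives \<open>norm (h0 * w) \<le> 2 * norm (h0 * (w * d))\<close>.\<close>
    define \<delta> where "\<delta> = norm (h0 * w) / (2 * norm h0)"
    have \<delta>: "\<delta> > 0" using hw h0 by (simp add: \<delta>_def)
    define K where "K = 2 + norm e + norm f"
    have K: "K > 0" by (simp add: K_def add_pos_nonneg)
    define K' where "K' = norm n + norm n ^ 3 + (norm f + 1) * norm n + 1"
    have K': "K' > 0" unfolding K'_def by (intro add_nonneg_pos add_nonneg_nonneg mult_nonneg_nonneg) auto
    \<comment> \<open>\<eta> K bounds the distance of \<open>w * d\<close> from a multiple of
      \<open>d\<close> and must be at most \<delta> / 2; then |\<mu> - l \<nu>| is at least \<delta>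
      / 2. \<eta> K' bounds the error in the identity for \<open>d * n * d\<close> and must be at
      most \<epsilon> times that lower bound. The cap 1 serves to bound
      \<open>cmod l\<close>.\<close>
    define \<eta> where "\<eta> = min 1 (min (\<delta> / (2 * K)) (\<epsilon> * \<delta> / (2 * K')))"
    have \<eta>: "\<eta> > 0" "\<eta> \<le> 1" "\<eta> * K \<le> \<delta> / 2" "\<eta> * K' \<le> \<epsilon> * (\<delta> / 2)"
    proof -
      show "\<eta> > 0" "\<eta> \<le> 1" using \<delta> K K' \<epsilon> by (auto simp: \<eta>_def)
      have "\<eta> \<le> \<delta> / (2 * K)" "\<eta> \<le> \<epsilon> * \<delta> / (2 * K')" by (simp_all add: \<eta>_def)
      then have "\<eta> * (2 * K) \<le> \<delta>" "\<eta> * (2 * K') \<le> \<epsilon> * \<delta>" using K K' by (simp_all add: pos_le_divide_eq)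
      then show "\<eta> * K \<le> \<delta> / 2" "\<eta> * K' \<le> \<epsilon> * (\<delta> / 2)" by simp_all
    qed
    obtain d2 l where d2: "live D d2" "d1 * d2 = d2" "norm ((f - scaleC l 1) * d2) \<le> \<eta>"
      using localize[OF _ d1(1) \<eta>(1)] f D_subset_E by blast
    obtain d3 \<mu> where d3: "live D d3" "d2 * d3 = d3" "norm ((g f - scaleC \<mu> 1) * d3) \<le> \<eta>"
      using localize[OF _ d2(1) \<eta>(1)] gD[OF f(1)] D_subset_E by blast
    obtain d \<nu> where d: "live D d" "d3 * d = d" "norm ((e - scaleC \<nu> 1) * d) \<le> \<eta>"
      using localize[OF _ d3(1) \<eta>(1)] eD D_subset_E by blast
    have dd2: "d2 * d = d" by (rule below_trans[OF d3(2) d(2)])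
    have dd1: "d1 * d = d" by (rule below_trans[OF d2(2) dd2])
    have dd0: "d0 * d = d" by (rule below_trans[OF d1(2) dd1])
    have nd: "norm d = 1" by (rule live_norm[OF d(1)])
    have dD: "d \<in> D" by (rule live_in_D[OF d(1)])
    define F where "F = (f - scaleC l 1) * d"
    define G where "G = (g f - scaleC \<mu> 1) * d"
    define H where "H = (e - scaleC \<nu> 1) * d"
    have nF: "norm F \<le> \<eta>" unfolding F_def using norm_mult_below_le[OF d(1) dd2] d2(3) order_trans by blast
    have nG: "norm G \<le> \<eta>" unfolding G_def using norm_mult_below_le[OF d(1,2)] d3(3) order_trans by blast
    have nH: "norm H \<le> \<eta>" unfolding H_def by (rule d(3))
    have fd: "f * d = scaleC l d + F" "g f * d = scaleC \<mu> d + G" "e * d = scaleC \<nu> d + H"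
      by (simp_all add: F_def G_def H_def left_diff_distrib mult_scaleC_left)
    have ln: "cmod l \<le> norm f + 1"
    proof -
      have "scaleC l d = f * d - F" using fd(1) by simp
      then have "cmod l = norm (f * d - F)" using nd by (metis norm_scaleC mult.right_neutral)
      also have "\<dots> \<le> norm (f * d) + norm F" by (rule norm_triangle_ineq4)
      also have "\<dots> \<le> norm f * norm d + \<eta>" by (intro add_mono norm_mult_ineq nF)
      finally show ?thesis using nd \<eta>(2) by simp
    qed
    have "\<delta> \<le> norm (w * d)"
    proof -
      have "norm (h0 * w) \<le> 2 * norm (h0 * (w * d))" using d1(5)[OF dd1] nd by (simp add: mult.assoc)
      also have "\<dots> \<le> 2 * (norm h0 * norm (w * d))" by (simp add: norm_mult_ineq)
      finally show ?thesis using h0 by (simp add: \<delta>_def field_simps)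
    qed
    moreover have wd: "w * d = scaleC (\<mu> - l * \<nu>) d + (G - (e * F + scaleC l H))"
    proof -
      have "f * e * d = e * (f * d)" using D_comm[OF f(1) eD] by (metis mult.assoc)
      also have "\<dots> = scaleC l (e * d) + e * F" unfolding fd(1) by (simp add: distrib_left mult_scaleC_right)
      also have "\<dots> = scaleC (l * \<nu>) d + (e * F + scaleC l H)"
        unfolding fd(3) by (simp add: scaleC_add_right scaleC_scaleC)
      finally show ?thesis by (simp add: w_def left_diff_distrib fd(2) scaleC_diff_left)
    qed
    moreover have "norm (G - (e * F + scaleC l H)) \<le> \<eta> * K"
    proof -
      have "norm (G - (e * F + scaleC l H)) \<le> norm G + (norm (e * F) + norm (scaleC l H))"
        using norm_triangle_ineq4[of G "e * F + scaleC l H"] norm_triangle_ineq[of "e * F" "scaleC l H"] by linarith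
      also have "\<dots> \<le> \<eta> + (norm e * \<eta> + (norm f + 1) * \<eta>)"
        using nG nF nH ln \<eta> by (intro add_mono order_trans[OF norm_mult_ineq] mult_mono) (auto simp: norm_scaleC intro!: mult_mono)
      also have "\<dots> = \<eta> * K" by (simp add: K_def algebra_simps)
      finally show ?thesis .
    qed
    ultimately have "\<delta> \<le> cmod (\<mu> - l * \<nu>) + \<delta> / 2"
      using norm_triangle_ineq[of "scaleC (\<mu> - l * \<nu>) d" "G - (e * F + scaleC l H)"] \<eta>(3) nd
      by (simp add: norm_scaleC)
    then have lower: "\<delta> / 2 \<le> cmod (\<mu> - l * \<nu>)" by simp
    \<comment> \<open>The product \<open>d * g f * n * d\<close> is evaluated twice:
      \<open>g f\<close> acts as \<mu> on the left, or \<open>g f * n = n * adj n * n * f\<close>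
      lets \<open>f\<close> act as l on the right and then \<open>e\<close> as \<nu> on the left.
      The difference leaves only error terms.\<close>
    have "scaleC (\<mu> - l * \<nu>) (d * n * d) = d * n * adj n * n * F + scaleC l (H * n * d) - G * n * d"
    proof -
      have d_left: "d * g f = g f * d" "d * e = e * d" by (intro D_comm dD gD f eD)+
      have gn: "g f * n = n * adj n * n * f"
      proof -
        have "g f * n = n * (f * (adj n * n))" by (simp add: g_def mult.assoc)
        also have "f * (adj n * n) = adj n * n * f" by (rule D_comm[OF f(1) normalizer_square(2)[OF n]])
        finally show ?thesis by (simp add: mult.assoc)
      qed
      have "scaleC \<mu> (d * n * d) + G * n * d = (d * g f) * n * d"
        unfolding d_left fd(2) by (simp add: distrib_right mult_scaleC_left)
      also have "\<dots> = d * (g f * n) * d" by (simp add: mult.assoc)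
      also have "\<dots> = d * n * adj n * n * (f * d)" unfolding gn by (simp add: mult.assoc)
      also have "\<dots> = scaleC l (d * n * adj n * n * d) + d * n * adj n * n * F"
        unfolding fd(1) by (simp add: distrib_left mult_scaleC_right)
      also have "d * n * adj n * n * d = (d * e) * n * d" by (simp add: e_def mult.assoc)
      also have "\<dots> = scaleC \<nu> (d * n * d) + H * n * d"
        unfolding d_left fd(3) by (simp add: distrib_right mult_scaleC_left)
      finally show ?thesis by (simp add: scaleC_diff_left scaleC_add_right scaleC_scaleC algebra_simps)
    qed
    moreover have "norm (d * n * adj n * n * F + scaleC l (H * n * d) - G * n * d) \<le> \<eta> * K'"
    proof -
      have "norm (d * n * adj n * n * F) \<le> 1 * norm n * norm n * norm n * \<eta>"
        using nd nF by (intro norm_mult_le) auto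
      moreover have "norm (scaleC l (H * n * d)) \<le> (norm f + 1) * (\<eta> * norm n * 1)"
        unfolding norm_scaleC using nd nH ln by (intro mult_mono norm_mult_le) auto
      moreover have "norm (G * n * d) \<le> \<eta> * norm n * 1" using nd nG by (intro norm_mult_le) auto
      ultimately have "norm (d * n * adj n * n * F + scaleC l (H * n * d) - G * n * d)
          \<le> 1 * norm n * norm n * norm n * \<eta> + (norm f + 1) * (\<eta> * norm n * 1) + \<eta> * norm n * 1"
        using norm_triangle_ineq4[of "d * n * adj n * n * F + scaleC l (H * n * d)" "G * n * d"]
          norm_triangle_ineq[of "d * n * adj n * n * F" "scaleC l (H * n * d)"] by linarith
      also have "\<dots> \<le> \<eta> * K'" using \<eta>(1) by (simp add: K'_def algebra_simps power3_eq_cube)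
      finally show ?thesis .
    qed
    ultimately have "cmod (\<mu> - l * \<nu>) * norm (d * n * d) \<le> \<epsilon> * (\<delta> / 2)"
      using \<eta>(4) by (metis norm_scaleC order_trans)
    then have "\<delta> / 2 * norm (d * n * d) \<le> \<delta> / 2 * \<epsilon>"
      using mult_right_mono[OF lower norm_ge_zero[of "d * n * d"]] by (simp add: mult.commute)
    then have "norm (d * n * d) \<le> \<epsilon>" using \<delta> by simp
    then have "norm (d * n * d - scaleC 0 (d * d)) \<le> \<epsilon>" by simp
    then show ?thesis by (rule that[OF d(1) dd0])
  next
    case False
    then have w0: "f \<in> D \<Longrightarrow> h0 * g f = h0 * (f * e)" for f by (auto simp: right_diff_distrib)
    obtain d1 where d1: "live D d1" "d0 * d1 = d1" "\<And>x. norm (d1 * x) \<le> 2 * norm (h0 * x) / norm h0"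
      by (rule live_cut_below[OF h0], rule that)
    have "d1 * n \<in> E" unfolding E_eq
    proof (intro CollectI ballI)
      fix f assume f: "f \<in> D"
      have af: "adj f \<in> D" by (rule D_adj[OF f])
      define y where "y = h0 * (n * f - f * n)"
      define u where "u = n * f - f * n"
      have u: "u * adj u = g (f * adj f) - g f * adj f - (f * g (adj f) - f * e * adj f)"
        by (simp add: u_def g_def e_def adj_mult adj_diff left_diff_distrib right_diff_distrib mult.assoc)
      \<comment> \<open>Since \<open>h0 * g f\<close> equals \<open>h0 * (f * e)\<close> for all f,
        each of the four terms becomes \<open>h0 * f * e * adj f\<close>, and they cancel.\<close>
      have "y * adj y = h0 * (u * adj u) * adj h0" by (simp add: y_def u_def adj_mult mult.assoc)
      also have "h0 * (u * adj u) = h0 * g (f * adj f) - h0 * g f * adj f - (f * (h0 * g (adj f)) - h0 * f * e * adj f)"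
        unfolding u using D_comm[OF h0(1) f] by (simp add: right_diff_distrib mult.assoc[symmetric])
      also have "h0 * g (f * adj f) = h0 * f * e * adj f"
        using w0[of "f * adj f"] f af D_closed(4) D_comm[OF eD af] by (simp add: mult.assoc)
      also have "h0 * g f * adj f = h0 * f * e * adj f" using w0[OF f] by (simp add: mult.assoc)
      also have "f * (h0 * g (adj f)) = h0 * f * e * adj f"
        using w0[OF af] D_comm[OF h0(1) f] D_comm[OF eD af] by (metis mult.assoc)
      finally have "y * adj y = 0" by simp
      then have "y = 0" using cstar_identity'[of y] by simp
      then have "d1 * (n * f - f * n) = 0" using d1(3)[of "n * f - f * n"] by (simp add: y_def)
      then have "d1 * (n * f) = d1 * (f * n)" by (simp add: right_diff_distrib)
      then show "f * (d1 * n) = d1 * n * f" using D_comm[OF f live_in_D[OF d1(1)]] by (metis mult.assoc)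
    qed
    then obtain d c where d: "live D d" "d1 * d = d" "norm ((d1 * n - scaleC c 1) * d) \<le> \<epsilon>"
      using localize[OF _ d1(1) \<epsilon>] by blast
    have dd1: "d * d1 = d" using d(2) D_comm[OF live_in_D[OF d(1)] live_in_D[OF d1(1)]] by simp
    have "d * n * d - scaleC c (d * d) = d * ((d1 * n - scaleC c 1) * d)"
      by (simp add: left_diff_distrib right_diff_distrib mult_scaleC_left mult_scaleC_right mult.assoc[symmetric] dd1)
    then have "norm (d * n * d - scaleC c (d * d)) \<le> norm d * norm ((d1 * n - scaleC c 1) * d)"
      by (simp only: norm_mult_ineq)
    then have "norm (d * n * d - scaleC c (d * d)) \<le> \<epsilon>" using live_norm[OF d(1)] d(3) by simp
    then show ?thesis using that[OF d(1) below_trans[OF d1(2) d(2)]] by blast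
  qed
qed


lemma live_below:
  assumes "live D d0"
  obtains d where "live D d" "d0 * d = d"
proof -
  obtain h0 where h0: "h0 \<in> D" "h0 \<noteq> 0" "d0 * h0 = h0" using assms by (auto simp: live_def)
  show ?thesis by (rule live_cut_below[OF h0], rule that)
qed

section \<open>The ideal of locally null elements\<close>

definition locally_null :: "'a set" where
  "locally_null = {x. \<forall>d0 \<delta>. live D d0 \<longrightarrow> 0 < \<delta> \<longrightarrow> (\<exists>d. live D d \<and> d0 * d = d \<and> norm (x * d) \<le> \<delta>)}"

lemma locally_nullD:
  assumes "x \<in> locally_null" "live D d0" "0 < \<delta>"
  obtains d where "live D d" "d0 * d = d" "norm (x * d) \<le> \<delta>"
  using assms by (auto simp: locally_null_def)

lemma locally_nullI:
  assumes "\<And>d0 \<delta>. live D d0 \<Longrightarrow> 0 < \<delta> \<Longrightarrow> \<exists>d. live D d \<and> d0 * d = d \<and> norm (x * d) \<le> \<delta>"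
  shows "x \<in> locally_null"
  using assms by (auto simp: locally_null_def)

lemma locally_null_left:
  assumes "x \<in> locally_null" shows "b * x \<in> locally_null"
proof (rule locally_nullI)
  fix d0 \<delta> assume d0: "live D d0" and \<delta>: "(0::real) < \<delta>"
  have "\<delta> / (norm b + 1) > 0" using \<delta> by (simp add: add_nonneg_pos)
  then obtain d where d: "live D d" "d0 * d = d" "norm (x * d) \<le> \<delta> / (norm b + 1)"
    using locally_nullD[OF assms d0] by blast
  have "norm (b * x * d) \<le> norm b * norm (x * d)" by (simp add: mult.assoc norm_mult_ineq)
  also have "\<dots> \<le> (norm b + 1) * (\<delta> / (norm b + 1))" using d(3) by (intro mult_mono) auto
  also have "\<dots> = \<delta>" using norm_ge_zero[of b] by (simp add: add_nonneg_eq_0_iff)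
  finally show "\<exists>d. live D d \<and> d0 * d = d \<and> norm (b * x * d) \<le> \<delta>" using d by blast
qed

lemma locally_null_subspace: "csubspace locally_null"
  unfolding csubspace_def
proof (intro conjI ballI allI)
  show "0 \<in> locally_null"
  proof (rule locally_nullI)
    fix d0 \<delta> assume d0: "live D d0" and \<delta>: "(0::real) < \<delta>"
    obtain d where "live D d" "d0 * d = d" using live_below[OF d0] .
    then show "\<exists>d. live D d \<and> d0 * d = d \<and> norm (0 * d) \<le> \<delta>" using \<delta> by auto
  qed
next
  fix x y assume x: "x \<in> locally_null" and y: "y \<in> locally_null"
  show "x + y \<in> locally_null"
  proof (rule locally_nullI)
    fix d0 \<delta> assume d0: "live D d0" and \<delta>: "(0::real) < \<delta>"
    obtain d1 where d1: "live D d1" "d0 * d1 = d1" "norm (x * d1) \<le> \<delta> / 2"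
      using locally_nullD[OF x d0, of "\<delta> / 2"] \<delta> by auto
    obtain d where d: "live D d" "d1 * d = d" "norm (y * d) \<le> \<delta> / 2"
      using locally_nullD[OF y d1(1), of "\<delta> / 2"] \<delta> by auto
    have "norm ((x + y) * d) \<le> norm (x * d) + norm (y * d)" by (simp add: distrib_right norm_triangle_ineq)
    also have "\<dots> \<le> \<delta>" using norm_mult_below_le[OF d(1,2), of x] d1(3) d(3) by linarith
    finally show "\<exists>d. live D d \<and> d0 * d = d \<and> norm ((x + y) * d) \<le> \<delta>"
      using d(1) below_trans[OF d1(2) d(2)] by blast
  qed
next
  fix c x assume "x \<in> locally_null"
  then show "scaleC c x \<in> locally_null"
    using locally_null_left[of x "scaleC c 1"] by (simp add: mult_scaleC_left)
qed

lemma closed_locally_null: "closed locally_null"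
  unfolding closed_sequential_limits
proof (intro allI impI, elim conjE)
  fix s x assume s: "\<forall>n. s n \<in> locally_null" "s \<longlonglongrightarrow> x"
  show "x \<in> locally_null"
  proof (rule locally_nullI)
    fix d0 \<delta> assume d0: "live D d0" and \<delta>: "(0::real) < \<delta>"
    obtain n where n: "norm (s n - x) < \<delta> / 2"
      using LIMSEQ_D[OF s(2), of "\<delta> / 2"] \<delta> by auto
    obtain d where d: "live D d" "d0 * d = d" "norm (s n * d) \<le> \<delta> / 2"
      using locally_nullD[OF s(1)[rule_format] d0, of "\<delta> / 2"] \<delta> by auto
    have "norm ((s n - x) * d) \<le> norm (s n - x)"
      using norm_mult_ineq[of "s n - x" d] live_norm[OF d(1)] by simp
    moreover have "norm (x * d) \<le> norm (s n * d) + norm ((s n - x) * d)"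
      using norm_triangle_ineq4[of "s n * d" "(s n - x) * d"] by (simp add: left_diff_distrib)
    ultimately have "norm (x * d) \<le> \<delta>" using n d(3) by linarith
    then show "\<exists>d. live D d \<and> d0 * d = d \<and> norm (x * d) \<le> \<delta>" using d by blast
  qed
qed

text \<open>The cut stands on the right of \<open>x\<close>, so it has to be moved through
  \<open>n\<close>. A normalizer transports supports: \<open>x\<close> is cut by d2 at the place to
  which \<open>n\<close> carries the support of \<open>h0\<close>, and \<open>adj n * d2 * n\<close>
  pulls this cut back under \<open>d0\<close>.\<close>

lemma locally_null_normalizer:
  assumes x: "x \<in> locally_null" and n: "n \<in> normalizers D"
  shows "x * n \<in> locally_null"
proof (rule locally_nullI)
  fix d0 \<delta> assume d0: "live D d0" and \<delta>: "(0::real) < \<delta>"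
  obtain h where h: "h \<in> D" "h \<noteq> 0" "d0 * h = h" using d0 by (auto simp: live_def)
  define h0 where "h0 = h * adj h"
  have h0: "h0 \<in> D" "h0 \<noteq> 0" "d0 * h0 = h0" "adj h0 = h0"
    using h D_adj D_closed(4) adj_mult_self_eq_0[of "adj h"]
    by (auto simp: h0_def mult.assoc[symmetric] adj_mult adj_adj)
  define m where "m = adj n * n"
  \<comment> \<open>\<open>k0\<close> lives where \<open>n\<close> carries the support of
    \<open>h0\<close>; the extra factor \<open>n * adj n\<close> is what makes
    \<open>n * k * adj n = k0 * d2\<close> hold below. If it vanishes, then
    \<open>n * h0 = 0\<close> and a cut at \<open>h0\<close> annihilates
    \<open>x * n\<close>.\<close>
  define k0 where "k0 = n * h0 * adj n * (n * adj n)"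
  have mD: "m \<in> D" unfolding m_def by (rule normalizer_square[OF n])
  have k0D: "k0 \<in> D" unfolding k0_def by (intro D_closed normalizer_conj normalizer_square n h0)
  show "\<exists>d. live D d \<and> d0 * d = d \<and> norm (x * n * d) \<le> \<delta>"
  proof (cases "k0 = 0")
    case True
    have hm: "h0 * m = m * h0" by (intro D_comm h0 mD)
    have "adj n * k0 * n = m * h0 * m * m" by (simp add: k0_def m_def mult.assoc)
    then have mmm: "m * h0 * m * m = 0" using True by simp
    define y where "y = h0 * m"
    have ay: "adj y = y" using hm by (simp add: y_def m_def adj_mult adj_adj h0)
    have "y * y * y = h0 * (m * h0 * m * (h0 * m))" by (simp add: y_def mult.assoc)
    also have "\<dots> = h0 * (m * h0 * m * m * h0)" unfolding hm by (simp only: mult.assoc)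
    finally have "y * y * y = 0" using mmm by simp
    then have "(y * y) * (y * y) = 0" by (simp add: mult.assoc[symmetric])
    then have "adj (y * y) * (y * y) = 0" by (simp add: adj_mult ay)
    then have "adj y * y = 0" by (simp add: adj_mult_self_eq_0 ay)
    then have "h0 * m = 0" by (simp add: adj_mult_self_eq_0 y_def)
    then have "adj (n * h0) * (n * h0) = 0" by (simp add: adj_mult h0 m_def mult.assoc[symmetric])
    then have nh: "n * h0 = 0" by (simp add: adj_mult_self_eq_0)
    obtain d where d: "live D d" "d0 * d = d" "\<And>y. norm (y * d) \<le> 2 * norm (y * h0) / norm h0"
      by (rule live_cut_below[OF h0(1-3)], rule that)
    have "norm (x * n * d) \<le> 0" using d(3)[of "x * n"] nh by (simp add: mult.assoc)
    then show ?thesis using d \<delta> by (intro exI[of _ d]) auto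
  next
    case False
    obtain d1 where d1: "live D d1" "\<And>y. d1 * y = y \<Longrightarrow> norm k0 * norm y \<le> 2 * norm (k0 * y)"
      by (rule live_cut[OF k0D False], rule that)
    \<comment> \<open>The losses on the way: norm h0 * norm n ^ 3 from \<open>q * n\<close>, a
      division by \<open>norm k\<close>, which is at least norm k0 / (2 norm n ^ 2), and the factor
      2 of \<open>live_cut_below\<close>; the summand 1 keeps C positive.\<close>
    define C where "C = 4 * (norm h0 * norm n ^ 3) * norm n ^ 2 / norm k0 + 1"
    have C: "C > 0" unfolding C_def by (intro add_nonneg_pos) auto
    have "\<delta> / C > 0" using \<delta> C by simp
    then obtain d2 where d2: "live D d2" "d1 * d2 = d2" "norm (x * d2) \<le> \<delta> / C"
      using locally_nullD[OF x d1(1)] by blast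
    have d2D: "d2 \<in> D" by (rule live_in_D[OF d2(1)])
    define k where "k = h0 * (adj n * d2 * n)"
    have kD: "k \<in> D" unfolding k_def by (intro D_closed h0 normalizer_conj n d2D)
    have d0k: "d0 * k = k" by (simp add: k_def mult.assoc[symmetric] h0)
    define q where "q = n * h0 * adj n"
    have qD: "q \<in> D" unfolding q_def by (intro normalizer_conj n h0)
    have qd: "q * d2 = d2 * q" by (intro D_comm qD d2D)
    have ed: "n * adj n * d2 = d2 * (n * adj n)" by (intro D_comm normalizer_square n d2D)
    have "n * k * adj n = q * d2 * (n * adj n)" by (simp add: k_def q_def mult.assoc)
    also have "\<dots> = k0 * d2" unfolding k0_def q_def[symmetric] using ed by (simp add: mult.assoc)
    finally have nk: "n * k * adj n = k0 * d2" .
    have "norm k0 \<le> 2 * norm (n * k * adj n)" using d1(2)[OF d2(2)] live_norm[OF d2(1)] by (simp add: nk)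
    also have "\<dots> \<le> 2 * (norm n * norm k * norm (adj n))"
      by (intro mult_left_mono order_trans[OF norm_mult_ineq] mult_right_mono norm_mult_ineq) auto
    finally have nk2: "norm k0 \<le> 2 * norm n ^ 2 * norm k" by (simp add: power2_eq_square mult_ac)
    then have kn0: "k \<noteq> 0" using False by auto
    have "x * n * k = (x * d2) * (q * n)"
    proof -
      have "x * n * k = x * (q * d2) * n" by (simp add: k_def q_def mult.assoc)
      then show ?thesis unfolding qd by (simp add: mult.assoc)
    qed
    then have "norm (x * n * k) \<le> norm (x * d2) * norm (q * n)" by (simp add: norm_mult_ineq)
    also have "\<dots> \<le> \<delta> / C * (norm n * norm h0 * norm (adj n) * norm n)"
    proof (rule mult_mono[OF d2(3)])
      show "norm (q * n) \<le> norm n * norm h0 * norm (adj n) * norm n"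
        unfolding q_def by (intro norm_mult_le) auto
    qed (use \<delta> C in auto)
    also have "\<dots> = \<delta> / C * (norm h0 * norm n ^ 3)" by (simp add: power3_eq_cube mult_ac)
    finally have xnk: "norm (x * n * k) \<le> \<delta> / C * (norm h0 * norm n ^ 3)" .
    obtain d where d: "live D d" "d0 * d = d" "\<And>y. norm (y * d) \<le> 2 * norm (y * k) / norm k"
      by (rule live_cut_below[OF kD kn0 d0k], rule that)
    have "2 * norm (x * n * k) * norm k0 \<le> 2 * (\<delta> / C * (norm h0 * norm n ^ 3)) * (2 * norm n ^ 2 * norm k)"
      using xnk nk2 \<delta> C by (intro mult_mono) auto
    also have "\<dots> = (\<delta> / C) * (4 * (norm h0 * norm n ^ 3) * norm n ^ 2 / norm k0) * norm k * norm k0"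
      using False by simp
    also have "\<dots> \<le> (\<delta> / C) * C * norm k * norm k0"
      using \<delta> C by (intro mult_right_mono mult_left_mono) (auto simp: C_def)
    finally have "2 * norm (x * n * k) \<le> \<delta> * norm k" using False C by simp
    then have "2 * norm (x * n * k) / norm k \<le> \<delta>" using kn0 by (simp add: pos_divide_le_eq)
    then show ?thesis using d(1,2) order_trans[OF d(3)] by blast
  qed
qed

text \<open>Regularity enters here: the elements \<open>c\<close> with \<open>x * c\<close> locally
  null form a closed subspace that contains all normalizers.\<close>

lemma locally_null_right:
  assumes "x \<in> locally_null" shows "x * b \<in> locally_null"
proof -
  define R where "R = (\<lambda>c. x * c) -` locally_null"
  have "closed R" unfolding R_def
    by (intro closed_vimage closed_locally_null continuous_intros)
  moreover have "csubspace R" unfolding csubspace_def R_def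
    using csubspaceD[OF locally_null_subspace] by (auto simp: distrib_left mult_scaleC_right)
  moreover have "normalizers D \<subseteq> R" unfolding R_def using locally_null_normalizer[OF assms] by auto
  ultimately have "closure (cspan (normalizers D)) \<subseteq> R"
    by (intro closure_minimal) (auto simp: cspan_def)
  moreover have "closure (cspan (normalizers D)) = UNIV"
    using pseudo_cartan by (simp add: pseudo_cartan_def regular_inclusion_def)
  ultimately show ?thesis by (auto simp: R_def)
qed

lemma locally_null_D: "locally_null \<inter> D = {0}"
proof -
  have "k = 0" if k: "k \<in> locally_null" "k \<in> D" for k
  proof (rule ccontr)
    assume "k \<noteq> 0"
    obtain d0 where d0: "live D d0" "\<And>y. d0 * y = y \<Longrightarrow> norm k * norm y \<le> 2 * norm (k * y)"
      by (rule live_cut[OF k(2) \<open>k \<noteq> 0\<close>], rule that)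
    obtain d where d: "live D d" "d0 * d = d" "norm (k * d) \<le> norm k / 3"
      using locally_nullD[OF k(1) d0(1), of "norm k / 3"] \<open>k \<noteq> 0\<close> by auto
    have "norm k \<le> 2 * norm (k * d)" using d0(2)[OF d(2)] live_norm[OF d(1)] by simp
    moreover have "norm k > 0" using \<open>k \<noteq> 0\<close> by simp
    ultimately show False using d(3) by linarith
  qed
  then show ?thesis using csubspaceD(1)[OF locally_null_subspace] D_closed by auto
qed

text \<open>Two stages, one for each intersection property: the trivial intersection with
  \<open>D\<close> gives a trivial intersection with \<open>E\<close>, and this gives the claim in
  the whole algebra.\<close>

lemma locally_null_eq: "locally_null = {0}"
proof -
  have LE: "closed_ideal E (locally_null \<inter> E)"
    unfolding closed_ideal_def using E_closed(2) closed_locally_null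
      csubspaceD[OF locally_null_subspace] E_closed locally_null_left locally_null_right
    by (auto simp: csubspace_def intro!: closed_Int)
  have "locally_null \<inter> E = {0}"
  proof (rule ccontr)
    assume "locally_null \<inter> E \<noteq> {0}"
    then obtain h where "h \<in> locally_null \<inter> E" "h \<in> D" "h \<noteq> 0" using E_ideal_meets_D[OF LE] by blast
    then show False using locally_null_D by blast
  qed
  moreover have "closed_ideal UNIV locally_null"
    unfolding closed_ideal_def
    using closed_locally_null locally_null_subspace locally_null_left locally_null_right by auto
  ultimately show ?thesis
    using pseudo_cartan by (auto simp: pseudo_cartan_def ideal_intersection_property_def E_def)
qed

lemma bounded_below_locally:
  assumes "x \<noteq> 0"
  obtains d0 \<delta> where "live D d0" "\<delta> > 0" "\<And>d. live D d \<Longrightarrow> d0 * d = d \<Longrightarrow> \<delta> \<le> norm (x * d)"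
proof -
  have "x \<notin> locally_null" using assms locally_null_eq by auto
  then obtain d0 \<delta> where "live D d0" "0 < \<delta>" "\<And>d. live D d \<Longrightarrow> d0 * d = d \<Longrightarrow> \<not> norm (x * d) \<le> \<delta>"
    by (auto simp: locally_null_def)
  then show ?thesis using that by force
qed

end

subsection \<open>The Hahn-Banach theorem for sublinear functionals\<close>

definition sublinear :: "('v::real_vector \<Rightarrow> real) \<Rightarrow> bool" where
  "sublinear p \<longleftrightarrow> (\<forall>x y. p (x + y) \<le> p x + p y) \<and> (\<forall>t>0. \<forall>x. p (t *\<^sub>R x) \<le> t * p x)"

lemma sublinearD:
  assumes "sublinear p"
  shows "p (x + y) \<le> p x + p y" "t > 0 \<Longrightarrow> p (t *\<^sub>R x) = t * p x" "p 0 = 0" "- p (- x) \<le> p x"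
proof -
  show add: "\<And>x y. p (x + y) \<le> p x + p y" using assms by (auto simp: sublinear_def)
  have le: "p (t *\<^sub>R x) \<le> t * p x" if "t > 0" for t x using assms that by (auto simp: sublinear_def)
  show "p (t *\<^sub>R x) = t * p x" if t: "t > 0" for t x
    using le[OF t, of x] le[of "1 / t" "t *\<^sub>R x"] t by (simp add: field_simps)
  have "p 0 \<le> 2 * p 0" "p 0 \<le> (1/2) * p 0" using le[of 2 0] le[of "1/2" 0] by simp_all
  then show "p 0 = 0" by simp
  then show "- p (- x) \<le> p x" using add[of x "- x"] by simp
qed

text \<open>A pair (m, r) in the cone is read as the constraint r <= f m on a functional f to be
  found.\<close>

definition real_cone :: "('v::real_vector \<times> real) set \<Rightarrow> bool" where
  "real_cone M \<longleftrightarrow> 0 \<in> M \<and> (\<forall>u\<in>M. \<forall>v\<in>M. u + v \<in> M) \<and> (\<forall>t>0. \<forall>u\<in>M. t *\<^sub>R u \<in> M)"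

text \<open>The infimum of p (x + m) - r over the constraints (m, r) absorbs them into the majorant:
  every linear f below it satisfies f (- m) <= - r.\<close>

lemma sublinear_shift:
  fixes p :: "'v::real_vector \<Rightarrow> real"
  assumes p: "sublinear p" and M: "real_cone M" and le: "\<And>m r. (m, r) \<in> M \<Longrightarrow> r \<le> p m"
  obtains p' where "sublinear p'" "\<And>x. p' x \<le> p x" "\<And>m r. (m, r) \<in> M \<Longrightarrow> p' (- m) \<le> - r"
proof -
  note P = sublinearD[OF p]
  define g where "g x u = p (x + fst u) - snd u" for x u
  define p' where "p' x = (INF u\<in>M. g x u)" for x
  have M0: "0 \<in> M" "M \<noteq> {}" using M by (auto simp: real_cone_def)
  have lower: "- p (- x) \<le> g x u" if "u \<in> M" for x u
    using le[of "fst u" "snd u"] that P(1)[of "x + fst u" "- x"] by (simp add: g_def)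
  have bdd: "bdd_below (g x ` M)" for x using lower by (auto intro!: bdd_belowI2)
  have up: "p' x \<le> g x u" if "u \<in> M" for x u unfolding p'_def by (rule cINF_lower[OF bdd that])
  have "p' (x + y) \<le> p' x + p' y" for x y
  proof -
    have *: "p' (x + y) \<le> g x u + g y v" if uv: "u \<in> M" "v \<in> M" for u v
    proof -
      have "u + v \<in> M" using uv M by (auto simp: real_cone_def)
      from up[OF this, of "x + y"] have "p' (x + y) \<le> p ((x + fst u) + (y + fst v)) - (snd u + snd v)"
        by (simp add: g_def algebra_simps)
      then show ?thesis using P(1)[of "x + fst u" "y + fst v"] by (simp add: g_def)
    qed
    have "p' (x + y) - g x u \<le> p' y" if "u \<in> M" for u
      unfolding p'_def[of y] by (rule cINF_greatest[OF M0(2)]) (use *[OF that] in \<open>simp add: algebra_simps\<close>)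
    then have "p' (x + y) - p' y \<le> g x u" if "u \<in> M" for u using that by (simp add: algebra_simps)
    then have "p' (x + y) - p' y \<le> p' x" unfolding p'_def[of x] by (intro cINF_greatest M0(2))
    then show ?thesis by simp
  qed
  moreover have "p' (t *\<^sub>R x) \<le> t * p' x" if t: "t > 0" for t x
  proof -
    have "p' (t *\<^sub>R x) / t \<le> g x u" if "u \<in> M" for u
    proof -
      have "t *\<^sub>R u \<in> M" using t that M by (auto simp: real_cone_def)
      from up[OF this] have "p' (t *\<^sub>R x) \<le> p (t *\<^sub>R (x + fst u)) - t * snd u"
        by (simp add: g_def scaleR_add_right)
      then have "p' (t *\<^sub>R x) \<le> t * g x u" by (simp only: P(2)[OF t] g_def right_diff_distrib)
      then show ?thesis using t by (simp add: pos_divide_le_eq mult.commute)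
    qed
    then have "p' (t *\<^sub>R x) / t \<le> p' x" unfolding p'_def[of x] by (intro cINF_greatest M0(2))
    then show ?thesis using t by (simp add: field_simps)
  qed
  ultimately have "sublinear p'" by (auto simp: sublinear_def)
  moreover have "p' x \<le> p x" for x using up[OF M0(1)] by (simp add: g_def)
  moreover have "p' (- m) \<le> - r" if "(m, r) \<in> M" for m r using up[OF that, of "- m"] P(3) by (simp add: g_def)
  ultimately show ?thesis using that by blast
qed

text \<open>Shifting \<open>m\<close> along the ray through (y, m y) cannot change it by minimality,
  so m (- y) <= - m y, and with subadditivity \<open>m\<close> becomes additive.\<close>

lemma minimal_sublinear_is_linear:
  fixes m :: "'v::real_vector \<Rightarrow> real"
  assumes m: "sublinear m" and minimal: "\<And>q. sublinear q \<Longrightarrow> (\<And>x. q x \<le> m x) \<Longrightarrow> q = m"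
  shows "linear m"
proof -
  note P = sublinearD[OF m]
  have super: "m x + m y \<le> m (x + y)" for x y
  proof -
    let ?M = "(\<lambda>t. (t *\<^sub>R y, t * m y)) ` {0..}"
    have "real_cone ?M"
      unfolding real_cone_def
    proof (intro conjI ballI allI impI)
      show "0 \<in> ?M" by (rule image_eqI[of _ _ 0]) (auto simp: zero_prod_def)
      fix u v assume "u \<in> ?M" "v \<in> ?M"
      then obtain s t where "s \<ge> 0" "t \<ge> 0" "u = (s *\<^sub>R y, s * m y)" "v = (t *\<^sub>R y, t * m y)" by auto
      then show "u + v \<in> ?M" by (intro image_eqI[of _ _ "s + t"]) (auto simp: algebra_simps)
    next
      fix t :: real and u assume "0 < t" "u \<in> ?M"
      then obtain s where "s \<ge> 0" "u = (s *\<^sub>R y, s * m y)" by auto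
      then show "t *\<^sub>R u \<in> ?M" using \<open>0 < t\<close> by (intro image_eqI[of _ _ "t * s"]) auto
    qed
    moreover have "r \<le> m z" if zr: "(z, r) \<in> ?M" for z r
    proof -
      obtain t where t: "t \<ge> 0" "z = t *\<^sub>R y" "r = t * m y" using zr by auto
      then show ?thesis using P(2)[of t y] P(3) by (cases "t = 0") auto
    qed
    ultimately obtain q where q: "sublinear q" "\<And>x. q x \<le> m x" "\<And>z r. (z, r) \<in> ?M \<Longrightarrow> q (- z) \<le> - r"
      using sublinear_shift[OF m] by blast
    have "q = m" by (rule minimal[OF q(1,2)])
    moreover have "(y, m y) \<in> ?M" by (rule image_eqI[of _ _ 1]) auto
    ultimately have "m (- y) \<le> - m y" using q(3) by blast
    then show ?thesis using P(1)[of "x + y" "- y"] by simp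
  qed
  then have add: "m (x + y) = m x + m y" for x y using P(1) by (simp add: antisym)
  have neg: "m (- x) = - m x" for x using add[of x "- x"] P(3) by simp
  have "m (t *\<^sub>R x) = t * m x" for t x
    using P(2)[of t x] P(2)[of "- t" x] P(3) neg[of "t *\<^sub>R x"] by (cases t "0::real" rule: linorder_cases) auto
  then show ?thesis by (intro linearI) (auto simp: add)
qed

text \<open>Zorn's lemma for the reversed pointwise order. Infima over chains are finite, because
  every sublinear q below \<open>p\<close> satisfies q x >= - p (- x).\<close>

lemma minimal_sublinear_exists:
  fixes p :: "'v::real_vector \<Rightarrow> real"
  assumes p: "sublinear p"
  obtains m where "sublinear m" "\<And>x. m x \<le> p x" "\<And>q. sublinear q \<Longrightarrow> (\<And>x. q x \<le> m x) \<Longrightarrow> q = m"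
proof -
  define A where "A = {q. sublinear q \<and> (\<forall>x. q x \<le> p x)}"
  define R where "R q q' \<longleftrightarrow> (\<forall>x. q' x \<le> q x)" for q q' :: "'v \<Rightarrow> real"
  have "\<exists>m\<in>A. \<forall>q\<in>A. R m q \<longrightarrow> q = m"
  proof (rule predicate_Zorn)
    show "partial_order_on A (relation_of R A)"
      by (rule partial_order_on_relation_ofI) (auto simp: R_def fun_eq_iff intro: order_trans antisym)
    fix C assume C: "C \<in> Chains (relation_of R A)"
    have CA: "C \<subseteq> A" and tot: "\<And>q q'. q \<in> C \<Longrightarrow> q' \<in> C \<Longrightarrow> R q q' \<or> R q' q"
      using C by (auto simp: Chains_def relation_of_def)
    show "\<exists>u\<in>A. \<forall>a\<in>C. R a u"
    proof (cases "C = {}")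
      case True
      then show ?thesis using p by (auto simp: A_def)
    next
      case False
      define u where "u x = (INF q\<in>C. q x)" for x
      have CD: "sublinear q" "q x \<le> p x" if "q \<in> C" for q x using that CA by (auto simp: A_def)
      have bdd: "bdd_below ((\<lambda>q. q x) ` C)" for x
      proof (rule bdd_belowI2)
        fix q assume q: "q \<in> C"
        show "- p (- x) \<le> q x" using sublinearD(4)[OF CD(1)[OF q], of x] CD(2)[OF q, of "- x"] by linarith
      qed
      have up: "u x \<le> q x" if "q \<in> C" for q x unfolding u_def by (rule cINF_lower[OF bdd that])
      have "u (x + y) \<le> u x + u y" for x y
      proof -
        have *: "u (x + y) \<le> q x + q' y" if qq: "q \<in> C" "q' \<in> C" for q q'
        proof -
          obtain r where r: "r \<in> C" "r x \<le> q x" "r y \<le> q' y" using tot[OF qq] qq unfolding R_def by blast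
          have "u (x + y) \<le> r (x + y)" by (rule up[OF r(1)])
          also have "\<dots> \<le> r x + r y" by (rule sublinearD(1)[OF CD(1)[OF r(1)]])
          finally show ?thesis using r by linarith
        qed
        have "u (x + y) - q x \<le> u y" if "q \<in> C" for q
          unfolding u_def[of y] by (rule cINF_greatest[OF False]) (use *[OF that] in \<open>simp add: algebra_simps\<close>)
        then have "u (x + y) - u y \<le> q x" if "q \<in> C" for q using that by (simp add: algebra_simps)
        then have "u (x + y) - u y \<le> u x" unfolding u_def[of x] by (intro cINF_greatest False)
        then show ?thesis by simp
      qed
      moreover have "u (t *\<^sub>R x) \<le> t * u x" if t: "t > 0" for t x
      proof -
        have "u (t *\<^sub>R x) / t \<le> q x" if "q \<in> C" for q
          using up[OF that, of "t *\<^sub>R x"] sublinearD(2)[OF CD(1)[OF that] t, of x] t by (simp add: field_simps)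
        then have "u (t *\<^sub>R x) / t \<le> u x" unfolding u_def[of x] by (intro cINF_greatest False)
        then show ?thesis using t by (simp add: field_simps)
      qed
      ultimately have "sublinear u" by (auto simp: sublinear_def)
      moreover obtain q where "q \<in> C" using False by blast
      ultimately have "u \<in> A" unfolding A_def using up[OF \<open>q \<in> C\<close>] CD(2)[OF \<open>q \<in> C\<close>] order_trans by blast
      then show ?thesis using up by (auto simp: R_def)
    qed
  qed
  then obtain m where m: "m \<in> A" "\<And>q. q \<in> A \<Longrightarrow> R m q \<Longrightarrow> q = m" by blast
  show ?thesis
  proof (rule that)
    show "sublinear m" "\<And>x. m x \<le> p x" using m(1) by (auto simp: A_def)
    fix q assume q: "sublinear q" "\<And>x. q x \<le> m x"
    have "q \<in> A" using q m(1) order_trans unfolding A_def by blast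
    then show "q = m" using q m(2) by (simp add: R_def)
  qed
qed

theorem Hahn_Banach_cone:
  fixes p :: "'v::real_vector \<Rightarrow> real"
  assumes "sublinear p" "real_cone M" "\<And>m r. (m, r) \<in> M \<Longrightarrow> r \<le> p m"
  obtains f where "linear f" "\<And>x. f x \<le> p x" "\<And>m r. (m, r) \<in> M \<Longrightarrow> r \<le> f m"
proof -
  obtain p' where p': "sublinear p'" "\<And>x. p' x \<le> p x" "\<And>m r. (m, r) \<in> M \<Longrightarrow> p' (- m) \<le> - r"
    using sublinear_shift[OF assms] by blast
  obtain f where f: "sublinear f" "\<And>x. f x \<le> p' x" "\<And>q. sublinear q \<Longrightarrow> (\<And>x. q x \<le> f x) \<Longrightarrow> q = f"
    using minimal_sublinear_exists[OF p'(1)] by blast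
  have lin: "linear f" by (rule minimal_sublinear_is_linear[OF f(1,3)])
  show ?thesis
  proof (rule that[OF lin])
    show "f x \<le> p x" for x using f(2) p'(2) order_trans by blast
    show "r \<le> f m" if "(m, r) \<in> M" for m r
      using f(2)[of "- m"] p'(3)[OF that] linear_neg[OF lin, of m] by simp
  qed
qed

subsection \<open>States and their seminorms\<close>

text \<open>The bound concerns the real part because that is what Hahn-Banach delivers; the bound on
  the modulus follows in \<open>cstate_norm_le\<close>. The value at 1 is obtained from
  \<open>cstate_absorb\<close>, once some contraction has value 1.\<close>

definition cstate :: "('a::cstar_algebra \<Rightarrow> complex) \<Rightarrow> bool" where
  "cstate \<phi> \<longleftrightarrow> (\<forall>x y. \<phi> (x + y) = \<phi> x + \<phi> y) \<and> (\<forall>c x. \<phi> (scaleC c x) = c * \<phi> x) \<and>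
     (\<forall>x. \<phi> (adj x) = cnj (\<phi> x)) \<and> (\<forall>x. 0 \<le> Re (\<phi> (adj x * x))) \<and> (\<forall>x. Re (\<phi> x) \<le> norm x)"

text \<open>The infimum of norm (t + x) - t over t is the maximum of Re \<phi> x over the unital
  states \<phi>, so a real functional below it should be the real part of a state. For x = i h with
  \<open>h\<close> self-adjoint, norm (t + x) exceeds t by at most norm h ^ 2 / (2 t), which forces
  f x = 0.\<close>

lemma cstate_of_linear:
  fixes f :: "'a::cstar_algebra \<Rightarrow> real"
  assumes lin: "linear f" and f: "\<And>x t. t \<ge> 0 \<Longrightarrow> f x \<le> norm (t *\<^sub>R 1 + x) - t"
  shows "cstate (\<lambda>x. Complex (f x) (- f (scaleC \<i> x)))"
proof -
  note L = linear_add[OF lin] linear_scale[OF lin] linear_neg[OF lin] linear_diff[OF lin]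
  have imag_le: "f (scaleC \<i> h) \<le> 0" if h: "adj h = h" for h
  proof (rule ccontr)
    define e where "e = f (scaleC \<i> h)"
    assume "\<not> f (scaleC \<i> h) \<le> 0"
    then have e: "e > 0" by (simp add: e_def)
    \<comment> \<open>This makes the cross term 2 e t equal to norm h ^ 2, which leaves e^2 <=
      0.\<close>
    define t where "t = norm h ^ 2 / (2 * e)"
    have t: "t \<ge> 0" using e by (simp add: t_def)
    let ?z = "t *\<^sub>R 1 + scaleC \<i> h"
    have "adj ?z * ?z = t\<^sup>2 *\<^sub>R 1 + h * h"
      by (simp add: adj_add adj_scaleR adj_scaleC h algebra_simps mult_scaleC_left mult_scaleC_right
          scaleC_scaleC scaleC_minus_left scaleC_minus1 power2_eq_square scaleC_add_right scaleC_diff_right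
          scaleR_scaleC scaleC_one mult.commute)
    then have "norm ?z ^ 2 \<le> norm (t\<^sup>2 *\<^sub>R (1::'a)) + norm (h * h)"
      using cstar_identity[of ?z] norm_triangle_ineq by metis
    then have "norm ?z ^ 2 \<le> t\<^sup>2 + norm h ^ 2" by (simp add: norm_square_selfadj[OF h])
    moreover have "e + t \<le> norm ?z" using f[OF t, of "scaleC \<i> h"] by (simp add: e_def)
    then have "(e + t) ^ 2 \<le> norm ?z ^ 2" using e t by (intro power_mono) auto
    ultimately have "(e + t)\<^sup>2 \<le> t\<^sup>2 + norm h ^ 2" by linarith
    then have "e\<^sup>2 + 2 * e * t \<le> norm h ^ 2" by (simp add: power2_sum)
    moreover have "2 * e * t = norm h ^ 2" using e by (simp add: t_def)
    ultimately show False using e by simp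
  qed
  have imag: "f (scaleC \<i> h) = 0" if h: "adj h = h" for h
    using imag_le[OF h] imag_le[of "- h"] h by (simp add: adj_minus scaleC_minus_right L)
  have fadj: "f (adj x) = f x" for x
  proof -
    obtain h k where hk: "adj h = h" "adj k = k" "x = h + scaleC \<i> k" using real_imag_decomp by metis
    have "adj x = h - scaleC \<i> k" unfolding hk(3) by (simp add: adj_add adj_scaleC hk(1,2) scaleC_minus_left)
    then show ?thesis unfolding hk(3) by (simp add: L imag[OF hk(2)])
  qed
  have pos: "0 \<le> f (adj x * x)" for x
  proof -
    have "f (- (adj x * x)) \<le> norm ((norm x ^ 2) *\<^sub>R 1 + - (adj x * x)) - norm x ^ 2" by (rule f) simp
    moreover have "norm ((norm x ^ 2) *\<^sub>R 1 - adj x * x) \<le> norm x ^ 2"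
      by (rule norm_minus_cpos[OF cpos_adj_mult]) (simp add: cstar_identity)
    ultimately show ?thesis by (simp add: L)
  qed
  have mult: "scaleC c x = Re c *\<^sub>R x + Im c *\<^sub>R scaleC \<i> x" for c and x :: 'a
    by (simp add: scaleR_scaleC scaleC_scaleC scaleC_add_left[symmetric]) (metis complex_eq mult.commute)
  have hom: "Complex (f (scaleC c x)) (- f (scaleC \<i> (scaleC c x))) = c * Complex (f x) (- f (scaleC \<i> x))" for c x
  proof -
    have "scaleC \<i> (scaleC c x) = Re c *\<^sub>R scaleC \<i> x - Im c *\<^sub>R x"
      by (subst mult) (simp add: scaleC_add_right scaleR_scaleC scaleC_scaleC scaleC_minus_left mult.commute)
    then show ?thesis by (simp add: mult[of c x] L complex_eq_iff)
  qed
  have fiadj: "f (scaleC \<i> (adj x)) = - f (scaleC \<i> x)" for x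
    using fadj[of "scaleC \<i> x"] by (simp add: adj_scaleC scaleC_minus_left L)
  show ?thesis unfolding cstate_def
  proof (intro conjI allI)
    fix x y :: 'a
    show "Complex (f (x + y)) (- f (scaleC \<i> (x + y)))
        = Complex (f x) (- f (scaleC \<i> x)) + Complex (f y) (- f (scaleC \<i> y))"
      by (simp add: L(1) scaleC_add_right complex_eq_iff)
    show "Complex (f (adj x)) (- f (scaleC \<i> (adj x))) = cnj (Complex (f x) (- f (scaleC \<i> x)))"
      by (simp add: fadj fiadj complex_eq_iff)
    show "0 \<le> Re (Complex (f (adj x * x)) (- f (scaleC \<i> (adj x * x))))" using pos by simp
    show "Re (Complex (f x) (- f (scaleC \<i> x))) \<le> norm x" using f[of 0 x] by simp
  qed (rule hom)
qed

text \<open>The hypothesis on \<open>d\<close> covers both uses: a decreasing sequence of localizing elements in \<open>C\<close>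
  and a constant sequence with value the unit of a subalgebra that may differ from 1.\<close>

lemma cstate_exists:
  fixes d :: "nat \<Rightarrow> 'a::cstar_algebra"
  assumes d: "\<And>i. norm (d i) \<le> 1" "\<And>i. norm (d i * d i) = 1"
      "\<And>i j x. i \<le> j \<Longrightarrow> norm (d j * x * d j) \<le> norm (d i * x * d i)"
    and M: "real_cone M" "\<And>m r i t. (m, r) \<in> M \<Longrightarrow> t \<ge> 0 \<Longrightarrow> r + t \<le> norm (d i * (t *\<^sub>R 1 + m) * d i)"
  obtains \<phi> where "cstate \<phi>" "\<And>m r. (m, r) \<in> M \<Longrightarrow> r \<le> Re (\<phi> m)"
    "\<And>x i t. t \<ge> 0 \<Longrightarrow> Re (\<phi> x) \<le> norm (d i * (t *\<^sub>R 1 + x) * d i) - t"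
proof -
  define g where "g x u = norm (d (fst u) * (snd u *\<^sub>R 1 + x) * d (fst u)) - snd u" for x u
  define I where "I = (UNIV :: nat set) \<times> {0::real..}"
  have I0: "I \<noteq> {}" by (auto simp: I_def)
  define p where "p x = (INF u\<in>I. g x u)" for x
  have dxd: "norm (d i * x * d i) \<le> norm x" for i x
    using norm_mult_le[OF norm_mult_le[OF d(1) order_refl] d(1), of i x i] by simp
  have lower: "- norm x \<le> g x u" if "u \<in> I" for x u
  proof -
    obtain i t where u: "u = (i, t)" "t \<ge> 0" using \<open>u \<in> I\<close> by (auto simp: I_def)
    have "t = norm (t *\<^sub>R (d i * d i))" using u d(2) by simp
    also have "t *\<^sub>R (d i * d i) = d i * (t *\<^sub>R 1 + x) * d i - d i * x * d i" by (simp add: algebra_simps)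
    also have "norm \<dots> \<le> norm (d i * (t *\<^sub>R 1 + x) * d i) + norm (d i * x * d i)" by (rule norm_triangle_ineq4)
    finally show ?thesis using dxd[of i x] by (simp add: g_def u)
  qed
  have bdd: "bdd_below (g x ` I)" for x using lower by (auto intro!: bdd_belowI2)
  have up: "p x \<le> g x u" if "u \<in> I" for x u unfolding p_def by (rule cINF_lower[OF bdd that])
  have p: "sublinear p" unfolding sublinear_def
  proof (intro conjI allI impI)
    fix x y
    have *: "p (x + y) \<le> g x u + g y v" if uv: "u \<in> I" "v \<in> I" for u v
    proof -
      obtain i t j s where u: "u = (i, t)" "t \<ge> 0" "v = (j, s)" "s \<ge> 0" using uv by (auto simp: I_def)
      \<comment> \<open>Subadditivity comes from directedness: the later cut and the sum of the two
        shifts serve both terms.\<close>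
      let ?k = "max i j"
      have "p (x + y) \<le> norm (d ?k * ((t + s) *\<^sub>R 1 + (x + y)) * d ?k) - (t + s)"
        using up[of "(?k, t + s)" "x + y"] u by (simp add: I_def g_def)
      also have "d ?k * ((t + s) *\<^sub>R 1 + (x + y)) * d ?k
          = d ?k * (t *\<^sub>R 1 + x) * d ?k + d ?k * (s *\<^sub>R 1 + y) * d ?k" by (simp add: algebra_simps)
      also have "norm \<dots> \<le> norm (d i * (t *\<^sub>R 1 + x) * d i) + norm (d j * (s *\<^sub>R 1 + y) * d j)"
        by (intro order_trans[OF norm_triangle_ineq] add_mono d(3)) auto
      finally show ?thesis by (simp add: g_def u)
    qed
    have "p (x + y) - g x u \<le> p y" if "u \<in> I" for u
      unfolding p_def[of y] by (rule cINF_greatest[OF I0]) (use *[OF that] in \<open>simp add: algebra_simps\<close>)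
    then have "p (x + y) - p y \<le> g x u" if "u \<in> I" for u using that by (simp add: algebra_simps)
    then have "p (x + y) - p y \<le> p x" unfolding p_def[of x] by (intro cINF_greatest I0)
    then show "p (x + y) \<le> p x + p y" by simp
  next
    fix c :: real and x assume c: "0 < c"
    have "p (c *\<^sub>R x) / c \<le> g x u" if uI: "u \<in> I" for u
    proof -
      obtain i t where u: "u = (i, t)" "t \<ge> 0" using uI by (auto simp: I_def)
      have "p (c *\<^sub>R x) \<le> norm (d i * ((c * t) *\<^sub>R 1 + c *\<^sub>R x) * d i) - c * t"
        using up[of "(i, c * t)" "c *\<^sub>R x"] u c by (simp add: I_def g_def)
      also have "d i * ((c * t) *\<^sub>R 1 + c *\<^sub>R x) * d i = c *\<^sub>R (d i * (t *\<^sub>R 1 + x) * d i)"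
        by (simp add: algebra_simps)
      also have "norm \<dots> = c * norm (d i * (t *\<^sub>R 1 + x) * d i)" by (simp only: norm_scaleR abs_of_pos[OF c])
      finally have "p (c *\<^sub>R x) \<le> c * g x u" by (simp add: g_def u right_diff_distrib)
      then show ?thesis using c by (simp add: pos_divide_le_eq mult.commute)
    qed
    then have "p (c *\<^sub>R x) / c \<le> p x" unfolding p_def[of x] by (intro cINF_greatest I0)
    then show "p (c *\<^sub>R x) \<le> c * p x" using c by (simp add: field_simps)
  qed
  have "r \<le> p m" if "(m, r) \<in> M" for m r
    unfolding p_def
  proof (rule cINF_greatest[OF I0])
    fix u assume "u \<in> I"
    then show "r \<le> g m u" using M(2)[OF that, of "snd u" "fst u"] by (auto simp: g_def I_def)
  qed
  then obtain f where f: "linear f" "\<And>x. f x \<le> p x" "\<And>m r. (m, r) \<in> M \<Longrightarrow> r \<le> f m"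
    using Hahn_Banach_cone[OF p M(1)] by blast
  have fle: "f x \<le> norm (d i * (t *\<^sub>R 1 + x) * d i) - t" if "t \<ge> 0" for x i t
    using order_trans[OF f(2) up[of "(i, t)" x]] that by (simp add: I_def g_def)
  have "cstate (\<lambda>x. Complex (f x) (- f (scaleC \<i> x)))"
  proof (rule cstate_of_linear[OF f(1)])
    fix x and t :: real assume "t \<ge> 0"
    from fle[OF this, of x 0] show "f x \<le> norm (t *\<^sub>R 1 + x) - t"
      using dxd[of 0 "t *\<^sub>R 1 + x"] by linarith
  qed
  then show ?thesis using that[of "\<lambda>x. Complex (f x) (- f (scaleC \<i> x))"] f(3) fle by simp
qed

text \<open>The length of the vector of \<open>x\<close> in the GNS space of \<phi>; neither
  quotient nor completion is formed.\<close>

definition seminorm :: "('a::cstar_algebra \<Rightarrow> complex) \<Rightarrow> 'a \<Rightarrow> real" where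
  "seminorm \<phi> x = sqrt (Re (\<phi> (adj x * x)))"

context
  fixes \<phi> :: "'a::cstar_algebra \<Rightarrow> complex"
  assumes \<phi>: "cstate \<phi>"
begin

lemma cstate_add: "\<phi> (x + y) = \<phi> x + \<phi> y"
  and cstate_scaleC: "\<phi> (scaleC c x) = c * \<phi> x"
  and cstate_adj: "\<phi> (adj x) = cnj (\<phi> x)"
  and cstate_pos: "0 \<le> Re (\<phi> (adj x * x))"
  and cstate_Re_le: "Re (\<phi> x) \<le> norm x"
  using \<phi> by (auto simp: cstate_def)

lemma cstate_0: "\<phi> 0 = 0"
  using cstate_scaleC[of 0 0] by simp

lemma cstate_minus: "\<phi> (- x) = - \<phi> x"
  using cstate_scaleC[of "- 1" x] by (simp add: scaleC_minus1)

lemma cstate_diff: "\<phi> (x - y) = \<phi> x - \<phi> y"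
  using cstate_add[of x "- y"] by (simp add: cstate_minus)

lemma cstate_scaleR: "\<phi> (r *\<^sub>R x) = of_real r * \<phi> x"
  by (simp add: scaleR_scaleC cstate_scaleC)

lemma seminorm_nonneg: "0 \<le> seminorm \<phi> x"
  by (simp add: seminorm_def cstate_pos)

lemma seminorm_square: "seminorm \<phi> x ^ 2 = Re (\<phi> (adj x * x))"
  by (simp add: seminorm_def cstate_pos)

lemma cstate_selfadj_real: "adj x = x \<Longrightarrow> \<phi> x = of_real (Re (\<phi> x))"
  using cstate_adj[of x] by (simp add: complex_eq_iff)

lemma cstate_adj_mult_self: "\<phi> (adj x * x) = of_real (seminorm \<phi> x ^ 2)"
  using cstate_selfadj_real[of "adj x * x"] by (simp add: adj_mult adj_adj seminorm_square)

lemma cstate_swap: "\<phi> (adj x * y) = cnj (\<phi> (adj y * x))"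
  using cstate_adj[of "adj y * x"] by (simp add: adj_mult adj_adj)

lemma seminorm_diff_scaleC_square:
  "seminorm \<phi> (x - scaleC c y) ^ 2
     = seminorm \<phi> x ^ 2 - 2 * Re (cnj c * \<phi> (adj y * x)) + cmod c ^ 2 * seminorm \<phi> y ^ 2"
proof -
  have "adj (x - scaleC c y) * (x - scaleC c y)
      = adj x * x - scaleC c (adj x * y) - scaleC (cnj c) (adj y * x) + scaleC (cnj c * c) (adj y * y)"
    by (simp add: adj_diff adj_scaleC algebra_simps mult_scaleC_left mult_scaleC_right scaleC_scaleC scaleC_diff_right mult.commute)
  then have "\<phi> (adj (x - scaleC c y) * (x - scaleC c y))
      = \<phi> (adj x * x) - c * cnj (\<phi> (adj y * x)) - cnj c * \<phi> (adj y * x) + cnj c * c * \<phi> (adj y * y)"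
    by (simp add: cstate_add cstate_diff cstate_scaleC cstate_swap[of x y])
  also have "cnj c * c = of_real (cmod c ^ 2)" by (metis complex_norm_square mult.commute)
  finally show ?thesis by (simp add: seminorm_square)
qed

lemma cstate_Cauchy_Schwarz: "cmod (\<phi> (adj y * x)) \<le> seminorm \<phi> x * seminorm \<phi> y"
proof -
  define z where "z = \<phi> (adj y * x)"
  define a where "a = seminorm \<phi> x ^ 2"
  define b where "b = seminorm \<phi> y ^ 2"
  have key: "0 \<le> a - 2 * s * cmod z ^ 2 + s\<^sup>2 * cmod z ^ 2 * b" for s :: real
  proof -
    have "0 \<le> seminorm \<phi> (x - scaleC (of_real s * z) y) ^ 2" by simp
    also have "\<dots> = a - 2 * Re (cnj (of_real s * z) * z) + cmod (of_real s * z) ^ 2 * b"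
      by (simp only: seminorm_diff_scaleC_square a_def b_def z_def)
    also have "cnj (of_real s * z) * z = of_real (s * cmod z ^ 2)"
      using complex_norm_square[of z] by (simp add: mult_ac)
    finally show ?thesis by (simp add: norm_mult power_mult_distrib)
  qed
  have "cmod z ^ 2 \<le> a * b"
  proof (cases "b = 0")
    case False
    then have b: "b > 0" by (simp add: b_def)
    have "(1 / b)\<^sup>2 * cmod z ^ 2 * b = cmod z ^ 2 / b" using b by (simp add: power2_eq_square)
    then have "0 \<le> a - cmod z ^ 2 / b" using key[of "1 / b"] by simp
    then show ?thesis using b by (simp add: field_simps)
  next
    case True
    have "z = 0"
    proof (rule ccontr)
      assume "z \<noteq> 0"
      then have "2 * ((a + 1) / (2 * cmod z ^ 2)) * cmod z ^ 2 = a + 1" by simp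
      then show False using key[of "(a + 1) / (2 * cmod z ^ 2)"] True by simp
    qed
    then show ?thesis by (simp add: True)
  qed
  then have "cmod z ^ 2 \<le> (seminorm \<phi> x * seminorm \<phi> y) ^ 2" by (simp add: a_def b_def power_mult_distrib)
  then have "cmod z \<le> seminorm \<phi> x * seminorm \<phi> y"
    by (rule power2_le_imp_le) (intro mult_nonneg_nonneg seminorm_nonneg)
  then show ?thesis by (simp add: z_def)
qed

lemma seminorm_scaleC: "seminorm \<phi> (scaleC c x) = cmod c * seminorm \<phi> x"
proof -
  have "seminorm \<phi> (scaleC c x) ^ 2 = (cmod c * seminorm \<phi> x) ^ 2"
    using seminorm_diff_scaleC_square[of 0 "- c" x]
    by (simp add: scaleC_minus_left power_mult_distrib seminorm_def cstate_0)
  then show ?thesis by (rule power2_eq_imp_eq) (auto intro: seminorm_nonneg mult_nonneg_nonneg)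
qed

lemma seminorm_triangle: "seminorm \<phi> (x + y) \<le> seminorm \<phi> x + seminorm \<phi> y"
proof -
  have "seminorm \<phi> (x + y) ^ 2 = seminorm \<phi> x ^ 2 + 2 * Re (\<phi> (adj y * x)) + seminorm \<phi> y ^ 2"
    using seminorm_diff_scaleC_square[of x "- 1" y] by (simp add: scaleC_minus1)
  also have "Re (\<phi> (adj y * x)) \<le> seminorm \<phi> x * seminorm \<phi> y"
    using complex_Re_le_cmod cstate_Cauchy_Schwarz order_trans by blast
  finally have "seminorm \<phi> (x + y) ^ 2 \<le> (seminorm \<phi> x + seminorm \<phi> y) ^ 2" by (simp add: power2_sum)
  then show ?thesis by (rule power2_le_imp_le) (auto intro: add_nonneg_nonneg seminorm_nonneg)
qed

lemma seminorm_minus: "seminorm \<phi> (- x) = seminorm \<phi> x"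
  using seminorm_scaleC[of "- 1" x] by (simp add: scaleC_minus1)

lemma seminorm_triangle_diff: "seminorm \<phi> (x - y) \<le> seminorm \<phi> x + seminorm \<phi> y"
  using seminorm_triangle[of x "- y"] by (simp add: seminorm_minus)

lemma seminorm_mult_le: "seminorm \<phi> (b * x) \<le> norm b * seminorm \<phi> x"
proof -
  obtain s where s: "cpos s" "s * s = (norm b ^ 2) *\<^sub>R 1 - adj b * b"
    using cpos_sqrt[OF cpos_norm_square_minus, of b] by blast
  have "adj (s * x) * (s * x) = adj x * (s * s) * x" by (simp add: adj_mult cpos_adj[OF s(1)] mult.assoc)
  also have "\<dots> = (norm b ^ 2) *\<^sub>R (adj x * x) - adj (b * x) * (b * x)"
    unfolding s(2) by (simp add: adj_mult left_diff_distrib right_diff_distrib mult.assoc)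
  finally have "0 \<le> norm b ^ 2 * seminorm \<phi> x ^ 2 - seminorm \<phi> (b * x) ^ 2"
    using cstate_pos[of "s * x"] by (simp add: seminorm_square cstate_diff cstate_scaleR)
  then have "seminorm \<phi> (b * x) ^ 2 \<le> (norm b * seminorm \<phi> x) ^ 2" by (simp add: power_mult_distrib)
  then show ?thesis by (rule power2_le_imp_le) (auto intro: mult_nonneg_nonneg seminorm_nonneg)
qed

lemma seminorm_le_norm: "seminorm \<phi> x \<le> norm x"
proof -
  have "seminorm \<phi> x ^ 2 \<le> norm x ^ 2" using cstate_Re_le[of "adj x * x"] by (simp add: seminorm_square cstar_identity)
  then show ?thesis by (rule power2_le_imp_le) simp
qed

lemma cstate_norm_le: "cmod (\<phi> x) \<le> norm x"
proof -
  have "cmod (\<phi> (adj 1 * x)) \<le> seminorm \<phi> x * seminorm \<phi> 1" by (rule cstate_Cauchy_Schwarz)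
  also have "\<dots> \<le> norm x * norm (1::'a)" by (intro mult_mono seminorm_le_norm seminorm_nonneg) simp
  finally show ?thesis by simp
qed

end

lemma tendsto_0_if_le:
  fixes f g :: "nat \<Rightarrow> real"
  assumes "\<And>n. 0 \<le> f n" "\<And>n. n > N \<Longrightarrow> f n \<le> g n" "g \<longlonglongrightarrow> 0"
  shows "f \<longlonglongrightarrow> 0"
proof (rule tendsto_sandwich[OF _ _ tendsto_const assms(3)])
  show "\<forall>\<^sub>F n in sequentially. 0 \<le> f n" using assms(1) by (rule always_eventually[OF allI])
  show "\<forall>\<^sub>F n in sequentially. f n \<le> g n" by (rule eventually_sequentiallyI[of "Suc N"]) (rule assms(2), simp)
qed

subsection \<open>Closed linear spans\<close>

lemma cspan_superset: "V \<subseteq> cspan V"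
  by (auto simp: cspan_def)

lemma cspan_minimal: "csubspace T \<Longrightarrow> V \<subseteq> T \<Longrightarrow> cspan V \<subseteq> T"
  by (auto simp: cspan_def)

lemma csubspace_cspan: "csubspace (cspan V)"
  unfolding cspan_def csubspace_def by auto

lemma cspan_mono: "V \<subseteq> W \<Longrightarrow> cspan V \<subseteq> cspan W"
  by (auto simp: cspan_def)

lemma closure_cspan_minimal: "csubspace T \<Longrightarrow> closed T \<Longrightarrow> V \<subseteq> T \<Longrightarrow> closure (cspan V) \<subseteq> T"
  by (intro closure_minimal cspan_minimal)

lemma csubspace_closure:
  fixes S :: "'a::cstar_algebra set"
  assumes "csubspace S"
  shows "csubspace (closure S)"
  unfolding csubspace_def
proof (intro conjI ballI allI)
  show "0 \<in> closure S" using csubspaceD(1)[OF assms] closure_subset by blast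
next
  fix x y assume "x \<in> closure S" "y \<in> closure S"
  then obtain f g where "\<And>n. f n \<in> S" "f \<longlonglongrightarrow> x" "\<And>n. g n \<in> S" "g \<longlonglongrightarrow> y"
    by (auto simp: closure_sequential)
  then show "x + y \<in> closure S"
    unfolding closure_sequential by (intro exI[of _ "\<lambda>n. f n + g n"]) (auto intro!: tendsto_intros csubspaceD[OF assms])
next
  fix c x assume "x \<in> closure S"
  then obtain f where "\<And>n. f n \<in> S" "f \<longlonglongrightarrow> x" by (auto simp: closure_sequential)
  then show "scaleC c x \<in> closure S"
    unfolding closure_sequential by (intro exI[of _ "\<lambda>n. scaleC c (f n)"]) (auto intro!: tendsto_intros csubspaceD[OF assms])
qed

lemma closure_cspan_mult:
  fixes V :: "'a::cstar_algebra set"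
  assumes V: "\<And>v w. v \<in> V \<Longrightarrow> w \<in> V \<Longrightarrow> v * w \<in> V"
    and x: "x \<in> closure (cspan V)" and y: "y \<in> closure (cspan V)"
  shows "x * y \<in> closure (cspan V)"
proof -
  let ?W = "closure (cspan V)"
  note W = csubspaceD[OF csubspace_closure[OF csubspace_cspan[of V]]]
  have VW: "V \<subseteq> ?W" using cspan_superset closure_subset by (metis order_trans)
  have "?W \<subseteq> (\<lambda>z. v * z) -` ?W" if v: "v \<in> V" for v
  proof (rule closure_cspan_minimal)
    show "csubspace ((\<lambda>z. v * z) -` ?W)" using W by (auto simp: csubspace_def distrib_left mult_scaleC_right)
    show "closed ((\<lambda>z. v * z) -` ?W)" by (intro closed_vimage closed_closure continuous_intros)
    show "V \<subseteq> (\<lambda>z. v * z) -` ?W" using V[OF v] VW by auto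
  qed
  then have *: "v * y \<in> ?W" if "v \<in> V" for v using that y by blast
  have "?W \<subseteq> (\<lambda>z. z * y) -` ?W"
  proof (rule closure_cspan_minimal)
    show "csubspace ((\<lambda>z. z * y) -` ?W)" using W by (auto simp: csubspace_def distrib_right mult_scaleC_left)
    show "closed ((\<lambda>z. z * y) -` ?W)" by (intro closed_vimage closed_closure continuous_intros)
    show "V \<subseteq> (\<lambda>z. z * y) -` ?W" using * by auto
  qed
  then show ?thesis using x by blast
qed

lemma closure_cspan_adj:
  fixes V :: "'a::cstar_algebra set"
  assumes V: "\<And>v. v \<in> V \<Longrightarrow> adj v \<in> V" and x: "x \<in> closure (cspan V)"
  shows "adj x \<in> closure (cspan V)"
proof -
  let ?W = "closure (cspan V)"
  note W = csubspaceD[OF csubspace_closure[OF csubspace_cspan[of V]]]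
  have VW: "V \<subseteq> ?W" using cspan_superset closure_subset by (metis order_trans)
  have "?W \<subseteq> adj -` ?W"
  proof (rule closure_cspan_minimal)
    show "csubspace (adj -` ?W)" using W by (auto simp: csubspace_def adj_add adj_scaleC)
    show "closed (adj -` ?W)" by (intro closed_vimage closed_closure continuous_intros)
    show "V \<subseteq> adj -` ?W" using V VW by auto
  qed
  then show ?thesis using x by blast
qed

lemma cspan_finite_support:
  assumes "z \<in> cspan V"
  obtains F where "finite F" "F \<subseteq> V" "z \<in> cspan F"
proof -
  let ?U = "{z. \<exists>F. finite F \<and> F \<subseteq> V \<and> z \<in> cspan F}"
  have "csubspace ?U" unfolding csubspace_def
  proof (intro conjI ballI allI)
    show "0 \<in> ?U" using csubspaceD(1)[OF csubspace_cspan] by blast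
  next
    fix x y assume "x \<in> ?U" "y \<in> ?U"
    then obtain F G where FG: "finite F" "F \<subseteq> V" "x \<in> cspan F" "finite G" "G \<subseteq> V" "y \<in> cspan G" by blast
    then have "x \<in> cspan (F \<union> G)" "y \<in> cspan (F \<union> G)" using cspan_mono[of F "F \<union> G"] cspan_mono[of G "F \<union> G"] by auto
    then have "x + y \<in> cspan (F \<union> G)" by (rule csubspaceD(2)[OF csubspace_cspan])
    then show "x + y \<in> ?U" using FG by (intro CollectI exI[of _ "F \<union> G"]) auto
  next
    fix c x assume "x \<in> ?U"
    then show "scaleC c x \<in> ?U" using csubspaceD(3)[OF csubspace_cspan] by blast
  qed
  moreover have "V \<subseteq> ?U"
  proof
    fix v assume "v \<in> V"
    then show "v \<in> ?U" using cspan_superset[of "{v}"] by (intro CollectI exI[of _ "{v}"]) auto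
  qed
  ultimately have "cspan V \<subseteq> ?U" by (rule cspan_minimal)
  then show ?thesis using assms that by blast
qed

subsection \<open>Generic states\<close>

text \<open>Expanding (d - 1)^2 shows that the vector of d - 1 has length 0, and the Cauchy-Schwarz
  inequality then lets \<phi> absorb \<open>d\<close> on either side.\<close>

lemma cstate_absorb:
  assumes \<phi>: "cstate \<phi>" and d: "adj d = d" "norm d \<le> 1" "\<phi> d = 1"
  shows "\<phi> (d * x) = \<phi> x" "\<phi> (x * d) = \<phi> x" "\<phi> 1 = 1"
    "seminorm \<phi> (d - 1) = 0" "seminorm \<phi> (x * d) = seminorm \<phi> x"
proof -
  have "adj (d - 1) * (d - 1) = d * d - 2 *\<^sub>R d + 1" by (simp add: adj_diff d algebra_simps scaleR_2)
  then have "Re (\<phi> (adj (d - 1) * (d - 1))) = Re (\<phi> (d * d)) - 2 + Re (\<phi> 1)"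
    by (simp add: cstate_add[OF \<phi>] cstate_diff[OF \<phi>] cstate_scaleR[OF \<phi>] d)
  moreover have "Re (\<phi> (d * d)) \<le> 1" using cstate_Re_le[OF \<phi>, of "d * d"] norm_mult_le[OF d(2) d(2)] by simp
  moreover have "Re (\<phi> 1) \<le> 1" using cstate_Re_le[OF \<phi>, of 1] by simp
  ultimately have "seminorm \<phi> (d - 1) ^ 2 \<le> 0" by (simp add: seminorm_square[OF \<phi>])
  then show s: "seminorm \<phi> (d - 1) = 0" by simp
  have left: "\<phi> (d * y) = \<phi> y" for y
  proof -
    have "cmod (\<phi> (adj (d - 1) * y)) \<le> 0" using cstate_Cauchy_Schwarz[OF \<phi>, of "d - 1" y] s by simp
    then show ?thesis by (simp add: adj_diff d left_diff_distrib cstate_diff[OF \<phi>])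
  qed
  have right: "\<phi> (y * d) = \<phi> y" for y
    using left[of "adj y"] cstate_adj[OF \<phi>, of "y * d"] cstate_adj[OF \<phi>, of y] by (simp add: adj_mult d)
  show "\<phi> (d * x) = \<phi> x" "\<phi> (x * d) = \<phi> x" by (rule left right)+
  show "\<phi> 1 = 1" using left[of 1] d by simp
  show "seminorm \<phi> (x * d) = seminorm \<phi> x"
    unfolding seminorm_def adj_mult d mult.assoc left using right[of "adj x * x"] by (simp add: mult.assoc)
qed

text \<open>The sequence \<open>b\<close> shrinks to a point at which every element of \<open>V\<close> looks like a scalar. Only a
  countable \<open>V\<close> can be treated at once; this is why separable pieces of the algebra are used.\<close>

locale generic_state = pseudo_cartan_inclusion +
  fixes V :: "'a set" and b :: "nat \<Rightarrow> 'a" and \<omega> :: "'a \<Rightarrow> complex"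
  assumes V_normalizers: "V \<subseteq> normalizers D"
    and V_countable: "countable V"
    and V_1: "1 \<in> V"
    and V_mult: "v \<in> V \<Longrightarrow> w \<in> V \<Longrightarrow> v * w \<in> V"
    and V_adj: "v \<in> V \<Longrightarrow> adj v \<in> V"
    and b_live: "live D (b i)"
    and b_below: "i < j \<Longrightarrow> b i * b j = b j"
    and \<omega>: "cstate \<omega>"
    and \<omega>_b: "\<omega> (b i) = 1"
    and V_excised: "v \<in> V \<Longrightarrow> (\<lambda>i. norm (b i * v * b i - scaleC (\<omega> v) (b i * b i))) \<longlonglongrightarrow> 0"

context pseudo_cartan_inclusion
begin

text \<open>At each precision 1 / Suc n, an element of \<open>S\<close> is approximated by a
  combination of finitely many normalizers. The finite products of all these and their adjoints are
  still countably many normalizers.\<close>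

lemma countable_normalizer_semigroup:
  assumes S: "countable S"
  obtains V where "countable V" "V \<subseteq> normalizers D" "1 \<in> V" "S \<subseteq> closure (cspan V)"
    "\<And>v w. v \<in> V \<Longrightarrow> w \<in> V \<Longrightarrow> v * w \<in> V" "\<And>v. v \<in> V \<Longrightarrow> adj v \<in> V"
proof -
  have "\<exists>F. finite F \<and> F \<subseteq> normalizers D \<and> (\<exists>z\<in>cspan F. dist z s < 1 / real (Suc n))" for s n
  proof -
    have "s \<in> closure (cspan (normalizers D))"
      using pseudo_cartan by (simp add: pseudo_cartan_def regular_inclusion_def)
    moreover have "1 / real (Suc n) > 0" by simp
    ultimately obtain z where z: "z \<in> cspan (normalizers D)" "dist z s < 1 / real (Suc n)"
      unfolding closure_approachable by blast
    obtain F where "finite F" "F \<subseteq> normalizers D" "z \<in> cspan F" by (rule cspan_finite_support[OF z(1)])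
    then show ?thesis using z(2) by (intro exI[of _ F]) auto
  qed
  then obtain F where F: "\<And>s n. finite (F s n)" "\<And>s n. F s n \<subseteq> normalizers D"
    "\<And>s n. \<exists>z\<in>cspan (F s n). dist z s < 1 / real (Suc n)" by metis
  define V0 where "V0 = (\<Union>s\<in>S. \<Union>n. F s n)"
  have cV0: "countable V0" unfolding V0_def by (intro countable_UN[OF S] countable_UN[OF countableI_type] countable_finite[OF F(1)])
  have V0N: "V0 \<subseteq> normalizers D" unfolding V0_def using F(2) by blast
  define G where "G = V0 \<union> adj ` V0"
  have GN: "G \<subseteq> normalizers D" unfolding G_def using V0N normalizers_adj by auto
  have Gadj: "g \<in> G \<Longrightarrow> adj g \<in> G" for g by (auto simp: G_def adj_adj)
  define V where "V = prod_list ` lists G"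
  show ?thesis
  proof (rule that)
    show "countable V" unfolding V_def G_def by (intro countable_image countable_lists countable_Un cV0)
    have "prod_list ws \<in> normalizers D" if "ws \<in> lists G" for ws
      using that by (induction ws) (use GN normalizers_1 normalizers_mult in auto)
    then show "V \<subseteq> normalizers D" by (auto simp: V_def)
    show "1 \<in> V" unfolding V_def by (rule image_eqI[of _ _ "[]"]) auto
    show "v * w \<in> V" if vw: "v \<in> V" "w \<in> V" for v w
    proof -
      obtain vs ws where "vs \<in> lists G" "v = prod_list vs" "ws \<in> lists G" "w = prod_list ws"
        using vw unfolding V_def by blast
      then show ?thesis unfolding V_def by (intro image_eqI[of _ _ "vs @ ws"]) auto
    qed
    show "adj v \<in> V" if v: "v \<in> V" for v
    proof -
      obtain vs where vs: "vs \<in> lists G" "v = prod_list vs" using v unfolding V_def by blast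
      have "adj (prod_list vs) = prod_list (rev (map adj vs))"
        by (induction vs) (simp_all add: adj_mult)
      moreover have "rev (map adj vs) \<in> lists G" using vs(1) Gadj by (auto simp: in_lists_conv_set)
      ultimately show ?thesis unfolding V_def vs(2) by blast
    qed
    show "S \<subseteq> closure (cspan V)"
    proof
      fix s assume s: "s \<in> S"
      show "s \<in> closure (cspan V)" unfolding closure_approachable
      proof (intro allI impI)
        fix e :: real assume "e > 0"
        then obtain n where n: "1 / real (Suc n) < e" using nat_approx_posE by blast
        obtain z where z: "z \<in> cspan (F s n)" "dist z s < 1 / real (Suc n)" using F(3) by blast
        have "F s n \<subseteq> V"
        proof
          fix v assume "v \<in> F s n"
          then have "v \<in> G" using s by (auto simp: G_def V0_def)
          then show "v \<in> V" unfolding V_def by (intro image_eqI[of _ _ "[v]"]) auto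
        qed
        then show "\<exists>y\<in>cspan V. dist y s < e" using z n cspan_mono by (meson less_trans subsetD)
      qed
    qed
  qed
qed

lemma live_norm_square: "live D d \<Longrightarrow> norm (d * d) = 1"
  using norm_square_selfadj[OF live_adj] live_norm by fastforce

lemma live_norm_conj_le:
  assumes "live D d'" "d * d' = d'" "live D d"
  shows "norm (d' * x * d') \<le> norm (d * x * d)"
proof -
  have c: "d' * d = d'" using assms(2) D_comm[OF live_in_D[OF assms(1)] live_in_D[OF assms(3)]] by simp
  have "d' * x * d' = d' * (d * x * d) * d'"
    by (simp only: mult.assoc assms(2)) (simp only: mult.assoc[symmetric] c)
  also have "norm \<dots> \<le> 1 * norm (d * x * d) * 1" by (intro norm_mult_le) (simp_all add: live_norm[OF assms(1)])
  finally show ?thesis by simp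
qed

lemma generic_state_exists:
  assumes S: "countable S" and d0: "live D d0"
  obtains V b \<omega> where "generic_state D V b \<omega>" "S \<subseteq> closure (cspan V)" "\<And>i. d0 * b i = b i"
proof -
  obtain V where V: "countable V" "V \<subseteq> normalizers D" "1 \<in> V" "S \<subseteq> closure (cspan V)"
    "\<And>v w. v \<in> V \<Longrightarrow> w \<in> V \<Longrightarrow> v * w \<in> V" "\<And>v. v \<in> V \<Longrightarrow> adj v \<in> V"
    using countable_normalizer_semigroup[OF S] by blast
  \<comment> \<open>Every element of \<open>V\<close> recurs infinitely often, so it is treated with
    arbitrarily small tolerance 1 / Suc i.\<close>
  define n where "n i = from_nat_into V (fst (prod_decode i))" for i
  have V0: "V \<noteq> {}" using V(3) by auto
  have nN: "n i \<in> normalizers D" for i using from_nat_into[OF V0] V(2) by (auto simp: n_def)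
  define P where "P i x \<longleftrightarrow> live D x \<and> d0 * x = x \<and>
    (\<exists>c. norm (x * n i * x - scaleC c (x * x)) \<le> 1 / real (Suc i))" for i x
  have "\<exists>b. \<forall>i. P i (b i) \<and> b i * b (Suc i) = b (Suc i)"
  proof (rule dependent_nat_choice)
    obtain d c where "live D d" "d0 * d = d" "norm (d * n 0 * d - scaleC c (d * d)) \<le> 1"
      by (rule localize_normalizer[OF nN[of 0] d0, of 1], simp, rule that)
    then show "\<exists>x. P 0 x" by (auto simp: P_def)
  next
    fix x i assume x: "P i x"
    then have lx: "live D x" and d0x: "d0 * x = x" by (simp_all add: P_def)
    obtain d c where d: "live D d" "x * d = d" "norm (d * n (Suc i) * d - scaleC c (d * d)) \<le> 1 / real (Suc (Suc i))"
      by (rule localize_normalizer[OF nN[of "Suc i"] lx, of "1 / real (Suc (Suc i))"], simp, rule that)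
    have "d0 * d = d" by (rule below_trans[OF d0x d(2)])
    then show "\<exists>y. P (Suc i) y \<and> x * y = y" using d by (auto simp: P_def)
  qed
  then obtain b where b: "\<And>i. P i (b i)" "\<And>i. b i * b (Suc i) = b (Suc i)" by blast
  have live: "live D (b i)" for i using b(1) by (simp add: P_def)
  have below: "b i * b j = b j" if "i < j" for i j
    using that by (induction j) (use b(2) below_trans less_antisym in blast)+
  have conj: "norm (b j * x * b j) \<le> norm (b i * x * b i)" if "i \<le> j" for i j x
  proof (cases "i = j")
    case False
    then show ?thesis using that live_norm_conj_le[OF live below live] by simp
  qed simp
  obtain \<omega> where \<omega>: "cstate \<omega>"
    "\<And>x i t. t \<ge> 0 \<Longrightarrow> Re (\<omega> x) \<le> norm (b i * (t *\<^sub>R 1 + x) * b i) - t"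
  proof (rule cstate_exists[of b "{0}"])
    show "norm (b i) \<le> 1" "norm (b i * b i) = 1" for i using live_norm[OF live] live_norm_square[OF live] by simp_all
    show "real_cone {0 :: 'a \<times> real}" by (auto simp: real_cone_def)
    show "r + t \<le> norm (b i * (t *\<^sub>R 1 + m) * b i)" if "(m, r) \<in> {0}" "t \<ge> 0" for m r i t
      using that live_norm_square[OF live] by (simp add: zero_prod_def)
  qed (use conj in blast)+
  have \<omega>b: "\<omega> (b i) = 1" for i
  proof -
    \<comment> \<open>\<open>b i\<close> acts as 1 on \<open>b (Suc i)\<close>, so for t = 1 the
      norm in the bound vanishes and Re \<omega> (b i) >= 1 results.\<close>
    have "b (Suc i) * (1 *\<^sub>R 1 + - b i) * b (Suc i) = b (Suc i) * (b (Suc i) - b i * b (Suc i))" by (simp add: algebra_simps)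
    then have "Re (\<omega> (- b i)) \<le> - 1" using \<omega>(2)[of 1 "- b i" "Suc i"] b(2) by simp
    then have "Re (\<omega> (b i)) \<ge> 1" by (simp add: cstate_minus[OF \<omega>(1)])
    moreover have "Re (\<omega> (b i)) \<le> 1" using cstate_Re_le[OF \<omega>(1), of "b i"] live_norm[OF live] by simp
    ultimately show ?thesis using cstate_selfadj_real[OF \<omega>(1) live_adj[OF live]] by (metis antisym of_real_1)
  qed
  note absorb = cstate_absorb[OF \<omega>(1) live_adj[OF live] eq_refl[OF live_norm[OF live]] \<omega>b]
  have exc: "(\<lambda>i. norm (b i * v * b i - scaleC (\<omega> v) (b i * b i))) \<longlonglongrightarrow> 0" if v: "v \<in> V" for v
  proof (rule LIMSEQ_I)
    fix \<epsilon> :: real assume "0 < \<epsilon>"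
    then obtain N where N: "1 / real (Suc N) < \<epsilon> / 2" using nat_approx_posE[of "\<epsilon> / 2"] by auto
    obtain k where k: "from_nat_into V k = v" using from_nat_into_surj[OF V(1) v] by blast
    define i where "i = prod_encode (k, N)"
    have iN: "N \<le> i" unfolding i_def by (rule le_prod_encode_2)
    have ni: "n i = v" by (simp add: n_def i_def k)
    obtain c where "norm (b i * v * b i - scaleC c (b i * b i)) \<le> 1 / real (Suc i)"
      using b(1)[of i] by (auto simp: P_def ni)
    also have "1 / real (Suc i) \<le> 1 / real (Suc N)" using iN by (simp add: frac_le)
    finally have c: "norm (b i * v * b i - scaleC c (b i * b i)) < \<epsilon> / 2" using N by simp
    \<comment> \<open>The scalar c depends on the stage; applying \<omega> shows that it is close to
      \<omega> v.\<close>
    have "\<omega> (b i * v * b i - scaleC c (b i * b i)) = \<omega> v - c"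
      by (simp add: cstate_diff[OF \<omega>(1)] cstate_scaleC[OF \<omega>(1)] absorb \<omega>b)
    then have "cmod (\<omega> v - c) < \<epsilon> / 2" using cstate_norm_le[OF \<omega>(1)] c by (metis le_less_trans)
    moreover have "norm (b i * v * b i - scaleC (\<omega> v) (b i * b i))
        \<le> norm (b i * v * b i - scaleC c (b i * b i)) + norm (scaleC (\<omega> v - c) (b i * b i))"
      using norm_triangle_ineq4[of "b i * v * b i - scaleC c (b i * b i)" "scaleC (\<omega> v - c) (b i * b i)"]
      by (simp add: scaleC_diff_left)
    ultimately have "norm (b i * (v - scaleC (\<omega> v) 1) * b i) < \<epsilon>"
      using c live_norm_square[OF live] by (simp add: norm_scaleC algebra_simps mult_scaleC_left mult_scaleC_right)
    \<comment> \<open>Compressions by later \<open>b j\<close> are smaller, so the estimate at the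
      single stage i passes to all later ones.\<close>
    then have "norm (b j * (v - scaleC (\<omega> v) 1) * b j) < \<epsilon>" if "i \<le> j" for j
      using conj[OF that] le_less_trans by blast
    then show "\<exists>no. \<forall>j\<ge>no. norm (norm (b j * v * b j - scaleC (\<omega> v) (b j * b j)) - 0) < \<epsilon>"
      by (intro exI[of _ i]) (simp add: algebra_simps mult_scaleC_left mult_scaleC_right)
  qed
  have "generic_state D V b \<omega>"
    by (unfold_locales) (use V live below \<omega>(1) \<omega>b exc in blast)+
  then show ?thesis using that V(4) b(1) by (auto simp: P_def)
qed

end

section \<open>Excision of the state on the closed span of V\<close>

context generic_state
begin

definition W :: "'a set" where
  "W = closure (cspan V)"

lemma W_subspace: "csubspace W"
  unfolding W_def by (intro csubspace_closure csubspace_cspan)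

lemma closed_W: "closed W"
  by (simp add: W_def)

lemma V_subset_W: "V \<subseteq> W"
  unfolding W_def using cspan_superset closure_subset by (metis order_trans)

lemma W_mult: "x \<in> W \<Longrightarrow> y \<in> W \<Longrightarrow> x * y \<in> W"
  unfolding W_def by (rule closure_cspan_mult[OF V_mult])

lemma W_adj: "x \<in> W \<Longrightarrow> adj x \<in> W"
  unfolding W_def by (rule closure_cspan_adj[OF V_adj])

lemma b_D: "b i \<in> D" and b_adj: "adj (b i) = b i" and b_norm: "norm (b i) = 1"
  using live_in_D live_adj live_norm b_live by blast+

lemmas \<omega>_absorb = cstate_absorb[OF \<omega> b_adj eq_refl[OF b_norm] \<omega>_b]

text \<open>That its norm tends to 0 means that the sequence \<open>b\<close> excises the state
  \<omega> at \<open>x\<close>.\<close>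

definition defect :: "nat \<Rightarrow> 'a \<Rightarrow> 'a" where
  "defect i x = b i * x * b i - scaleC (\<omega> x) (b i * b i)"

lemma norm_defect_le: "norm (defect i x) \<le> 2 * norm x"
proof -
  have "norm (b i * x * b i) \<le> 1 * norm x * 1" by (intro norm_mult_le) (simp_all add: b_norm)
  moreover have "norm (scaleC (\<omega> x) (b i * b i)) \<le> norm x * 1"
    unfolding norm_scaleC by (intro mult_mono cstate_norm_le \<omega>) (simp_all add: live_norm_square b_live)
  ultimately show ?thesis unfolding defect_def
    using norm_triangle_ineq4[of "b i * x * b i" "scaleC (\<omega> x) (b i * b i)"] by linarith
qed

lemma defect_linear: "defect i (x + y) = defect i x + defect i y" "defect i (scaleC c x) = scaleC c (defect i x)"
  "defect i (x - y) = defect i x - defect i y"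
  by (simp_all add: defect_def cstate_add[OF \<omega>] cstate_diff[OF \<omega>] cstate_scaleC[OF \<omega>] algebra_simps
      scaleC_add_left scaleC_diff_left scaleC_diff_right mult_scaleC_left mult_scaleC_right scaleC_scaleC)

lemma defect_tendsto_0:
  assumes "x \<in> W"
  shows "(\<lambda>i. norm (defect i x)) \<longlonglongrightarrow> 0"
proof -
  let ?T = "{x. (\<lambda>i. norm (defect i x)) \<longlonglongrightarrow> 0}"
  have "W \<subseteq> ?T" unfolding W_def
  proof (rule closure_cspan_minimal)
    show "V \<subseteq> ?T" using V_excised by (auto simp: defect_def)
    show "csubspace ?T" unfolding csubspace_def
    proof (intro conjI ballI allI CollectI)
      have "norm (defect i 0) \<le> 0" for i using norm_defect_le[of i 0] by simp
      then show "(\<lambda>i. norm (defect i 0)) \<longlonglongrightarrow> 0" by simp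
    next
      fix x y assume "x \<in> ?T" "y \<in> ?T"
      then have "(\<lambda>i. norm (defect i x) + norm (defect i y)) \<longlonglongrightarrow> 0" using tendsto_add[of _ 0 _ _ 0] by simp
      then show "(\<lambda>i. norm (defect i (x + y))) \<longlonglongrightarrow> 0"
        by (rule Lim_null_comparison[rotated]) (simp add: defect_linear norm_triangle_ineq)
    next
      fix c x assume "x \<in> ?T"
      then show "(\<lambda>i. norm (defect i (scaleC c x))) \<longlonglongrightarrow> 0"
        by (simp add: defect_linear norm_scaleC tendsto_mult_right_zero)
    qed
    show "closed ?T" unfolding closed_sequential_limits
    proof (intro allI impI, elim conjE)
      fix s x assume s: "\<forall>n. s n \<in> ?T" "s \<longlonglongrightarrow> x"
      show "x \<in> ?T"
      proof (intro CollectI LIMSEQ_I)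
        fix \<epsilon> :: real assume \<epsilon>: "0 < \<epsilon>"
        obtain n where n: "norm (s n - x) < \<epsilon> / 4" using LIMSEQ_D[OF s(2), of "\<epsilon> / 4"] \<epsilon> by auto
        have "(\<lambda>i. norm (defect i (s n))) \<longlonglongrightarrow> 0" using s(1) by blast
        then obtain no where no: "\<And>i. i \<ge> no \<Longrightarrow> norm (defect i (s n)) < \<epsilon> / 2"
          using LIMSEQ_D[of _ 0 "\<epsilon> / 2"] \<epsilon> by fastforce
        have "norm (defect i x) < \<epsilon>" if "i \<ge> no" for i
        proof -
          have "norm (defect i x) \<le> norm (defect i (s n)) + norm (defect i (s n - x))"
            using norm_triangle_ineq4[of "defect i (s n)" "defect i (s n - x)"] by (simp add: defect_linear)
          then show ?thesis using no[OF that] norm_defect_le[of i "s n - x"] n by linarith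
        qed
        then show "\<exists>no. \<forall>i\<ge>no. norm (norm (defect i x) - 0) < \<epsilon>" by auto
      qed
    qed
  qed
  then show ?thesis using assms by blast
qed

text \<open>\<omega> absorbs \<open>b i\<close>, so inserting it on the right changes no length and
  produces the defect. Hence, on vectors from \<open>W\<close>, the \<open>b i\<close> tend strongly
  to the projection onto the vector of 1.\<close>

lemma seminorm_b_minus_le:
  "seminorm \<omega> (b i * x - scaleC (\<omega> x) 1) \<le> norm (defect i x)"
proof -
  have "seminorm \<omega> (b i * x - scaleC (\<omega> x) 1) = seminorm \<omega> ((b i * x - scaleC (\<omega> x) 1) * b i)"
    by (simp only: \<omega>_absorb)
  also have "(b i * x - scaleC (\<omega> x) 1) * b i = defect i x + scaleC (\<omega> x) (b i * (b i - 1))"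
    by (simp add: defect_def algebra_simps mult_scaleC_left scaleC_diff_right)
  also have "seminorm \<omega> \<dots> \<le> seminorm \<omega> (defect i x) + cmod (\<omega> x) * seminorm \<omega> (b i * (b i - 1))"
    using seminorm_triangle[OF \<omega>] by (simp add: seminorm_scaleC[OF \<omega>, symmetric])
  also have "seminorm \<omega> (b i * (b i - 1)) = 0"
    using seminorm_mult_le[OF \<omega>, of "b i" "b i - 1"] seminorm_nonneg[OF \<omega>, of "b i * (b i - 1)"] \<omega>_absorb(4) by simp
  finally show ?thesis using seminorm_le_norm[OF \<omega>, of "defect i x"] by simp
qed

text \<open>Inside \<open>D\<close> the two-sided cut can be gathered on one side; the index shift
  provides \<open>b (Suc n) = b (Suc n) * b n * b n\<close>.\<close>

lemma norm_b_mult_D_tendsto: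
  assumes h: "h \<in> W" "h \<in> D"
  shows "(\<lambda>n. norm (b n * (h - scaleC (\<omega> h) 1))) \<longlonglongrightarrow> 0"
proof -
  have "norm (b (Suc n) * (h - scaleC (\<omega> h) 1)) \<le> norm (defect n h)" for n
  proof -
    let ?g = "h - scaleC (\<omega> h) 1"
    have gD: "?g \<in> D" using h D_closed by (intro D_closed) auto
    have bb: "b (Suc n) = b (Suc n) * b n * b n"
      using b_below[of n "Suc n"] D_comm[OF b_D b_D] by (metis lessI mult.assoc)
    have "b (Suc n) * ?g = b (Suc n) * (b n * (b n * ?g))" by (subst bb) (simp only: mult.assoc)
    also have "b n * ?g = ?g * b n" by (rule D_comm[OF b_D gD])
    also have "b (Suc n) * (b n * (?g * b n)) = b (Suc n) * defect n h"
      by (simp add: defect_def algebra_simps mult_scaleC_left mult_scaleC_right)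
    finally show ?thesis using norm_mult_ineq[of "b (Suc n)" "defect n h"] by (simp add: b_norm)
  qed
  then have "(\<lambda>n. norm (b (Suc n) * (h - scaleC (\<omega> h) 1))) \<longlonglongrightarrow> 0"
    by (intro Lim_null_comparison[OF _ defect_tendsto_0[OF h(1)]]) auto
  then show ?thesis by (rule LIMSEQ_imp_Suc)
qed

definition mass :: "'a \<Rightarrow> real" where
  "mass w = seminorm \<omega> w ^ 2"

lemma mass_eq: "\<omega> (adj w * w) = of_real (mass w)"
  unfolding mass_def by (rule cstate_adj_mult_self[OF \<omega>])

text \<open>Modelled on the rank one projection onto the line of \<open>w\<close>, with
  \<open>b n\<close> in place of the projection onto the vector of 1. Conjugation by a normalizer
  keeps it in \<open>D\<close>, hence within reach of \<open>j\<close>.\<close>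

definition bump :: "'a \<Rightarrow> nat \<Rightarrow> 'a" where
  "bump w n = (1 / mass w) *\<^sub>R (w * b n * adj w)"

lemma bump_D: "w \<in> V \<Longrightarrow> bump w n \<in> D"
  unfolding bump_def using V_normalizers by (intro D_closed normalizer_conj b_D) auto

lemma bump_adj: "adj (bump w n) = bump w n"
  by (simp add: bump_def adj_scaleR adj_mult adj_adj b_adj mult.assoc)

text \<open>In the GNS space, \<open>bump w n\<close> converges strongly to the projection onto the line of \<open>w\<close>.\<close>

lemma bump_tendsto:
  assumes w: "w \<in> V" "mass w \<noteq> 0" and z: "z \<in> W"
  shows "(\<lambda>n. seminorm \<omega> (bump w n * z - scaleC (\<omega> (adj w * z) / mass w) w)) \<longlonglongrightarrow> 0"
proof -
  let ?m = "adj w * z"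
  have m: "?m \<in> W" using w z V_subset_W W_mult W_adj by blast
  have s: "mass w > 0" using w(2) by (simp add: mass_def)
  have "seminorm \<omega> (bump w n * z - scaleC (\<omega> ?m / mass w) w) \<le> norm w / mass w * norm (defect n ?m)" for n
  proof -
    have "bump w n * z - scaleC (\<omega> ?m / mass w) w = scaleC (1 / mass w) (w * (b n * ?m - scaleC (\<omega> ?m) 1))"
      by (simp add: bump_def scaleR_scaleC mult_scaleC_left mult_scaleC_right right_diff_distrib scaleC_diff_right
          scaleC_scaleC mult.assoc)
    then have "seminorm \<omega> (bump w n * z - scaleC (\<omega> ?m / mass w) w)
        = 1 / mass w * seminorm \<omega> (w * (b n * ?m - scaleC (\<omega> ?m) 1))"
      using s by (simp add: seminorm_scaleC[OF \<omega>] norm_divide)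
    also have "\<dots> \<le> 1 / mass w * (norm w * norm (defect n ?m))"
      using s by (intro mult_left_mono order_trans[OF seminorm_mult_le[OF \<omega>]] seminorm_b_minus_le) auto
    finally show ?thesis by simp
  qed
  moreover have "(\<lambda>n. norm w / mass w * norm (defect n ?m)) \<longlonglongrightarrow> 0"
    using defect_tendsto_0[OF m] by (rule tendsto_mult_right_zero)
  ultimately show ?thesis
    by (intro tendsto_0_if_le[OF seminorm_nonneg[OF \<omega>], rotated])
qed

text \<open>Since \<open>adj w * w\<close> lies in \<open>D\<close>,
  \<open>norm_b_mult_D_tendsto\<close> applies. Norm convergence, as opposed to the strong
  convergence of \<open>bump_tendsto\<close>, survives the passage through \<open>j\<close>.\<close>

lemma bump_absorb:
  assumes w: "w \<in> V" "mass w \<noteq> 0"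
  shows "(\<lambda>n. norm (bump w m * bump w n - bump w n)) \<longlonglongrightarrow> 0"
proof -
  let ?h = "adj w * w"
  have h: "?h \<in> W" "?h \<in> D" using w V_subset_W W_mult W_adj V_normalizers normalizer_square by blast+
  let ?r = "\<lambda>n. b n * (?h - scaleC (\<omega> ?h) 1)"
  have "norm (bump w m * bump w n - bump w n) \<le> (1 / mass w)\<^sup>2 * norm w ^ 2 * norm (?r n)" if "n > m" for n
  proof -
    have "b m * ?h * b n = b n * ?h" using D_comm[OF h(2) b_D] b_below[OF that] by (metis mult.assoc)
    moreover have "bump w m * bump w n = (1 / mass w)\<^sup>2 *\<^sub>R (w * (b m * ?h * b n) * adj w)"
      by (simp add: bump_def power2_eq_square mult.assoc)
    moreover have "bump w n = (1 / mass w)\<^sup>2 *\<^sub>R (w * scaleC (\<omega> ?h) (b n) * adj w)"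
      using w(2) by (simp add: bump_def mass_eq scaleR_scaleC[symmetric] power2_eq_square)
    ultimately have "bump w m * bump w n - bump w n = (1 / mass w)\<^sup>2 *\<^sub>R (w * ?r n * adj w)"
      by (simp add: right_diff_distrib left_diff_distrib scaleR_diff_right mult_scaleC_right)
    then have "norm (bump w m * bump w n - bump w n) = (1 / mass w)\<^sup>2 * norm (w * ?r n * adj w)" by simp
    also have "\<dots> \<le> (1 / mass w)\<^sup>2 * (norm w * norm (?r n) * norm (adj w))"
      by (intro mult_left_mono norm_mult_le) auto
    finally show ?thesis by (simp add: power2_eq_square mult_ac)
  qed
  moreover have "(\<lambda>n. (1 / mass w)\<^sup>2 * norm w ^ 2 * norm (?r n)) \<longlonglongrightarrow> 0"
    by (intro tendsto_mult_right_zero norm_b_mult_D_tendsto h)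
  ultimately show ?thesis
    by (intro tendsto_0_if_le[OF norm_ge_zero, rotated])
qed

text \<open>Converts norms, which \<open>j\<close> preserves, into lengths of vectors: by excision,
  cutting \<open>x\<close> close to the point of \<open>w\<close> leaves little more than the length
  of \<open>x\<close> on the normalized vector \<open>w\<close>.\<close>

lemma norm_mult_bump:
  assumes w: "w \<in> V" "mass w \<noteq> 0" and x: "adj w * (adj x * x) * w \<in> W" and \<epsilon>: "\<epsilon> > 0"
  shows "\<exists>m. norm (x * bump w m) * seminorm \<omega> w \<le> seminorm \<omega> (x * w) + \<epsilon>"
proof -
  let ?k = "adj w * (adj x * x) * w" and ?h = "adj w * w"
  have h: "?h \<in> W" using w V_subset_W W_mult W_adj by blast
  have s: "mass w > 0" using w(2) by (simp add: mass_def)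
  have \<omega>k: "\<omega> ?k = of_real (seminorm \<omega> (x * w) ^ 2)"
    using cstate_adj_mult_self[OF \<omega>, of "x * w"] by (simp add: adj_mult mult.assoc)
  \<comment> \<open>The bound for \<open>norm (x * bump w m) ^ 2\<close> that results when the
    compressions of \<open>?h\<close> and \<open>?k\<close> by \<open>b m\<close> are replaced by
    scalars plus defects.\<close>
  define B where "B m = (1 / mass w)\<^sup>2 * (seminorm \<omega> (x * w) ^ 2 * (mass w + norm (defect m ?h)) + norm w ^ 2 * norm (defect m ?k))" for m
  have "B \<longlonglongrightarrow> (1 / mass w)\<^sup>2 * (seminorm \<omega> (x * w) ^ 2 * (mass w + 0) + norm w ^ 2 * 0)"
    unfolding B_def by (intro tendsto_intros defect_tendsto_0 h x)
  then have "(\<lambda>m. sqrt (B m) * seminorm \<omega> w) \<longlonglongrightarrow>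
      sqrt ((1 / mass w)\<^sup>2 * (seminorm \<omega> (x * w) ^ 2 * (mass w + 0) + norm w ^ 2 * 0)) * seminorm \<omega> w"
    by (intro tendsto_intros)
  also have "sqrt ((1 / mass w)\<^sup>2 * (seminorm \<omega> (x * w) ^ 2 * (mass w + 0) + norm w ^ 2 * 0)) = seminorm \<omega> (x * w) / seminorm \<omega> w"
  proof -
    have "(1 / mass w)\<^sup>2 * (seminorm \<omega> (x * w) ^ 2 * (mass w + 0) + norm w ^ 2 * 0) = (seminorm \<omega> (x * w) / seminorm \<omega> w) ^ 2"
      using s by (simp add: power2_eq_square mass_def)
    then show ?thesis using seminorm_nonneg[OF \<omega>] by (simp only: real_sqrt_abs) simp
  qed
  also have "seminorm \<omega> (x * w) / seminorm \<omega> w * seminorm \<omega> w = seminorm \<omega> (x * w)" using w(2) by (simp add: mass_def)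
  finally obtain m where m: "sqrt (B m) * seminorm \<omega> w < seminorm \<omega> (x * w) + \<epsilon>"
    using order_tendstoD(2)[of _ "seminorm \<omega> (x * w)" sequentially "seminorm \<omega> (x * w) + \<epsilon>"] \<epsilon>
    by (auto simp: eventually_sequentially)
  have "norm (x * bump w m) ^ 2 \<le> B m"
  proof -
    have nwbb: "norm (w * (b m * b m) * adj w) \<le> mass w + norm (defect m ?h)"
    proof -
      have "norm (w * (b m * b m) * adj w) = norm ((w * b m) * adj (w * b m))" by (simp add: adj_mult b_adj mult.assoc)
      also have "\<dots> = norm (adj (w * b m) * (w * b m))" by (simp only: cstar_identity cstar_identity')
      also have "adj (w * b m) * (w * b m) = defect m ?h + scaleC (\<omega> ?h) (b m * b m)"
        by (simp add: defect_def adj_mult b_adj mult.assoc)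
      also have "norm \<dots> \<le> norm (defect m ?h) + norm (scaleC (\<omega> ?h) (b m * b m))" by (rule norm_triangle_ineq)
      also have "norm (scaleC (\<omega> ?h) (b m * b m)) = mass w"
        using s by (simp add: norm_scaleC mass_eq live_norm_square[OF b_live])
      finally show ?thesis by simp
    qed
    have "norm (x * bump w m) ^ 2 = norm (adj (x * bump w m) * (x * bump w m))" by (simp only: cstar_identity)
    also have "adj (x * bump w m) * (x * bump w m) = (1 / mass w)\<^sup>2 *\<^sub>R (w * (b m * ?k * b m) * adj w)"
      by (simp add: adj_mult bump_adj) (simp add: bump_def mult.assoc power2_eq_square)
    also have "b m * ?k * b m = scaleC (\<omega> ?k) (b m * b m) + defect m ?k" by (simp add: defect_def)
    also have "norm ((1 / mass w)\<^sup>2 *\<^sub>R (w * (scaleC (\<omega> ?k) (b m * b m) + defect m ?k) * adj w))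
        = (1 / mass w)\<^sup>2 * norm (scaleC (\<omega> ?k) (w * (b m * b m) * adj w) + w * defect m ?k * adj w)"
      by (simp add: distrib_left distrib_right mult_scaleC_left mult_scaleC_right)
    also have "\<dots> \<le> (1 / mass w)\<^sup>2 * (seminorm \<omega> (x * w) ^ 2 * (mass w + norm (defect m ?h)) + norm w * norm (defect m ?k) * norm (adj w))"
      by (intro mult_left_mono order_trans[OF norm_triangle_ineq] add_mono norm_mult_le)
        (auto simp: norm_scaleC \<omega>k norm_power seminorm_nonneg[OF \<omega>] intro!: mult_left_mono nwbb)
    also have "\<dots> = B m" by (simp add: B_def power2_eq_square mult_ac)
    finally show ?thesis .
  qed
  then have "norm (x * bump w m) \<le> sqrt (B m)" by (rule real_le_rsqrt)
  then have "norm (x * bump w m) * seminorm \<omega> w \<le> sqrt (B m) * seminorm \<omega> w"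
    by (intro mult_right_mono seminorm_nonneg \<omega>)
  then show ?thesis using m by (intro exI[of _ m]) linarith
qed

end

context generic_state
begin

lemma seminorm_1: "seminorm \<omega> 1 = 1"
  using \<omega>_absorb(3) by (simp add: seminorm_def)

text \<open>Each \<open>w\<close> with positive mass excludes a nowhere dense set, so Baire's theorem applies.\<close>

lemma separating_vector_exists:
  obtains u where "u \<in> W" "seminorm \<omega> u = 1" "\<And>w. w \<in> V \<Longrightarrow> mass w \<noteq> 0 \<Longrightarrow> \<omega> (adj w * u) \<noteq> 0"
proof -
  define K where "K = {w \<in> V. mass w \<noteq> 0}"
  define U where "U w = {z \<in> W. \<omega> (adj w * z) \<noteq> 0}" for w
  let ?X = "top_of_set W"
  have cont: "continuous_on UNIV (\<lambda>z. \<omega> (adj w * z))" for w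
  proof (rule bounded_linear.continuous_on[OF bounded_linear_compose[OF _ bounded_linear_mult_right] continuous_on_id])
    show "bounded_linear \<omega>"
      by (rule bounded_linear_intro[where K = 1])
        (simp_all add: cstate_add[OF \<omega>] cstate_scaleR[OF \<omega>] cstate_norm_le[OF \<omega>] scaleR_conv_of_real[where 'a = complex])
  qed
  have "?X closure_of \<Inter>(U ` K) = topspace ?X"
  proof (rule Baire_category)
    have "completely_metrizable_space ?X"
      by (rule completely_metrizable_space_closedin[OF completely_metrizable_space_euclidean]) (simp add: closed_W)
    then show "completely_metrizable_space ?X \<or> locally_compact_space ?X \<and> regular_space ?X" ..
    show "countable (U ` K)" unfolding K_def by (intro countable_image countable_subset[OF _ V_countable]) auto
    fix T assume "T \<in> U ` K"
    then obtain w where w: "w \<in> V" "mass w \<noteq> 0" "T = U w" by (auto simp: K_def)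
    have "open {z. \<omega> (adj w * z) \<noteq> 0}" by (intro open_Collect_neq cont continuous_on_const)
    then have "openin ?X (W \<inter> {z. \<omega> (adj w * z) \<noteq> 0})" by (rule openin_open_Int)
    moreover have "T = W \<inter> {z. \<omega> (adj w * z) \<noteq> 0}" by (auto simp: w(3) U_def)
    ultimately have "openin ?X T" by simp
    moreover have "?X closure_of T = topspace ?X"
    proof
      show "topspace ?X \<subseteq> ?X closure_of T"
      proof
        fix x assume "x \<in> topspace ?X"
        then have x: "x \<in> W" by simp
        show "x \<in> ?X closure_of T" unfolding in_closure_of
        proof (intro conjI allI impI)
          fix S assume S: "x \<in> S \<and> openin ?X S"
          then obtain G where G: "open G" "S = W \<inter> G" unfolding openin_open by blast
          obtain e where e: "e > 0" "ball x e \<subseteq> G" using S G open_contains_ball by blast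
          show "\<exists>y. y \<in> T \<and> y \<in> S"
          proof (cases "\<omega> (adj w * x) = 0")
            case False
            then show ?thesis using x S w by (auto simp: U_def)
          next
            case True
            define N where "N = norm w + 1"
            define t where "t = e / (2 * N)"
            have np: "N > 0" by (simp add: N_def add_nonneg_pos)
            have t: "t > 0" using e np by (simp add: t_def)
            have "t * norm w \<le> t * N" using t by (simp add: N_def)
            also have "\<dots> = e / 2" using np by (simp add: t_def)
            finally have "x + t *\<^sub>R w \<in> ball x e" using e t by (simp add: dist_norm)
            moreover have "x + t *\<^sub>R w \<in> W" using x w V_subset_W csubspaceD[OF W_subspace] by blast
            moreover have "\<omega> (adj w * (x + t *\<^sub>R w)) = of_real (t * mass w)"
              by (simp add: distrib_left cstate_add[OF \<omega>] cstate_scaleR[OF \<omega>] True mass_eq)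
            ultimately show ?thesis using G e t w by (intro exI[of _ "x + t *\<^sub>R w"]) (auto simp: U_def)
          qed
        qed (use x in simp)
      qed
    qed (rule closure_of_subset_topspace)
    ultimately show "openin ?X T \<and> ?X closure_of T = topspace ?X" ..
  qed
  moreover have "0 \<in> W" by (rule csubspaceD(1)[OF W_subspace])
  ultimately have "\<Inter>(U ` K) \<noteq> {}" by auto
  then obtain u where "u \<in> \<Inter>(U ` K)" by blast
  moreover have "1 \<in> K" using V_1 seminorm_1 by (simp add: K_def mass_def)
  ultimately have u: "u \<in> W" "\<And>w. w \<in> V \<Longrightarrow> mass w \<noteq> 0 \<Longrightarrow> \<omega> (adj w * u) \<noteq> 0" and u1: "\<omega> (adj 1 * u) \<noteq> 0"
    by (auto simp: U_def K_def)
  have "seminorm \<omega> u \<noteq> 0" using u1 cstate_Cauchy_Schwarz[OF \<omega>, of 1 u] by auto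
  then have su: "seminorm \<omega> u > 0" using seminorm_nonneg[OF \<omega>, of u] by simp
  let ?u = "scaleC (of_real (1 / seminorm \<omega> u)) u"
  show ?thesis
  proof (rule that)
    show "?u \<in> W" using u(1) by (rule csubspaceD(3)[OF W_subspace])
    show "seminorm \<omega> ?u = 1" unfolding seminorm_scaleC[OF \<omega>] using su by (simp add: norm_divide)
    show "\<omega> (adj w * ?u) \<noteq> 0" if "w \<in> V" "mass w \<noteq> 0" for w
      using u(2)[OF that] su by (simp add: mult_scaleC_right cstate_scaleC[OF \<omega>])
  qed
qed

end

subsection \<open>Matching vectors of two GNS representations\<close>

text \<open>The vector \<open>w\<close> of the first representation corresponds to the limit, in the second one, of
  the sequence \<open>\<zeta> w\<close>. The predicate \<open>matched\<close> extends this correspondence to the closed linear span,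
  and \<open>intertwined x y\<close> says that \<open>x\<close> and \<open>y\<close> act compatibly on it.\<close>

locale matched_vectors =
  fixes \<omega> :: "'a::cstar_algebra \<Rightarrow> complex" and \<phi> :: "'b::cstar_algebra \<Rightarrow> complex"
    and K :: "'a set" and \<zeta> :: "'a \<Rightarrow> nat \<Rightarrow> 'b"
  assumes \<omega>: "cstate \<omega>" and \<phi>: "cstate \<phi>"
    and \<zeta>: "v \<in> K \<Longrightarrow> w \<in> K \<Longrightarrow> (\<lambda>n. \<phi> (adj (\<zeta> v n) * \<zeta> w n)) \<longlonglongrightarrow> \<omega> (adj v * w)"
begin

inductive matched :: "'a \<Rightarrow> (nat \<Rightarrow> 'b) \<Rightarrow> bool" where
  base: "w \<in> K \<Longrightarrow> matched w (\<zeta> w)"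
| zero: "matched 0 (\<lambda>_. 0)"
| add: "matched X Y \<Longrightarrow> matched X' Y' \<Longrightarrow> matched (X + X') (\<lambda>n. Y n + Y' n)"
| scale: "matched X Y \<Longrightarrow> matched (scaleC c X) (\<lambda>n. scaleC c (Y n))"
| limit: "(\<And>e. e > 0 \<Longrightarrow> \<exists>X' Y'. matched X' Y' \<and> seminorm \<omega> (X - X') \<le> e \<and>
    (\<forall>\<^sub>F n in sequentially. seminorm \<phi> (Y n - Y' n) \<le> e)) \<Longrightarrow> matched X Y"

lemma matched_bounded: "matched X Y \<Longrightarrow> \<exists>M. \<forall>\<^sub>F n in sequentially. seminorm \<phi> (Y n) \<le> M"
proof (induction rule: matched.induct)
  case (base w)
  have "(\<lambda>n. sqrt (Re (\<phi> (adj (\<zeta> w n) * \<zeta> w n)))) \<longlonglongrightarrow> sqrt (Re (\<omega> (adj w * w)))"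
    by (intro tendsto_intros \<zeta> base)
  then have "(\<lambda>n. seminorm \<phi> (\<zeta> w n)) \<longlonglongrightarrow> seminorm \<omega> w" by (simp add: seminorm_def)
  then have "\<forall>\<^sub>F n in sequentially. seminorm \<phi> (\<zeta> w n) < seminorm \<omega> w + 1" by (rule order_tendstoD) simp
  then show ?case by (intro exI[of _ "seminorm \<omega> w + 1"]) (auto elim: eventually_mono)
next
  case zero
  show ?case by (intro exI[of _ 0]) (simp add: seminorm_def cstate_0[OF \<phi>])
next
  case (add X Y X' Y')
  then obtain M M' where "\<forall>\<^sub>F n in sequentially. seminorm \<phi> (Y n) \<le> M" "\<forall>\<^sub>F n in sequentially. seminorm \<phi> (Y' n) \<le> M'"
    by blast
  then have "\<forall>\<^sub>F n in sequentially. seminorm \<phi> (Y n + Y' n) \<le> M + M'"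
    by eventually_elim (meson add_mono order_trans seminorm_triangle[OF \<phi>])
  then show ?case ..
next
  case (scale X Y c)
  then obtain M where "\<forall>\<^sub>F n in sequentially. seminorm \<phi> (Y n) \<le> M" by blast
  then have "\<forall>\<^sub>F n in sequentially. seminorm \<phi> (scaleC c (Y n)) \<le> cmod c * M"
    by eventually_elim (simp add: seminorm_scaleC[OF \<phi>] mult_left_mono)
  then show ?case ..
next
  case (limit X Y)
  from limit(1)[of 1] obtain X' Y' M where "\<forall>\<^sub>F n in sequentially. seminorm \<phi> (Y' n) \<le> M"
    "\<forall>\<^sub>F n in sequentially. seminorm \<phi> (Y n - Y' n) \<le> 1" by auto
  then have "\<forall>\<^sub>F n in sequentially. seminorm \<phi> (Y n) \<le> M + 1"
  proof eventually_elim
    case (elim n)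
    then show ?case using seminorm_triangle[OF \<phi>, of "Y' n" "Y n - Y' n"] by simp
  qed
  then show ?case ..
qed

text \<open>\<open>Y0\<close> is only assumed bounded with the right products against the \<zeta> v,
  because the lemma is applied to sequences \<open>y * \<zeta> w n\<close> before these are known to
  be matched.\<close>

lemma matched_pairing:
  assumes "matched X Y" and bounded: "\<forall>\<^sub>F n in sequentially. seminorm \<phi> (Y0 n) \<le> M"
    and conv: "\<And>v. v \<in> K \<Longrightarrow> (\<lambda>n. \<phi> (adj (\<zeta> v n) * Y0 n)) \<longlonglongrightarrow> \<omega> (adj v * X0)"
  shows "(\<lambda>n. \<phi> (adj (Y n) * Y0 n)) \<longlonglongrightarrow> \<omega> (adj X * X0)"
  using assms(1)
proof (induction rule: matched.induct)
  case (base w)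
  then show ?case by (rule conv)
next
  case zero
  show ?case by (simp add: cstate_0[OF \<phi>] cstate_0[OF \<omega>])
next
  case (add X Y X' Y')
  then show ?case by (simp add: adj_add distrib_right cstate_add[OF \<phi>] cstate_add[OF \<omega>] tendsto_add)
next
  case (scale X Y c)
  then show ?case
    by (simp add: adj_scaleC mult_scaleC_left cstate_scaleC[OF \<phi>] cstate_scaleC[OF \<omega>] tendsto_mult_left)
next
  case (limit X Y)
  show ?case
  proof (rule tendstoI)
    fix \<epsilon> :: real assume \<epsilon>: "\<epsilon> > 0"
    define R where "R = \<bar>M\<bar> + seminorm \<omega> X0 + 1"
    have R: "R > 0" unfolding R_def using seminorm_nonneg[OF \<omega>, of X0] by linarith
    define e where "e = \<epsilon> / (3 * R)"
    have e: "e > 0" "e * R = \<epsilon> / 3" using \<epsilon> R by (simp_all add: e_def)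
    obtain X' Y' where X': "seminorm \<omega> (X - X') \<le> e" "\<forall>\<^sub>F n in sequentially. seminorm \<phi> (Y n - Y' n) \<le> e"
      and conv': "(\<lambda>n. \<phi> (adj (Y' n) * Y0 n)) \<longlonglongrightarrow> \<omega> (adj X' * X0)"
      using limit(1)[OF e(1)] by blast
    have "\<forall>\<^sub>F n in sequentially. dist (\<phi> (adj (Y' n) * Y0 n)) (\<omega> (adj X' * X0)) < \<epsilon> / 3"
      using tendstoD[OF conv', of "\<epsilon> / 3"] \<epsilon> by simp
    then show "\<forall>\<^sub>F n in sequentially. dist (\<phi> (adj (Y n) * Y0 n)) (\<omega> (adj X * X0)) < \<epsilon>"
      using X'(2) bounded
    proof eventually_elim
      case (elim n)
      have le: "s \<le> e * R" if "s \<le> p * q" "p \<le> e" "q \<le> R" "0 \<le> q" for s p q :: real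
        using that e R by (meson mult_mono order_trans less_imp_le)
      have "cmod (\<phi> (adj (Y n - Y' n) * Y0 n)) \<le> seminorm \<phi> (Y n - Y' n) * seminorm \<phi> (Y0 n)"
        using cstate_Cauchy_Schwarz[OF \<phi>, of "Y n - Y' n" "Y0 n"] by (simp add: mult.commute)
      then have 1: "cmod (\<phi> (adj (Y n - Y' n) * Y0 n)) \<le> e * R"
        by (rule le) (use elim seminorm_nonneg[OF \<omega>, of X0] seminorm_nonneg[OF \<phi>] in \<open>auto simp: R_def\<close>)
      have "cmod (\<omega> (adj (X - X') * X0)) \<le> seminorm \<omega> (X - X') * seminorm \<omega> X0"
        using cstate_Cauchy_Schwarz[OF \<omega>, of "X - X'" X0] by (simp add: mult.commute)
      then have 2: "cmod (\<omega> (adj (X - X') * X0)) \<le> e * R"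
        by (rule le) (use X' seminorm_nonneg[OF \<omega>] in \<open>auto simp: R_def\<close>)
      have "\<phi> (adj (Y n) * Y0 n) - \<omega> (adj X * X0)
          = \<phi> (adj (Y n - Y' n) * Y0 n) + (\<phi> (adj (Y' n) * Y0 n) - \<omega> (adj X' * X0)) - \<omega> (adj (X - X') * X0)"
        by (simp add: adj_diff left_diff_distrib cstate_diff[OF \<phi>] cstate_diff[OF \<omega>])
      then have "cmod (\<phi> (adj (Y n) * Y0 n) - \<omega> (adj X * X0))
          \<le> cmod (\<phi> (adj (Y n - Y' n) * Y0 n)) + cmod (\<phi> (adj (Y' n) * Y0 n) - \<omega> (adj X' * X0))
            + cmod (\<omega> (adj (X - X') * X0))"
        by (metis (no_types) norm_triangle_ineq4 norm_triangle_ineq add_right_mono order_trans)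
      then show ?case using 1 2 elim(1) e(2) by (simp add: dist_norm)
    qed
  qed
qed

lemma matched_seminorm:
  assumes XY: "matched X Y"
  shows "(\<lambda>n. seminorm \<phi> (Y n)) \<longlonglongrightarrow> seminorm \<omega> X"
proof -
  have "(\<lambda>n. \<phi> (adj (\<zeta> w n) * Y n)) \<longlonglongrightarrow> \<omega> (adj w * X)" if w: "w \<in> K" for w
  proof -
    obtain M where "\<forall>\<^sub>F n in sequentially. seminorm \<phi> (\<zeta> w n) \<le> M" using matched_bounded[OF base[OF w]] by blast
    then have "(\<lambda>n. \<phi> (adj (Y n) * \<zeta> w n)) \<longlonglongrightarrow> \<omega> (adj X * w)"
      by (rule matched_pairing[OF XY]) (rule \<zeta>[OF _ w])
    then have "(\<lambda>n. cnj (\<phi> (adj (Y n) * \<zeta> w n))) \<longlonglongrightarrow> cnj (\<omega> (adj X * w))" by (rule tendsto_cnj)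
    then show ?thesis by (simp only: cstate_swap[OF \<phi>, symmetric] cstate_swap[OF \<omega>, symmetric])
  qed
  moreover obtain M where "\<forall>\<^sub>F n in sequentially. seminorm \<phi> (Y n) \<le> M" using matched_bounded[OF XY] by blast
  ultimately have "(\<lambda>n. \<phi> (adj (Y n) * Y n)) \<longlonglongrightarrow> \<omega> (adj X * X)" by (intro matched_pairing[OF XY])
  then show ?thesis unfolding seminorm_def by (intro tendsto_intros)
qed

definition intertwined :: "'a \<Rightarrow> 'b \<Rightarrow> bool" where
  "intertwined x y \<longleftrightarrow> (\<forall>X Y. matched X Y \<longrightarrow> matched (x * X) (\<lambda>n. y * Y n))"

lemma intertwined_mult: "intertwined x y \<Longrightarrow> intertwined x' y' \<Longrightarrow> intertwined (x * x') (y * y')"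
  by (simp add: intertwined_def mult.assoc)

lemma intertwined_add: "intertwined x y \<Longrightarrow> intertwined x' y' \<Longrightarrow> intertwined (x + x') (y + y')"
  by (simp add: intertwined_def distrib_right matched.add)

lemma intertwined_scaleC: "intertwined x y \<Longrightarrow> intertwined (scaleC c x) (scaleC c y)"
  by (simp add: intertwined_def mult_scaleC_left matched.scale)

lemma intertwinedI:
  assumes "\<And>w. w \<in> K \<Longrightarrow> matched (x * w) (\<lambda>n. y * \<zeta> w n)"
  shows "intertwined x y"
  unfolding intertwined_def
proof (intro allI impI)
  fix X Y assume "matched X Y"
  then show "matched (x * X) (\<lambda>n. y * Y n)"
  proof (induction rule: matched.induct)
    case (base w)
    then show ?case by (rule assms)
  next
    case zero
    show ?case using matched.zero by simp
  next
    case (add X Y X' Y')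
    then show ?case using matched.add by (simp add: distrib_left)
  next
    case (scale X Y c)
    then show ?case using matched.scale by (simp add: mult_scaleC_right)
  next
    case (limit X Y)
    show ?case
    proof (rule matched.limit)
      fix e :: real assume e: "e > 0"
      define R where "R = norm x + norm y + 1"
      have R: "R > 0" "norm x \<le> R" "norm y \<le> R" by (simp_all add: R_def add_nonneg_pos)
      obtain X' Y' where X': "matched (x * X') (\<lambda>n. y * Y' n)" "seminorm \<omega> (X - X') \<le> e / R"
        "\<forall>\<^sub>F n in sequentially. seminorm \<phi> (Y n - Y' n) \<le> e / R"
        using limit(1)[of "e / R"] e R by auto
      have eR: "R * (e / R) = e" using R by simp
      have "seminorm \<omega> (x * X - x * X') \<le> norm x * seminorm \<omega> (X - X')"
        using seminorm_mult_le[OF \<omega>, of x "X - X'"] by (simp add: right_diff_distrib)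
      also have "\<dots> \<le> R * (e / R)" using X'(2) R seminorm_nonneg[OF \<omega>] by (intro mult_mono) auto
      finally have 1: "seminorm \<omega> (x * X - x * X') \<le> e" by (simp only: eR)
      have "\<forall>\<^sub>F n in sequentially. seminorm \<phi> (y * Y n - y * Y' n) \<le> e"
        using X'(3)
      proof eventually_elim
        case (elim n)
        have "seminorm \<phi> (y * Y n - y * Y' n) \<le> norm y * seminorm \<phi> (Y n - Y' n)"
          using seminorm_mult_le[OF \<phi>, of y "Y n - Y' n"] by (simp add: right_diff_distrib)
        also have "\<dots> \<le> R * (e / R)" using elim R seminorm_nonneg[OF \<phi>] by (intro mult_mono) auto
        finally show ?case by (simp only: eR)
      qed
      then show "\<exists>X' Y'. matched X' Y' \<and> seminorm \<omega> (x * X - X') \<le> e \<and>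
          (\<forall>\<^sub>F n in sequentially. seminorm \<phi> (y * Y n - Y' n) \<le> e)" using X'(1) 1 by blast
    qed
  qed
qed

text \<open>The vectors \<open>y * \<zeta> w n\<close> have asymptotically the inner products of \<open>x * w\<close> with all matched
  vectors, and are asymptotically not longer than \<open>x * w\<close>; hence they converge to its partner.\<close>

lemma matched_if_seminorm_le:
  assumes bound: "\<And>e. e > 0 \<Longrightarrow> \<forall>\<^sub>F n in sequentially. seminorm \<phi> (Y n) \<le> seminorm \<omega> X + e"
    and conv: "\<And>v. v \<in> K \<Longrightarrow> (\<lambda>n. \<phi> (adj (\<zeta> v n) * Y n)) \<longlonglongrightarrow> \<omega> (adj v * X)"
    and approx: "\<And>e. e > 0 \<Longrightarrow> \<exists>X' Y'. matched X' Y' \<and> seminorm \<omega> (X - X') \<le> e"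
  shows "matched X Y"
proof (rule limit)
  fix e :: real assume e: "e > 0"
  obtain X' Y' where X': "matched X' Y'" "seminorm \<omega> (X - X') \<le> e / 2" using approx[of "e / 2"] e by auto
  \<comment> \<open>Only upper bounds are known for \<open>seminorm \<phi> (Y n)\<close>; the
    maximum is a majorant that converges.\<close>
  define f where "f n = max (seminorm \<phi> (Y n)) (seminorm \<omega> X)" for n
  have f: "f \<longlonglongrightarrow> seminorm \<omega> X"
  proof (rule tendstoI)
    fix \<epsilon> :: real assume "\<epsilon> > 0"
    then have "\<forall>\<^sub>F n in sequentially. seminorm \<phi> (Y n) \<le> seminorm \<omega> X + \<epsilon> / 2" by (intro bound) simp
    then show "\<forall>\<^sub>F n in sequentially. dist (f n) (seminorm \<omega> X) < \<epsilon>"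
      by eventually_elim (use \<open>\<epsilon> > 0\<close> in \<open>auto simp: f_def dist_real_def max_def\<close>)
  qed
  have pair: "(\<lambda>n. \<phi> (adj (Y' n) * Y n)) \<longlonglongrightarrow> \<omega> (adj X' * X)"
    by (rule matched_pairing[OF X'(1) bound[OF zero_less_one] conv])
  have sq: "seminorm \<psi> (x - y) ^ 2 = seminorm \<psi> x ^ 2 - 2 * Re (\<psi> (adj y * x)) + seminorm \<psi> y ^ 2"
    if "cstate \<psi>" for \<psi> :: "'c::cstar_algebra \<Rightarrow> complex" and x y
    using seminorm_diff_scaleC_square[OF that, of x 1 y] by (simp add: scaleC_one)
  define Q where "Q n = f n ^ 2 - 2 * Re (\<phi> (adj (Y' n) * Y n)) + seminorm \<phi> (Y' n) ^ 2" for n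
  have "Q \<longlonglongrightarrow> seminorm \<omega> X ^ 2 - 2 * Re (\<omega> (adj X' * X)) + seminorm \<omega> X' ^ 2"
    unfolding Q_def by (intro tendsto_intros f pair matched_seminorm X')
  then have "Q \<longlonglongrightarrow> seminorm \<omega> (X - X') ^ 2" by (simp only: sq[OF \<omega>])
  moreover have "seminorm \<omega> (X - X') ^ 2 < e ^ 2"
    using X'(2) e seminorm_nonneg[OF \<omega>] by (intro power_strict_mono) auto
  ultimately have "\<forall>\<^sub>F n in sequentially. Q n < e ^ 2" by (rule order_tendstoD)
  then have "\<forall>\<^sub>F n in sequentially. seminorm \<phi> (Y n - Y' n) \<le> e"
  proof eventually_elim
    case (elim n)
    have "seminorm \<phi> (Y n) ^ 2 \<le> f n ^ 2"
      unfolding f_def by (intro power_mono seminorm_nonneg[OF \<phi>]) simp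
    then have "seminorm \<phi> (Y n - Y' n) ^ 2 \<le> e ^ 2" using elim by (simp add: sq[OF \<phi>] Q_def)
    then show ?case by (rule power2_le_imp_le) (use e in simp)
  qed
  then show "\<exists>X' Y'. matched X' Y' \<and> seminorm \<omega> (X - X') \<le> e \<and>
      (\<forall>\<^sub>F n in sequentially. seminorm \<phi> (Y n - Y' n) \<le> e)" using X' e by (intro exI conjI) auto
qed

end

lemma cstate_pairing_tendsto:
  assumes \<omega>: "cstate \<omega>" and X: "(\<lambda>n. seminorm \<omega> (X n - X0)) \<longlonglongrightarrow> 0" and Y: "(\<lambda>n. seminorm \<omega> (Y n - Y0)) \<longlonglongrightarrow> 0"
  shows "(\<lambda>n. \<omega> (adj (Y n) * (a * X n))) \<longlonglongrightarrow> \<omega> (adj Y0 * (a * X0))"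
proof -
  let ?x = "\<lambda>n. seminorm \<omega> (X n - X0)" and ?y = "\<lambda>n. seminorm \<omega> (Y n - Y0)"
  have cs: "cmod (\<omega> (adj z * (a * w))) \<le> norm a * seminorm \<omega> w * seminorm \<omega> z" for z w
    using cstate_Cauchy_Schwarz[OF \<omega>, of z "a * w"] seminorm_mult_le[OF \<omega>, of a w]
      mult_right_mono[OF seminorm_mult_le[OF \<omega>, of a w] seminorm_nonneg[OF \<omega>, of z]] by linarith
  have "cmod (\<omega> (adj (Y n) * (a * X n)) - \<omega> (adj Y0 * (a * X0)))
      \<le> norm a * ?x n * ?y n + norm a * seminorm \<omega> X0 * ?y n + norm a * ?x n * seminorm \<omega> Y0" for n
  proof -
    have "\<omega> (adj (Y n) * (a * X n)) - \<omega> (adj Y0 * (a * X0)) = \<omega> (adj (Y n - Y0) * (a * (X n - X0)))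
        + \<omega> (adj (Y n - Y0) * (a * X0)) + \<omega> (adj Y0 * (a * (X n - X0)))"
      by (simp add: adj_diff left_diff_distrib right_diff_distrib cstate_diff[OF \<omega>])
    also have "cmod \<dots> \<le> cmod (\<omega> (adj (Y n - Y0) * (a * (X n - X0)))) + cmod (\<omega> (adj (Y n - Y0) * (a * X0)))
        + cmod (\<omega> (adj Y0 * (a * (X n - X0))))"
      by (meson norm_triangle_ineq add_right_mono order_trans)
    also have "\<dots> \<le> norm a * ?x n * ?y n + norm a * seminorm \<omega> X0 * ?y n + norm a * ?x n * seminorm \<omega> Y0"
      by (intro add_mono cs)
    finally show ?thesis .
  qed
  moreover have "(\<lambda>n. norm a * ?x n * ?y n + norm a * seminorm \<omega> X0 * ?y n + norm a * ?x n * seminorm \<omega> Y0)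
      \<longlonglongrightarrow> norm a * 0 * 0 + norm a * seminorm \<omega> X0 * 0 + norm a * 0 * seminorm \<omega> Y0"
    by (intro tendsto_intros X Y)
  ultimately have "(\<lambda>n. cmod (\<omega> (adj (Y n) * (a * X n)) - \<omega> (adj Y0 * (a * X0)))) \<longlonglongrightarrow> 0"
    by (intro tendsto_0_if_le[OF norm_ge_zero]) auto
  then show ?thesis by (simp only: tendsto_norm_zero_iff LIM_zero_iff)
qed

subsection \<open>Isometric homomorphisms\<close>

locale isometric_hom =
  fixes A :: "'a::cstar_algebra set" and j :: "'a \<Rightarrow> 'b::cstar_algebra"
  assumes A: "csubalgebra A" and A_1: "1 \<in> A" and hom: "chom_on A j"
    and isometric: "a \<in> A \<Longrightarrow> norm (j a) = norm a"
begin

lemma A_subspace: "csubspace A" and A_mult: "x \<in> A \<Longrightarrow> y \<in> A \<Longrightarrow> x * y \<in> A"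
  using A by (auto simp: csubalgebra_def)

lemmas A_closed = A_1 A_mult csubspaceD[OF A_subspace]

lemma j_add: "x \<in> A \<Longrightarrow> y \<in> A \<Longrightarrow> j (x + y) = j x + j y"
  and j_mult: "x \<in> A \<Longrightarrow> y \<in> A \<Longrightarrow> j (x * y) = j x * j y"
  and j_scaleC: "x \<in> A \<Longrightarrow> j (scaleC c x) = scaleC c (j x)"
  using hom by (auto simp: chom_on_def)

lemma j_scaleR: "x \<in> A \<Longrightarrow> j (r *\<^sub>R x) = r *\<^sub>R j x"
  by (simp add: scaleR_scaleC j_scaleC)

lemma j_0: "j 0 = 0"
  using j_scaleC[of 0 0] A_closed by simp

lemma j_minus: "x \<in> A \<Longrightarrow> j (- x) = - j x"
  using j_scaleC[of x "- 1"] by (simp add: scaleC_minus1)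

lemma j_diff: "x \<in> A \<Longrightarrow> y \<in> A \<Longrightarrow> j (x - y) = j x - j y"
  using j_add[of x "- y"] A_closed by (simp add: j_minus)

lemma j_1_mult: "a \<in> A \<Longrightarrow> j 1 * j a = j a" "a \<in> A \<Longrightarrow> j a * j 1 = j a"
  using j_mult[of 1 a] j_mult[of a 1] A_1 by auto

lemma norm_j_1: "norm (j 1) = 1"
  using isometric[OF A_1] by simp

lemma j_1_adj: "adj (j 1) = j 1"
  using j_1_mult[OF A_1] norm_j_1 by (intro contractive_idempotent_selfadj) auto

text \<open>For self-adjoint \<open>h\<close> and real t, norm (h + i t) ^ 2 is at most norm h ^ 2 +
  t^2. Isometry transports this to \<open>j h\<close>, with the projection \<open>j 1\<close> as
  unit.\<close>

lemma j_selfadj: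
  assumes h: "h \<in> A" "adj h = h"
  shows "adj (j h) = j h"
proof (rule selfadj_if_norm_imaginary_shift[of "j 1" "j h" "norm h ^ 2"])
  fix t :: real
  let ?z = "h + scaleC (\<i> * t) 1"
  have "j h + scaleC (\<i> * t) (j 1) = j ?z" using h A_closed by (simp add: j_add j_scaleC)
  then have "norm (j h + scaleC (\<i> * t) (j 1)) = norm ?z" using h A_closed by (simp add: isometric)
  moreover have "adj ?z * ?z = h * h + t\<^sup>2 *\<^sub>R 1"
    by (simp add: adj_add adj_scaleC h(2) algebra_simps mult_scaleC_left mult_scaleC_right scaleC_scaleC
        scaleC_minus_left scaleR_scaleC power2_eq_square scaleC_add_right scaleC_diff_right)
  then have "norm ?z ^ 2 \<le> norm (h * h) + norm (t\<^sup>2 *\<^sub>R (1::'a))"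
    using cstar_identity[of ?z] norm_triangle_ineq by metis
  then have "norm ?z ^ 2 \<le> norm h ^ 2 + t\<^sup>2" by (simp add: norm_square_selfadj[OF h(2)])
  ultimately show "norm (j h + scaleC (\<i> * t) (j 1)) ^ 2 \<le> norm h ^ 2 + t\<^sup>2" by simp
qed (use j_1_mult h A_1 j_1_adj in auto)

text \<open>The graph of j a \<mapsto> Re (\<psi> a) serves as the cone of constraints. It is
  symmetric, so the inequalities become equalities, and replacing a by i a gives the imaginary
  part.\<close>

lemma cstate_extension:
  assumes \<psi>: "\<And>x y. \<psi> (x + y) = \<psi> x + \<psi> y" "\<And>c x. \<psi> (scaleC c x) = c * \<psi> x" "\<psi> 1 = 1"
      "\<And>x. cmod (\<psi> x) \<le> norm x"
  obtains \<phi> where "cstate \<phi>" "\<And>a. a \<in> A \<Longrightarrow> \<phi> (j a) = \<psi> a"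
proof -
  let ?q = "j 1"
  have qq: "?q * ?q = ?q" by (rule j_1_mult(1)[OF A_1])
  define M where "M = (\<lambda>a. (j a, Re (\<psi> a))) ` A"
  have \<psi>0: "\<psi> 0 = 0" using \<psi>(2)[of 0 0] by simp
  have \<psi>R: "\<psi> (r *\<^sub>R x) = of_real r * \<psi> x" for r x by (simp add: scaleR_scaleC \<psi>)
  obtain \<phi> where \<phi>: "cstate \<phi>" "\<And>m r. (m, r) \<in> M \<Longrightarrow> r \<le> Re (\<phi> m)"
  \<comment> \<open>Cutting by \<open>j 1\<close> turns t + j a into \<open>j (t 1 + a)\<close>, so
    isometry on \<open>A\<close> applies although \<open>j 1\<close> may differ from 1.\<close>
  proof (rule cstate_exists[of "\<lambda>_. ?q" M])
    show "real_cone M" unfolding real_cone_def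
    proof (intro conjI ballI allI impI)
      show "0 \<in> M" unfolding M_def using A_closed by (intro image_eqI[of _ _ 0]) (auto simp: j_0 \<psi>0 zero_prod_def)
      fix p p' assume "p \<in> M" "p' \<in> M"
      then obtain a a' where "a \<in> A" "p = (j a, Re (\<psi> a))" "a' \<in> A" "p' = (j a', Re (\<psi> a'))" by (auto simp: M_def)
      then show "p + p' \<in> M" unfolding M_def using A_closed
        by (intro image_eqI[of _ _ "a + a'"]) (auto simp: j_add \<psi>)
    next
      fix t :: real and p assume "0 < t" "p \<in> M"
      then obtain a where "a \<in> A" "p = (j a, Re (\<psi> a))" by (auto simp: M_def)
      then show "t *\<^sub>R p \<in> M" unfolding M_def using A_closed
        by (intro image_eqI[of _ _ "t *\<^sub>R a"]) (auto simp: j_scaleR \<psi>R)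
    qed
    fix m r and t :: real assume "(m, r) \<in> M" "t \<ge> 0"
    then obtain a where a: "a \<in> A" "m = j a" "r = Re (\<psi> a)" by (auto simp: M_def)
    have "?q * (t *\<^sub>R 1 + m) * ?q = j (t *\<^sub>R 1 + a)"
      using a A_closed by (simp add: distrib_left distrib_right j_1_mult qq j_add j_scaleR)
    then have "norm (?q * (t *\<^sub>R 1 + m) * ?q) = norm (t *\<^sub>R 1 + a)" using a A_closed by (simp add: isometric)
    moreover have "r + t = Re (\<psi> (t *\<^sub>R 1 + a))" by (simp add: a \<psi> \<psi>R)
    moreover have "\<dots> \<le> norm (t *\<^sub>R 1 + a)" using \<psi>(4) complex_Re_le_cmod order_trans by blast
    ultimately show "r + t \<le> norm (?q * (t *\<^sub>R 1 + m) * ?q)" by simp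
  qed (auto simp: norm_j_1 qq)
  have ge: "Re (\<psi> a) \<le> Re (\<phi> (j a))" if "a \<in> A" for a using that by (intro \<phi>(2)) (auto simp: M_def)
  have Re_eq: "Re (\<phi> (j a)) = Re (\<psi> a)" if a: "a \<in> A" for a
    using ge[OF a] ge[of "- a"] a A_closed \<psi>(2)[of "- 1" a] by (simp add: j_minus cstate_minus[OF \<phi>(1)] scaleC_minus1)
  have "\<phi> (j a) = \<psi> a" if a: "a \<in> A" for a
  proof -
    have "Re (\<phi> (j (scaleC \<i> a))) = Re (\<psi> (scaleC \<i> a))" using a A_closed by (intro Re_eq)
    then have "Im (\<phi> (j a)) = Im (\<psi> a)" by (simp add: j_scaleC a cstate_scaleC[OF \<phi>(1)] \<psi>)
    then show ?thesis using Re_eq[OF a] by (simp add: complex_eq_iff)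
  qed
  then show ?thesis using that \<phi>(1) by blast
qed

end

text \<open>The values of one *-polynomial at elements of \<open>S\<close> and at their images. A
  relation, because it is yet to be shown that the second value determines the first.\<close>

inductive star_pair :: "'a::cstar_algebra set \<Rightarrow> ('a \<Rightarrow> 'b::cstar_algebra) \<Rightarrow> 'a \<Rightarrow> 'b \<Rightarrow> bool"
  for S :: "'a set" and j :: "'a \<Rightarrow> 'b" where
  elem: "a \<in> S \<Longrightarrow> star_pair S j a (j a)"
| elem_adj: "a \<in> S \<Longrightarrow> star_pair S j (adj a) (adj (j a))"
| add: "star_pair S j x y \<Longrightarrow> star_pair S j x' y' \<Longrightarrow> star_pair S j (x + x') (y + y')"
| mult: "star_pair S j x y \<Longrightarrow> star_pair S j x' y' \<Longrightarrow> star_pair S j (x * x') (y * y')"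
| scaleC: "star_pair S j x y \<Longrightarrow> star_pair S j (scaleC c x) (scaleC c y)"

lemma star_pair_adj: "star_pair S j x y \<Longrightarrow> star_pair S j (adj x) (adj y)"
  by (induction rule: star_pair.induct) (auto simp: adj_adj adj_add adj_mult adj_scaleC intro: star_pair.intros)

lemma star_pair_mono: "star_pair S j x y \<Longrightarrow> S \<subseteq> T \<Longrightarrow> star_pair T j x y"
  by (induction rule: star_pair.induct) (auto intro: star_pair.intros)

text \<open>Generic states handle countable families only, and a single pair involves finitely many
  elements.\<close>

lemma star_pair_finite: "star_pair S j x y \<Longrightarrow> \<exists>F. finite F \<and> F \<subseteq> S \<and> star_pair F j x y"
proof (induction rule: star_pair.induct)
  case (elem a)
  then show ?case by (intro exI[of _ "{a}"]) (auto intro: star_pair.intros)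
next
  case (elem_adj a)
  then show ?case by (intro exI[of _ "{a}"]) (auto intro: star_pair.intros)
next
  case (add x y x' y')
  then obtain F F' where "finite F" "F \<subseteq> S" "star_pair F j x y" "finite F'" "F' \<subseteq> S" "star_pair F' j x' y'" by blast
  then show ?case by (intro exI[of _ "F \<union> F'"]) (auto intro: star_pair.add star_pair_mono)
next
  case (mult x y x' y')
  then obtain F F' where "finite F" "F \<subseteq> S" "star_pair F j x y" "finite F'" "F' \<subseteq> S" "star_pair F' j x' y'" by blast
  then show ?case by (intro exI[of _ "F \<union> F'"]) (auto intro: star_pair.mult star_pair_mono)
next
  case (scaleC x y c)
  then show ?case by (auto intro: star_pair.scaleC)
qed

locale cover = pseudo_cartan_inclusion D + isometric_hom A j
  for D A :: "'a::cstar_algebra set" and j :: "'a \<Rightarrow> 'b::cstar_algebra" +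
  assumes D_A: "D \<subseteq> A"
begin

lemma j_adj:
  assumes d: "d \<in> D"
  shows "j (adj d) = adj (j d)"
proof -
  obtain h k where hk: "adj h = h" "adj k = k" "d = h + scaleC \<i> k"
    "h = scaleR (1/2) (d + adj d)" "k = scaleC (- \<i> / 2) (d - adj d)" by (rule real_imag_decomp)
  have "h \<in> D" "k \<in> D" unfolding hk(4,5) using d by (intro D_closed D_adj; assumption)+
  then have hA: "h \<in> A" "k \<in> A" using D_A by auto
  have ad: "adj d = h - scaleC \<i> k"
    unfolding hk(3) by (simp add: adj_add adj_scaleC hk(1,2) scaleC_minus_left)
  have jd: "j d = j h + scaleC \<i> (j k)" unfolding hk(3) using hA A_closed by (simp add: j_add j_scaleC)
  have "j (adj d) = j h - scaleC \<i> (j k)" unfolding ad using hA A_closed by (simp add: j_diff j_scaleC)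
  then show ?thesis unfolding jd by (simp add: adj_add adj_scaleC j_selfadj hA hk(1,2) scaleC_minus_left)
qed

end

section \<open>Transporting normalizer vectors to a representation of the cover\<close>

locale cover_state = cover D A j + generic_state D V b \<omega>
  for D A :: "'a::cstar_algebra set" and j :: "'a \<Rightarrow> 'b::cstar_algebra" and V b \<omega> +
  fixes u :: 'a and \<phi> :: "'b \<Rightarrow> complex"
  assumes u_W: "u \<in> W" and u_norm: "seminorm \<omega> u = 1"
    and u_sep: "w \<in> V \<Longrightarrow> mass w \<noteq> 0 \<Longrightarrow> \<omega> (adj w * u) \<noteq> 0"
    and \<phi>: "cstate \<phi>" and \<phi>_j: "a \<in> A \<Longrightarrow> \<phi> (j a) = \<omega> (adj u * a * u)"
begin

definition K :: "'a set" where
  "K = {w \<in> V. mass w \<noteq> 0}"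

definition coord :: "'a \<Rightarrow> complex" where
  "coord w = \<omega> (adj w * u) / mass w"

text \<open>The vectors \<open>bump w n * u\<close> tend to \<open>coord w\<close> times
  \<open>w\<close>. Applied through \<open>j\<close> to the cyclic vector of \<phi>, which
  corresponds to \<open>u\<close>, the same bumps divided by \<open>coord w\<close> must therefore
  yield the partner of \<open>w\<close>; this division is why no coordinate of \<open>u\<close> may
  vanish.\<close>

definition \<zeta> :: "'a \<Rightarrow> nat \<Rightarrow> 'b" where
  "\<zeta> w n = scaleC (1 / coord w) (j (bump w n))"

lemma coord_nonzero: "w \<in> K \<Longrightarrow> coord w \<noteq> 0"
  using u_sep by (simp add: K_def coord_def)

lemma bump_u: "w \<in> K \<Longrightarrow> (\<lambda>n. seminorm \<omega> (bump w n * u - scaleC (coord w) w)) \<longlonglongrightarrow> 0"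
  unfolding K_def coord_def using bump_tendsto[OF _ _ u_W] by simp

lemma bump_A: "w \<in> K \<Longrightarrow> bump w n \<in> A"
  using bump_D D_A by (auto simp: K_def)

lemma j_bump_adj: "w \<in> K \<Longrightarrow> adj (j (bump w n)) = j (bump w n)"
  using j_adj[OF bump_D] by (simp add: K_def bump_adj)

text \<open>\<open>bump v n * a * bump w n\<close> lies in \<open>A\<close>, where \<phi> is known,
  and the bumps applied to \<open>u\<close> converge.\<close>

lemma \<zeta>_pairing:
  assumes v: "v \<in> K" and w: "w \<in> K" and a: "a \<in> A"
  shows "(\<lambda>n. \<phi> (adj (\<zeta> v n) * (j a * \<zeta> w n))) \<longlonglongrightarrow> \<omega> (adj v * (a * w))"
proof -
  let ?c = "cnj (1 / coord v) * (1 / coord w)"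
  have "\<phi> (adj (\<zeta> v n) * (j a * \<zeta> w n)) = ?c * \<omega> (adj (bump v n * u) * (a * (bump w n * u)))" for n
  proof -
    have "adj (\<zeta> v n) * (j a * \<zeta> w n) = scaleC ?c (j (bump v n) * j a * j (bump w n))"
      by (simp add: \<zeta>_def adj_scaleC j_bump_adj[OF v] mult_scaleC_left mult_scaleC_right scaleC_scaleC mult.assoc
          mult.commute[of "coord w"])
    also have "j (bump v n) * j a * j (bump w n) = j (bump v n * a * bump w n)"
      using bump_A[OF v] bump_A[OF w] a A_closed by (simp add: j_mult)
    finally have "\<phi> (adj (\<zeta> v n) * (j a * \<zeta> w n)) = ?c * \<omega> (adj u * (bump v n * a * bump w n) * u)"
      using bump_A[OF v] bump_A[OF w] a A_closed(2) by (simp add: cstate_scaleC[OF \<phi>] \<phi>_j)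
    then show ?thesis by (simp add: adj_mult bump_adj mult.assoc)
  qed
  moreover have "(\<lambda>n. ?c * \<omega> (adj (bump v n * u) * (a * (bump w n * u))))
      \<longlonglongrightarrow> ?c * \<omega> (adj (scaleC (coord v) v) * (a * scaleC (coord w) w))"
    by (intro tendsto_mult_left cstate_pairing_tendsto \<omega> bump_u v w)
  moreover have "?c * \<omega> (adj (scaleC (coord v) v) * (a * scaleC (coord w) w)) = \<omega> (adj v * (a * w))"
    using coord_nonzero[OF v] coord_nonzero[OF w]
    by (simp add: adj_scaleC mult_scaleC_left mult_scaleC_right scaleC_scaleC cstate_scaleC[OF \<omega>])
  ultimately show ?thesis by simp
qed

lemma j_1_\<zeta>: "w \<in> K \<Longrightarrow> j 1 * \<zeta> w n = \<zeta> w n"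
  by (simp add: \<zeta>_def mult_scaleC_right j_1_mult bump_A)

sublocale matched_vectors \<omega> \<phi> K \<zeta>
proof
  fix v w assume vw: "v \<in> K" "w \<in> K"
  show "(\<lambda>n. \<phi> (adj (\<zeta> v n) * \<zeta> w n)) \<longlonglongrightarrow> \<omega> (adj v * w)"
    using \<zeta>_pairing[OF vw A_1] by (simp add: j_1_\<zeta> vw(2))
qed (rule \<omega> \<phi>)+

lemma cspan_V_matched: "z \<in> cspan V \<Longrightarrow> \<exists>Y. matched z Y"
proof -
  have "cspan V \<subseteq> {z. \<exists>Y. matched z Y}"
  proof (rule cspan_minimal)
    show "csubspace {z. \<exists>Y. matched z Y}"
      unfolding csubspace_def by (blast intro: matched.zero matched.add matched.scale)
    show "V \<subseteq> {z. \<exists>Y. matched z Y}"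
    proof
      fix v assume v: "v \<in> V"
      show "v \<in> {z. \<exists>Y. matched z Y}"
      proof (cases "mass v = 0")
        case True
        have "matched v (\<lambda>_. 0)"
        proof (rule matched.limit)
          fix e :: real assume "e > 0"
          then show "\<exists>X' Y'. matched X' Y' \<and> seminorm \<omega> (v - X') \<le> e \<and> (\<forall>\<^sub>F n in sequentially. seminorm \<phi> (0 - Y' n) \<le> e)"
            using True matched.zero by (intro exI[of _ 0] exI[of _ "\<lambda>_. 0"]) (auto simp: mass_def seminorm_def cstate_0[OF \<phi>])
        qed
        then show ?thesis by blast
      next
        case False
        then have "matched v (\<zeta> v)" using v by (intro matched.base) (simp add: K_def)
        then show ?thesis by blast
      qed
    qed
  qed
  then show "z \<in> cspan V \<Longrightarrow> \<exists>Y. matched z Y" by blast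
qed

lemma W_approx_matched:
  assumes "z \<in> W" "e > 0"
  shows "\<exists>X' Y'. matched X' Y' \<and> seminorm \<omega> (z - X') \<le> e"
proof -
  obtain z' where z': "z' \<in> cspan V" "dist z' z < e" using assms unfolding W_def closure_approachable by blast
  then have "seminorm \<omega> (z - z') \<le> e"
    using seminorm_le_norm[OF \<omega>, of "z - z'"] by (simp add: dist_norm norm_minus_commute)
  then show ?thesis using cspan_V_matched[OF z'(1)] by blast
qed

text \<open>\<open>\<zeta> w n\<close> is almost fixed by \<open>j (bump w m)\<close>, so the length
  of \<open>y\<close> on it is controlled by
  \<open>norm (y * j (bump w m)) = norm (x * bump w m)\<close>, which \<open>norm_mult_bump\<close>
  compares with the length of \<open>x * w\<close>. The form with a pair x, y serves both
  \<open>a\<close>, \<open>j a\<close> and their adjoints.\<close>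

lemma seminorm_\<zeta>_le:
  assumes w: "w \<in> K" and x: "x \<in> W" and iso: "\<And>d. d \<in> D \<Longrightarrow> adj d = d \<Longrightarrow> norm (y * j d) = norm (x * d)" and e: "e > 0"
  shows "\<forall>\<^sub>F n in sequentially. seminorm \<phi> (y * \<zeta> w n) \<le> seminorm \<omega> (x * w) + e"
proof -
  have wV: "w \<in> V" "mass w \<noteq> 0" using w by (auto simp: K_def)
  have xW: "adj w * (adj x * x) * w \<in> W" using wV V_subset_W x by (intro W_mult W_adj) auto
  obtain m where m: "norm (x * bump w m) * seminorm \<omega> w \<le> seminorm \<omega> (x * w) + e / 2"
    using norm_mult_bump[OF wV xW, of "e / 2"] e by auto
  let ?r = "\<lambda>n. norm (bump w m * bump w n - bump w n)"
  have le: "seminorm \<phi> (y * \<zeta> w n) \<le> norm (x * bump w m) * seminorm \<phi> (\<zeta> w n) + norm y * (norm (1 / coord w) * ?r n)" for n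
  proof -
    have jj: "j (bump w m) * \<zeta> w n - \<zeta> w n = scaleC (1 / coord w) (j (bump w m * bump w n - bump w n))"
      using bump_A[OF w] A_closed by (simp add: \<zeta>_def j_diff j_mult mult_scaleC_right scaleC_diff_right)
    have "norm (j (bump w m * bump w n - bump w n)) = ?r n"
      using bump_A[OF w] A_closed by (intro isometric) auto
    then have nz: "norm (j (bump w m) * \<zeta> w n - \<zeta> w n) = norm (1 / coord w) * ?r n"
      unfolding jj norm_scaleC by simp
    have "y * \<zeta> w n = y * j (bump w m) * \<zeta> w n - y * (j (bump w m) * \<zeta> w n - \<zeta> w n)"
      by (simp add: right_diff_distrib mult.assoc)
    then have "seminorm \<phi> (y * \<zeta> w n) \<le> seminorm \<phi> (y * j (bump w m) * \<zeta> w n) + seminorm \<phi> (y * (j (bump w m) * \<zeta> w n - \<zeta> w n))"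
      using seminorm_triangle_diff[OF \<phi>] by metis
    also have "\<dots> \<le> norm (y * j (bump w m)) * seminorm \<phi> (\<zeta> w n) + norm y * norm (j (bump w m) * \<zeta> w n - \<zeta> w n)"
      by (intro add_mono seminorm_mult_le \<phi> order_trans[OF seminorm_mult_le[OF \<phi>]] mult_left_mono seminorm_le_norm) auto
    also have "norm (y * j (bump w m)) = norm (x * bump w m)"
      using bump_D[OF wV(1)] bump_adj by (intro iso) auto
    finally show ?thesis by (simp only: nz)
  qed
  have "(\<lambda>n. norm (x * bump w m) * seminorm \<phi> (\<zeta> w n) + norm y * (norm (1 / coord w) * ?r n))
      \<longlonglongrightarrow> norm (x * bump w m) * seminorm \<omega> w + norm y * (norm (1 / coord w) * 0)"
    by (intro tendsto_intros matched_seminorm matched.base w bump_absorb wV)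
  moreover have "norm (x * bump w m) * seminorm \<omega> w + norm y * (norm (1 / coord w) * 0) < seminorm \<omega> (x * w) + e"
    using m e by simp
  ultimately have "\<forall>\<^sub>F n in sequentially. norm (x * bump w m) * seminorm \<phi> (\<zeta> w n) + norm y * (norm (1 / coord w) * ?r n)
      < seminorm \<omega> (x * w) + e" by (rule order_tendstoD)
  then show ?thesis by eventually_elim (use le in \<open>meson le_less_trans less_imp_le\<close>)
qed

lemma intertwined_j:
  assumes a: "a \<in> A" "a \<in> W"
  shows "intertwined a (j a)"
proof (rule intertwinedI)
  fix w assume w: "w \<in> K"
  then have wW: "w \<in> W" using V_subset_W by (auto simp: K_def)
  show "matched (a * w) (\<lambda>n. j a * \<zeta> w n)"
  proof (rule matched_if_seminorm_le)
    show "\<forall>\<^sub>F n in sequentially. seminorm \<phi> (j a * \<zeta> w n) \<le> seminorm \<omega> (a * w) + e" if "e > 0" for e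
    proof (rule seminorm_\<zeta>_le[OF w a(2) _ that])
      fix d assume "d \<in> D"
      then have "d \<in> A" using D_A by blast
      then show "norm (j a * j d) = norm (a * d)" using a A_closed by (simp add: j_mult[symmetric] isometric)
    qed
    show "(\<lambda>n. \<phi> (adj (\<zeta> v n) * (j a * \<zeta> w n))) \<longlonglongrightarrow> \<omega> (adj v * (a * w))" if "v \<in> K" for v
      by (rule \<zeta>_pairing[OF that w a(1)])
    show "\<exists>X' Y'. matched X' Y' \<and> seminorm \<omega> (a * w - X') \<le> e" if "e > 0" for e
      by (rule W_approx_matched[OF W_mult[OF a(2) wW] that])
  qed
qed

lemma intertwined_j_adj:
  assumes a: "a \<in> A" "a \<in> W"
  shows "intertwined (adj a) (adj (j a))"
proof (rule intertwinedI)
  fix w assume w: "w \<in> K"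
  then have wW: "w \<in> W" using V_subset_W by (auto simp: K_def)
  show "matched (adj a * w) (\<lambda>n. adj (j a) * \<zeta> w n)"
  proof (rule matched_if_seminorm_le)
    show "\<forall>\<^sub>F n in sequentially. seminorm \<phi> (adj (j a) * \<zeta> w n) \<le> seminorm \<omega> (adj a * w) + e" if "e > 0" for e
    proof (rule seminorm_\<zeta>_le[OF w W_adj[OF a(2)] _ that])
      fix d assume d: "d \<in> D" "adj d = d"
      then have dA: "d \<in> A" using D_A by blast
      \<comment> \<open>Taking adjoints turns the product into \<open>j (d * a)\<close>, the image
        of an element of \<open>A\<close>.\<close>
      have "norm (adj (j a) * j d) = norm (adj (adj (j a) * j d))" by simp
      also have "adj (adj (j a) * j d) = j (d * a)"
        using j_adj[OF d(1)] d(2) by (simp add: adj_mult adj_adj j_mult dA a)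
      also have "norm (j (d * a)) = norm (d * a)" using dA a A_closed by (intro isometric) auto
      also have "\<dots> = norm (adj (d * a))" by simp
      also have "adj (d * a) = adj a * d" by (simp add: adj_mult d)
      finally show "norm (adj (j a) * j d) = norm (adj a * d)" .
    qed
    show "(\<lambda>n. \<phi> (adj (\<zeta> v n) * (adj (j a) * \<zeta> w n))) \<longlonglongrightarrow> \<omega> (adj v * (adj a * w))" if v: "v \<in> K" for v
    proof -
      have "(\<lambda>n. cnj (\<phi> (adj (\<zeta> w n) * (j a * \<zeta> v n)))) \<longlonglongrightarrow> cnj (\<omega> (adj w * (a * v)))"
        by (intro tendsto_cnj \<zeta>_pairing w v a)
      then show ?thesis
        by (simp only: cstate_adj[OF \<phi>, symmetric] cstate_adj[OF \<omega>, symmetric]) (simp add: adj_mult adj_adj mult.assoc)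
    qed
    show "\<exists>X' Y'. matched X' Y' \<and> seminorm \<omega> (adj a * w - X') \<le> e" if "e > 0" for e
      by (rule W_approx_matched[OF W_mult[OF W_adj[OF a(2)] wW] that])
  qed
qed

lemma star_pair_intertwined:
  assumes "star_pair S j x y" "S \<subseteq> A" "S \<subseteq> W"
  shows "intertwined x y"
  using assms(1)
  by (induction rule: star_pair.induct)
    (use assms(2,3) intertwined_j intertwined_j_adj intertwined_add intertwined_mult intertwined_scaleC in auto)

lemma intertwined_seminorm_le:
  assumes "intertwined x y"
  shows "seminorm \<omega> x \<le> norm y"
proof -
  have 1: "1 \<in> K" using V_1 by (simp add: K_def mass_def seminorm_1)
  have "matched (x * 1) (\<lambda>n. y * \<zeta> 1 n)" using assms matched.base[OF 1] unfolding intertwined_def by blast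
  then have "(\<lambda>n. seminorm \<phi> (y * \<zeta> 1 n)) \<longlonglongrightarrow> seminorm \<omega> (x * 1)" by (rule matched_seminorm)
  moreover have "(\<lambda>n. norm y * seminorm \<phi> (\<zeta> 1 n)) \<longlonglongrightarrow> norm y * seminorm \<omega> 1"
    by (intro tendsto_mult_left matched_seminorm matched.base 1)
  ultimately have "seminorm \<omega> (x * 1) \<le> norm y * seminorm \<omega> 1"
    by (rule LIMSEQ_le) (use seminorm_mult_le[OF \<phi>] in blast)
  then show ?thesis by (simp add: seminorm_1)
qed

end


section \<open>The norm inequality for star pairs and the resulting homomorphism\<close>

context cover
begin

text \<open>If \<open>norm y < norm x\<close>, choose \<open>\<beta>\<close> strictly between \<open>norm y ^ 2\<close> and \<open>norm x ^ 2\<close> and a generic state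
  that sees the positive part \<open>k\<close> of \<open>adj x * x - \<beta>\<close>. In this state the powers of \<open>adj x * x\<close> grow
  like \<open>\<beta> ^ n\<close>, while the powers of \<open>adj y * y\<close> bound them by \<open>norm y ^ (2 * n)\<close>.\<close>

lemma star_pair_norm_le:
  assumes xy: "star_pair A j x y"
  shows "norm x \<le> norm y"
proof (rule ccontr)
  assume "\<not> norm x \<le> norm y"
  then have "norm y ^ 2 < norm x ^ 2" by (intro power_strict_mono) auto
  then obtain \<beta> where \<beta>: "norm y ^ 2 < \<beta>" "\<beta> < norm x ^ 2" using dense by blast
  have \<beta>0: "\<beta> > 0" using \<beta>(1) zero_le_power2[of "norm y"] by linarith
  define h where "h = adj x * x"
  have h: "cpos h" unfolding h_def by (rule cpos_adj_mult)
  define z where "z = h - \<beta> *\<^sub>R 1"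
  have az: "adj z = z" by (simp add: z_def adj_diff adj_scaleR cpos_adj[OF h])
  define k where "k = ppart z"
  have k: "cpos k" "cpos (k - z)" "k * (k - z) = 0" using pparts[OF az] by (auto simp: k_def)
  have hk: "h * k = k * h"
  proof -
    have "k \<in> {y. \<forall>x\<in>{h}. x * y = y * x}"
      unfolding k_def by (rule pparts(5)[OF az unital_closed_commutant]) (simp add: z_def algebra_simps)
    then show ?thesis by simp
  qed
  have "k \<noteq> 0"
  proof
    assume "k = 0"
    then have "norm h \<le> \<beta>" using k(2) by (intro norm_le_if_cpos h) (simp add: z_def)
    then show False using \<beta> by (simp add: h_def cstar_identity)
  qed
  then obtain d0 \<delta> where d0: "live D d0" "\<delta> > 0" "\<And>d. live D d \<Longrightarrow> d0 * d = d \<Longrightarrow> \<delta> \<le> norm (k * d)"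
    using bounded_below_locally by blast
  obtain F where F: "finite F" "F \<subseteq> A" "star_pair F j x y" using star_pair_finite[OF xy] by blast
  \<comment> \<open>\<open>k\<close> is adjoined so that \<omega> is excised at
    \<open>k * k\<close>; this is what makes \<omega> see \<open>k\<close>.\<close>
  have "countable (insert k F)" using F(1) by (simp add: countable_finite)
  then obtain V b \<omega> where gen: "generic_state D V b \<omega>" and FV: "insert k F \<subseteq> closure (cspan V)" and d0b: "\<And>i. d0 * b i = b i"
    using generic_state_exists[OF _ d0(1)] by blast
  interpret G: generic_state D V b \<omega> by (rule gen)
  obtain u where u: "u \<in> G.W" "seminorm \<omega> u = 1" "\<And>w. w \<in> V \<Longrightarrow> G.mass w \<noteq> 0 \<Longrightarrow> \<omega> (adj w * u) \<noteq> 0"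
    using G.separating_vector_exists by blast
  note \<omega> = G.\<omega>
  have "cmod (\<omega> (adj u * a * u)) \<le> norm a" for a
  proof -
    have "cmod (\<omega> (adj u * (a * u))) \<le> seminorm \<omega> (a * u) * seminorm \<omega> u" by (rule cstate_Cauchy_Schwarz[OF \<omega>])
    also have "\<dots> \<le> norm a" using seminorm_mult_le[OF \<omega>, of a u] u(2) by simp
    finally show ?thesis by (simp add: mult.assoc)
  qed
  moreover have "\<omega> (adj u * 1 * u) = 1" using cstate_adj_mult_self[OF \<omega>, of u] u(2) by simp
  ultimately obtain \<phi> where \<phi>: "cstate \<phi>" "\<And>a. a \<in> A \<Longrightarrow> \<phi> (j a) = \<omega> (adj u * a * u)"
    using cstate_extension[of "\<lambda>a. \<omega> (adj u * a * u)"]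
    by (auto simp: distrib_left distrib_right mult_scaleC_left mult_scaleC_right cstate_add[OF \<omega>] cstate_scaleC[OF \<omega>])
  interpret C: cover_state D A j V b \<omega> u \<phi>
    by unfold_locales (use u \<phi> in auto)
  have kW: "k \<in> G.W" and FW: "F \<subseteq> G.W" using FV by (auto simp: G.W_def)
  have pair: "C.intertwined h (adj y * y)" unfolding h_def
    by (intro C.intertwined_mult C.star_pair_intertwined[OF _ F(2) FW] F(3) star_pair_adj)
  have "C.intertwined (h ^ n) ((adj y * y) ^ n)" for n
  proof (induction n)
    case 0
    show ?case by (simp add: C.intertwined_def)
  next
    case (Suc n)
    then show ?case using C.intertwined_mult[OF pair Suc] by simp
  qed
  then have hn: "seminorm \<omega> (h ^ n) \<le> (norm y ^ 2) ^ n" for n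
    using C.intertwined_seminorm_le[of "h ^ n" "(adj y * y) ^ n"] norm_power_ineq[of "adj y * y" n]
    by (metis cstar_identity order_trans)
  define c where "c = k * k"
  have c: "cpos c" unfolding c_def by (rule cpos_square[OF cpos_adj[OF k(1)]])
  have hc: "h * c = \<beta> *\<^sub>R c + k * c" "h * c = c * h"
  proof -
    have "k * h = k * k + \<beta> *\<^sub>R k" using k(3) by (simp add: z_def algebra_simps)
    then have "h * k = k * k + \<beta> *\<^sub>R k" by (simp only: hk)
    then show "h * c = \<beta> *\<^sub>R c + k * c" unfolding c_def mult.assoc[symmetric] by (simp add: distrib_right)
    show "h * c = c * h" unfolding c_def using hk by (metis mult.assoc)
  qed
  have kc: "cpos (k * c)" unfolding c_def
    by (rule cpos_mult_commute[OF k(1) c[unfolded c_def]]) (simp add: mult.assoc)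
  have hnc: "h * h ^ n = h ^ n * h" for n by (simp add: power_commutes)
  have growth: "cpos (h ^ n * c - \<beta> ^ n *\<^sub>R c)" for n
  proof (induction n)
    case (Suc n)
    let ?T = "h ^ n * c - \<beta> ^ n *\<^sub>R c"
    have "h * ?T = ?T * h" using hnc[of n] hc(2) by (simp add: algebra_simps) (metis mult.assoc)
    then have "cpos (h * ?T)" by (rule cpos_mult_commute[OF h Suc])
    moreover have "cpos (\<beta> ^ n *\<^sub>R (k * c))" using \<beta>0 by (intro cpos_scaleR kc) simp
    moreover have "h ^ Suc n * c - \<beta> ^ Suc n *\<^sub>R c = h * ?T + \<beta> ^ n *\<^sub>R (k * c)"
    proof -
      have "h * ?T = h ^ Suc n * c - \<beta> ^ n *\<^sub>R (h * c)" by (simp add: right_diff_distrib mult.assoc)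
      then show ?thesis unfolding hc(1) by (simp add: scaleR_add_right mult.commute)
    qed
    ultimately show ?case using cpos_add by metis
  qed simp
  \<comment> \<open>Here \<omega> at h^n c is estimated from both sides: from below by
    \<open>growth\<close>, from above by Cauchy-Schwarz and \<open>hn\<close>.\<close>
  have lower: "\<beta> ^ n * seminorm \<omega> k ^ 2 \<le> (norm y ^ 2) ^ n * norm c" for n
  proof -
    obtain s where s: "cpos s" "s * s = h ^ n * c - \<beta> ^ n *\<^sub>R c" using cpos_sqrt[OF growth] by blast
    have "0 \<le> Re (\<omega> (h ^ n * c - \<beta> ^ n *\<^sub>R c))" using cstate_pos[OF \<omega>, of s] s by (simp add: cpos_adj)
    then have "\<beta> ^ n * Re (\<omega> c) \<le> Re (\<omega> (h ^ n * c))" by (simp add: cstate_diff[OF \<omega>] cstate_scaleR[OF \<omega>])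
    also have "\<dots> \<le> cmod (\<omega> (adj (h ^ n) * c))" using complex_Re_le_cmod by (simp add: adj_power cpos_adj[OF h])
    also have "\<dots> \<le> seminorm \<omega> c * seminorm \<omega> (h ^ n)" by (rule cstate_Cauchy_Schwarz[OF \<omega>])
    also have "\<dots> \<le> norm c * (norm y ^ 2) ^ n"
      by (intro mult_mono seminorm_le_norm[OF \<omega>] hn seminorm_nonneg[OF \<omega>]) simp
    finally show ?thesis using seminorm_square[OF \<omega>, of k] by (simp add: c_def cpos_adj[OF k(1)] mult.commute)
  qed
  have "\<delta>\<^sup>2 \<le> seminorm \<omega> k ^ 2"
  proof -
    have "\<delta>\<^sup>2 \<le> norm (G.defect i c) + seminorm \<omega> k ^ 2" for i
    proof -
      have "\<delta>\<^sup>2 \<le> norm (k * b i) ^ 2" using d0(2,3) G.b_live d0b by (intro power_mono) auto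
      also have "\<dots> = norm (adj (k * b i) * (k * b i))" by (simp only: cstar_identity)
      also have "adj (k * b i) * (k * b i) = G.defect i c + scaleC (\<omega> c) (b i * b i)"
        by (simp add: G.defect_def c_def adj_mult G.b_adj cpos_adj[OF k(1)] mult.assoc)
      also have "norm \<dots> \<le> norm (G.defect i c) + norm (scaleC (\<omega> c) (b i * b i))" by (rule norm_triangle_ineq)
      also have "norm (scaleC (\<omega> c) (b i * b i)) = cmod (\<omega> (adj k * k))"
        by (simp add: norm_scaleC live_norm_square[OF G.b_live] c_def cpos_adj[OF k(1)])
      also have "\<dots> = seminorm \<omega> k ^ 2" by (simp add: cstate_adj_mult_self[OF \<omega>] norm_power)
      finally show ?thesis .
    qed
    moreover have "(\<lambda>i. norm (G.defect i c) + seminorm \<omega> k ^ 2) \<longlonglongrightarrow> 0 + seminorm \<omega> k ^ 2"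
      unfolding c_def by (intro tendsto_intros G.defect_tendsto_0 G.W_mult kW)
    ultimately have "\<delta>\<^sup>2 \<le> 0 + seminorm \<omega> k ^ 2" by (intro LIMSEQ_le_const) auto
    then show ?thesis by simp
  qed
  define r where "r = norm y ^ 2 / \<beta>"
  have r: "0 \<le> r" "r < 1" using \<beta> \<beta>0 by (simp_all add: r_def)
  have "\<delta>\<^sup>2 \<le> r ^ n * norm c" for n
  proof -
    have "\<beta> ^ n * \<delta>\<^sup>2 \<le> (norm y ^ 2) ^ n * norm c"
      using mult_left_mono[OF \<open>\<delta>\<^sup>2 \<le> seminorm \<omega> k ^ 2\<close>, of "\<beta> ^ n"] \<beta>0 lower[of n]
      by (meson less_imp_le order_trans zero_le_power)
    then have "\<delta>\<^sup>2 \<le> (norm y ^ 2) ^ n * norm c / \<beta> ^ n" using \<beta>0 by (simp add: pos_le_divide_eq mult.commute)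
    then show ?thesis by (simp add: r_def power_divide)
  qed
  moreover have "(\<lambda>n. r ^ n * norm c) \<longlonglongrightarrow> 0 * norm c"
    using r by (intro tendsto_mult_right LIMSEQ_power_zero) simp
  ultimately have "\<delta>\<^sup>2 \<le> 0 * norm c" by (intro LIMSEQ_le_const) auto
  then show False using d0(2) by simp
qed

text \<open>By \<open>star_pair_norm_le\<close> the second component determines the first, also in
  the closure; read from right to left this is the graph of the desired homomorphism.\<close>

definition graph :: "('a \<times> 'b) set" where
  "graph = closure {(x, y). star_pair A j x y}"

lemma graph_seqI: "(\<And>n. star_pair A j (f n) (g n)) \<Longrightarrow> f \<longlonglongrightarrow> x \<Longrightarrow> g \<longlonglongrightarrow> y \<Longrightarrow> (x, y) \<in> graph"
  unfolding graph_def closure_sequential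
  by (intro exI[of _ "\<lambda>n. (f n, g n)"]) (auto intro: tendsto_Pair)

lemma graph_seqE:
  assumes "(x, y) \<in> graph"
  obtains f g where "\<And>n. star_pair A j (f n) (g n)" "f \<longlonglongrightarrow> x" "g \<longlonglongrightarrow> y"
proof -
  obtain p where p: "\<And>n. p n \<in> {(x, y). star_pair A j x y}" "p \<longlonglongrightarrow> (x, y)"
    using assms unfolding graph_def closure_sequential by blast
  show ?thesis
  proof (rule that)
    show "star_pair A j (fst (p n)) (snd (p n))" for n using p(1)[of n] by (simp add: case_prod_unfold)
    show "(\<lambda>n. fst (p n)) \<longlonglongrightarrow> x" "(\<lambda>n. snd (p n)) \<longlonglongrightarrow> y" using tendsto_fst[OF p(2)] tendsto_snd[OF p(2)] by simp_all
  qed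
qed

lemma graph_elem: "a \<in> A \<Longrightarrow> (a, j a) \<in> graph"
  unfolding graph_def using closure_subset star_pair.elem by fastforce

lemma graph_add:
  assumes "(x, y) \<in> graph" "(x', y') \<in> graph"
  shows "(x + x', y + y') \<in> graph"
proof -
  obtain f g where "\<And>n. star_pair A j (f n) (g n)" "f \<longlonglongrightarrow> x" "g \<longlonglongrightarrow> y" by (rule graph_seqE[OF assms(1)], rule that)
  moreover obtain f' g' where "\<And>n. star_pair A j (f' n) (g' n)" "f' \<longlonglongrightarrow> x'" "g' \<longlonglongrightarrow> y'" by (rule graph_seqE[OF assms(2)], rule that)
  ultimately show ?thesis
    by (intro graph_seqI[of "\<lambda>n. f n + f' n" "\<lambda>n. g n + g' n"] star_pair.add tendsto_add)
qed

lemma graph_mult: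
  assumes "(x, y) \<in> graph" "(x', y') \<in> graph"
  shows "(x * x', y * y') \<in> graph"
proof -
  obtain f g where "\<And>n. star_pair A j (f n) (g n)" "f \<longlonglongrightarrow> x" "g \<longlonglongrightarrow> y" by (rule graph_seqE[OF assms(1)], rule that)
  moreover obtain f' g' where "\<And>n. star_pair A j (f' n) (g' n)" "f' \<longlonglongrightarrow> x'" "g' \<longlonglongrightarrow> y'" by (rule graph_seqE[OF assms(2)], rule that)
  ultimately show ?thesis
    by (intro graph_seqI[of "\<lambda>n. f n * f' n" "\<lambda>n. g n * g' n"] star_pair.mult tendsto_mult)
qed

lemma graph_scaleC:
  assumes "(x, y) \<in> graph"
  shows "(scaleC c x, scaleC c y) \<in> graph"
proof -
  obtain f g where "\<And>n. star_pair A j (f n) (g n)" "f \<longlonglongrightarrow> x" "g \<longlonglongrightarrow> y" by (rule graph_seqE[OF assms], rule that)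
  then show ?thesis
    by (intro graph_seqI[of "\<lambda>n. scaleC c (f n)" "\<lambda>n. scaleC c (g n)"] star_pair.scaleC tendsto_scaleC_right)
qed

lemma graph_adj:
  assumes "(x, y) \<in> graph"
  shows "(adj x, adj y) \<in> graph"
proof -
  obtain f g where "\<And>n. star_pair A j (f n) (g n)" "f \<longlonglongrightarrow> x" "g \<longlonglongrightarrow> y" by (rule graph_seqE[OF assms], rule that)
  then show ?thesis
    by (intro graph_seqI[of "\<lambda>n. adj (f n)" "\<lambda>n. adj (g n)"] star_pair_adj tendsto_adj)
qed

lemma graph_diff: "(x, y) \<in> graph \<Longrightarrow> (x', y') \<in> graph \<Longrightarrow> (x - x', y - y') \<in> graph"
  using graph_add[of x y "- x'" "- y'"] graph_scaleC[of x' y' "- 1"] by (simp add: scaleC_minus1)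

lemma graph_norm_le:
  assumes "(x, y) \<in> graph"
  shows "norm x \<le> norm y"
proof -
  obtain f g where fg: "\<And>n. star_pair A j (f n) (g n)" "f \<longlonglongrightarrow> x" "g \<longlonglongrightarrow> y" by (rule graph_seqE[OF assms], rule that)
  show ?thesis
    by (rule LIMSEQ_le[OF tendsto_norm[OF fg(2)] tendsto_norm[OF fg(3)]]) (use star_pair_norm_le[OF fg(1)] in blast)
qed

lemma graph_unique: "(x, y) \<in> graph \<Longrightarrow> (x', y) \<in> graph \<Longrightarrow> x = x'"
  using graph_norm_le[OF graph_diff, of x y x' y] by simp

text \<open>Only closedness needs an argument: if second components converge,
  \<open>graph_norm_le\<close> makes the first components a Cauchy sequence.\<close>

lemma cstar_subalgebra_snd_graph: "cstar_subalgebra (snd ` graph)"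
  unfolding cstar_subalgebra_def csubalgebra_def csubspace_def
proof (intro conjI ballI allI)
  show "0 \<in> snd ` graph"
    using graph_elem[OF csubspaceD(1)[OF A_subspace]] by (rule rev_image_eqI) (simp add: j_0)
  show "closed (snd ` graph)" unfolding closed_sequential_limits
  proof (intro allI impI, elim conjE)
    fix g y assume g: "\<forall>n. g n \<in> snd ` graph" "g \<longlonglongrightarrow> y"
    then have "\<forall>n. \<exists>x. (x, g n) \<in> graph" by (metis imageE prod.collapse)
    then obtain f where f: "\<And>n. (f n, g n) \<in> graph" by metis
    have "Cauchy g" using g(2) LIMSEQ_imp_Cauchy by blast
    have "Cauchy f"
    proof (rule CauchyI)
      fix e :: real assume "0 < e"
      then obtain M where "\<forall>m\<ge>M. \<forall>n\<ge>M. norm (g m - g n) < e" using CauchyD[OF \<open>Cauchy g\<close>] by blast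
      then show "\<exists>M. \<forall>m\<ge>M. \<forall>n\<ge>M. norm (f m - f n) < e"
        using graph_norm_le[OF graph_diff[OF f f]] le_less_trans by blast
    qed
    then obtain x where "f \<longlonglongrightarrow> x" using convergent_eq_Cauchy by blast
    then have lim: "(\<lambda>n. (f n, g n)) \<longlonglongrightarrow> (x, y)" using g(2) by (rule tendsto_Pair)
    have "closed graph" by (simp add: graph_def)
    then have "(x, y) \<in> graph" by (rule closed_sequentially[OF _ f lim])
    then show "y \<in> snd ` graph" by (rule rev_image_eqI) simp
  qed
next
  fix y y' assume "y \<in> snd ` graph" "y' \<in> snd ` graph"
  then obtain x x' where "(x, y) \<in> graph" "(x', y') \<in> graph" by auto
  then show "y + y' \<in> snd ` graph" "y * y' \<in> snd ` graph"
    by (auto intro: rev_image_eqI[OF graph_add] rev_image_eqI[OF graph_mult])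
next
  fix c y assume "y \<in> snd ` graph"
  then obtain x where "(x, y) \<in> graph" by auto
  then show "scaleC c y \<in> snd ` graph" "adj y \<in> snd ` graph"
    by (auto intro: rev_image_eqI[OF graph_scaleC] rev_image_eqI[OF graph_adj])
qed

lemma cstar_subalgebra_cstar_gen: "cstar_subalgebra (cstar_gen S)" for S :: "'c::cstar_algebra set"
  unfolding cstar_gen_def cstar_subalgebra_def csubalgebra_def csubspace_def by auto

lemma fst_graph: "(x, y) \<in> graph \<Longrightarrow> x \<in> cstar_gen A"
proof (elim graph_seqE)
  fix f g assume fg: "\<And>n. star_pair A j (f n) (g n)" "f \<longlonglongrightarrow> x"
  have B: "cstar_subalgebra (cstar_gen A)" by (rule cstar_subalgebra_cstar_gen)
  have AB: "A \<subseteq> cstar_gen A" by (auto simp: cstar_gen_def)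
  have "star_pair A j x y \<Longrightarrow> x \<in> cstar_gen A" for x y
    by (induction rule: star_pair.induct)
      (use B AB in \<open>auto simp: cstar_subalgebra_def csubalgebra_def csubspace_def\<close>)
  then have f: "f n \<in> cstar_gen A" for n using fg(1) by blast
  have "closed (cstar_gen A)" using B by (simp add: cstar_subalgebra_def)
  then show "x \<in> cstar_gen A" by (rule closed_sequentially[OF _ f fg(2)])
qed

lemma retraction_exists:
  "\<exists>\<pi>. star_hom_on (cstar_gen (j ` A)) \<pi> \<and> \<pi> ` cstar_gen (j ` A) \<subseteq> cstar_gen A \<and> (\<forall>a\<in>A. \<pi> (j a) = a)"
proof -
  define \<pi> where "\<pi> y = (THE x. (x, y) \<in> graph)" for y
  have \<pi>_eq: "\<pi> y = x" if "(x, y) \<in> graph" for x y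
    unfolding \<pi>_def using that graph_unique by blast
  have "j ` A \<subseteq> snd ` graph" by (auto intro: rev_image_eqI[OF graph_elem])
  then have gen: "cstar_gen (j ` A) \<subseteq> snd ` graph"
    using cstar_subalgebra_snd_graph unfolding cstar_gen_def by blast
  have \<pi>: "(\<pi> y, y) \<in> graph" if y: "y \<in> cstar_gen (j ` A)" for y
  proof -
    obtain x where "(x, y) \<in> graph" using y gen by auto
    then show ?thesis using \<pi>_eq by simp
  qed
  show ?thesis
  proof (intro exI[of _ \<pi>] conjI ballI)
    show "star_hom_on (cstar_gen (j ` A)) \<pi>"
      unfolding star_hom_on_def chom_on_def
      by (auto intro!: \<pi>_eq graph_add graph_mult graph_scaleC graph_adj \<pi>)
    show "\<pi> ` cstar_gen (j ` A) \<subseteq> cstar_gen A" using \<pi> fst_graph by blast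
    show "\<pi> (j a) = a" if "a \<in> A" for a using that by (intro \<pi>_eq graph_elem)
  qed
qed

end

theorem theorem7p1:
  fixes D A :: "'a::cstar_algebra set"
  assumes "pseudo_cartan D"
    and "closed_subalgebra A"
    and "D \<subseteq> A"
  shows "cstar_envelope A (id :: 'a \<Rightarrow> 'a) TYPE('b::cstar_algebra)"
  unfolding cstar_envelope_def
proof (intro conjI allI impI)
  show "cstar_cover A (id :: 'a \<Rightarrow> 'a)"
    by (simp add: cstar_cover_def chom_on_def completely_isometric_on_def)
  fix j :: "'a \<Rightarrow> 'b" assume j: "cstar_cover A j"
  have "1 \<in> D" using assms(1) by (simp add: pseudo_cartan_def)
  interpret cover D A j
    by unfold_locales
      (use assms j \<open>1 \<in> D\<close> completely_isometric_norm in
        \<open>auto simp: closed_subalgebra_def cstar_cover_def\<close>)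
  show "\<exists>\<pi>. star_hom_on (cstar_gen (j ` A)) \<pi> \<and> \<pi> ` cstar_gen (j ` A) \<subseteq> cstar_gen (id ` A) \<and>
      (\<forall>a\<in>A. \<pi> (j a) = id a)"
    using retraction_exists by simp
qed

end
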